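(* The following statement (the Valuation Extension Lemma for $\mathbf{LTL}$) is provable in $\mathrm{ACA}'_0$: for each $\mathbf{LTL}$-frame $F=(S,R)$ and each $v:S\times\mathrm{Prop}\to\{0,1\}$, there exists an $\mathbf{LTL}$-valuation $V$ on $(S,R)$ such that $V$ is an extension of $v$.
   Context: Setting: second-order arithmetic. $\mathrm{RCA}_0$ consists of Robinson arithmetic, $\Sigma^0_1$-induction and $\Delta^0_1$-comprehension. $\mathrm{ACA}'_0$ is $\mathrm{RCA}_0$ plus the axiom that for every set $X$ and every $n$ there is a set $Y$ with $Y=X^{(n)}$, the $n$-th Turing jump of $X$. $\mathrm{Prop}$ is an infinite set of propositional variables. $\mathrm{Fml}_{\mathbf{LTL}}$ is the set of formulas built from $\mathrm{Prop}\cup\{\bot\}$ by $\varphi\to\psi$, $\mathsf{X}\varphi$, $\varphi\,\mathsf{U}\,\psi$, coded as natural numbers. An $\mathbf{LTL}$-frame is a pair $(S,R)$ where $S=\{s_i\}_{i\in\mathbb{N}}$ is an infinite path by $R$, that is, $\forall i,j\in\mathbb{N}\,(i<j\to s_iRs_j)$. An $\mathbf{LTL}$-valuation on $(S,R)$ is a function (a set in the sense of second-order arithmetic) $V:S\times\mathrm{Fml}_{\mathbf{LTL}}\to\{0,1\}$ such that for any $i\in\mathbb{N}$ and any $\varphi,\psi\in\mathrm{Fml}_{\mathbf{LTL}}$: $V(s_i,\bot)=0$; $V(s_i,\varphi\to\psi)=1-V(s_i,\varphi)(1-V(s_i,\psi))$; $V(s_i,\mathsf{X}\varphi)=1\iff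 V(s_{i+1},\varphi)=1$; $V(s_i,\varphi\,\mathsf{U}\,\psi)=1\iff\exists n\ge i\bigl(\forall j(i\le j<n\to V(s_j,\varphi)=1)\land V(s_n,\psi)=1\bigr)$. *)

theory Defs
  imports Main
begin

section \<open>The language of second-order arithmetic\<close>

text \<open>
  Number variables and set variables are two separate families of de Bruijn indices:
  \<open>AllN\<close> binds number index 0 and \<open>AllS\<close> binds set index 0.
  Equality of sets is not primitive; it abbreviates having the same elements.
\<close>

datatype tm =
    Var nat
  | Zero
  | One
  | Add tm tm (infixl \<open>\<^bold>+\<close> 65)
  | Mul tm tm (infixl \<open>\<^bold>*\<close> 70)

datatype fm =
    Eq tm tm (infix \<open>\<^bold>=\<close> 55)
  | Less tm tm (infix \<open>\<^bold><\<close> 55)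
  | Mem tm nat (infix \<open>\<^bold>\<in>\<close> 55)
  | Bot
  | Imp fm fm (infixr \<open>\<^bold>\<longrightarrow>\<close> 40)
  | AllN fm
  | AllS fm

abbreviation Neg :: "fm \<Rightarrow> fm" (\<open>\<^bold>\<not> _\<close> [52] 52) where
  "\<^bold>\<not> \<phi> \<equiv> \<phi> \<^bold>\<longrightarrow> Bot"

abbreviation Or :: "fm \<Rightarrow> fm \<Rightarrow> fm" (infixr \<open>\<^bold>\<or>\<close> 45) where
  "\<phi> \<^bold>\<or> \<psi> \<equiv> \<^bold>\<not> \<phi> \<^bold>\<longrightarrow> \<psi>"

abbreviation And :: "fm \<Rightarrow> fm \<Rightarrow> fm" (infixr \<open>\<^bold>\<and>\<close> 50) where
  "\<phi> \<^bold>\<and> \<psi> \<equiv> \<^bold>\<not> (\<phi> \<^bold>\<longrightarrow> \<^bold>\<not> \<psi>)"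

abbreviation Iff :: "fm \<Rightarrow> fm \<Rightarrow> fm" (infix \<open>\<^bold>\<longleftrightarrow>\<close> 38) where
  "\<phi> \<^bold>\<longleftrightarrow> \<psi> \<equiv> (\<phi> \<^bold>\<longrightarrow> \<psi>) \<^bold>\<and> (\<psi> \<^bold>\<longrightarrow> \<phi>)"

abbreviation ExN :: "fm \<Rightarrow> fm" where
  "ExN \<phi> \<equiv> \<^bold>\<not> AllN (\<^bold>\<not> \<phi>)"

abbreviation ExS :: "fm \<Rightarrow> fm" where
  "ExS \<phi> \<equiv> \<^bold>\<not> AllS (\<^bold>\<not> \<phi>)"

primrec tsub :: "(nat \<Rightarrow> tm) \<Rightarrow> tm \<Rightarrow> tm" where
  "tsub \<sigma> (Var n) = \<sigma> n"
| "tsub \<sigma> Zero = Zero"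
| "tsub \<sigma> One = One"
| "tsub \<sigma> (t \<^bold>+ u) = tsub \<sigma> t \<^bold>+ tsub \<sigma> u"
| "tsub \<sigma> (t \<^bold>* u) = tsub \<sigma> t \<^bold>* tsub \<sigma> u"

definition shift :: "nat \<Rightarrow> tm \<Rightarrow> tm" where
  "shift k = tsub (\<lambda>n. Var (n + k))"

definition under :: "(nat \<Rightarrow> tm) \<Rightarrow> nat \<Rightarrow> tm" where
  "under \<sigma> = case_nat (Var 0) (\<lambda>n. shift 1 (\<sigma> n))"

definition underS :: "(nat \<Rightarrow> nat) \<Rightarrow> nat \<Rightarrow> nat" where
  "underS \<rho> = case_nat 0 (\<lambda>n. Suc (\<rho> n))"

text \<open>Simultaneous capture-avoiding substitution for the number variables\<close>

primrec nsub :: "(nat \<Rightarrow> tm) \<Rightarrow> fm \<Rightarrow> fm" where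
  "nsub \<sigma> (t \<^bold>= u) = (tsub \<sigma> t \<^bold>= tsub \<sigma> u)"
| "nsub \<sigma> (t \<^bold>< u) = (tsub \<sigma> t \<^bold>< tsub \<sigma> u)"
| "nsub \<sigma> (t \<^bold>\<in> X) = (tsub \<sigma> t \<^bold>\<in> X)"
| "nsub \<sigma> Bot = Bot"
| "nsub \<sigma> (\<phi> \<^bold>\<longrightarrow> \<psi>) = (nsub \<sigma> \<phi> \<^bold>\<longrightarrow> nsub \<sigma> \<psi>)"
| "nsub \<sigma> (AllN \<phi>) = AllN (nsub (under \<sigma>) \<phi>)"
| "nsub \<sigma> (AllS \<phi>) = AllS (nsub \<sigma> \<phi>)"

text \<open>and for the set variables, the only terms of the set sort.\<close>

primrec ssub :: "(nat \<Rightarrow> nat) \<Rightarrow> fm \<Rightarrow> fm" where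
  "ssub \<rho> (t \<^bold>= u) = (t \<^bold>= u)"
| "ssub \<rho> (t \<^bold>< u) = (t \<^bold>< u)"
| "ssub \<rho> (t \<^bold>\<in> X) = (t \<^bold>\<in> \<rho> X)"
| "ssub \<rho> Bot = Bot"
| "ssub \<rho> (\<phi> \<^bold>\<longrightarrow> \<psi>) = (ssub \<rho> \<phi> \<^bold>\<longrightarrow> ssub \<rho> \<psi>)"
| "ssub \<rho> (AllN \<phi>) = AllN (ssub \<rho> \<phi>)"
| "ssub \<rho> (AllS \<phi>) = AllS (ssub (underS \<rho>) \<phi>)"

definition lift :: "fm \<Rightarrow> fm" where
  "lift = nsub (\<lambda>n. Var (Suc n))"

definition liftS :: "fm \<Rightarrow> fm" where
  "liftS = ssub Suc"

definition inst :: "tm \<Rightarrow> fm \<Rightarrow> fm" where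
  "inst t = nsub (case_nat t Var)"

definition instS :: "nat \<Rightarrow> fm \<Rightarrow> fm" where
  "instS X = ssub (case_nat X (\<lambda>n. n))"


section \<open>Provability\<close>

text \<open>
  Classical two-sorted natural deduction with equality. \<open>T\<close> is the set of non-logical axioms and
  \<open>\<Gamma>\<close> the list of open assumptions. As usual, a non-logical axiom with free variables stands for
  its universal closure: rule \<open>Axm\<close> does not put it among the assumptions that \<open>AllI\<close> and
  \<open>AllSI\<close> have to lift.
\<close>

inductive derives :: "fm set \<Rightarrow> fm list \<Rightarrow> fm \<Rightarrow> bool" for T where
  Axm: "\<phi> \<in> T \<Longrightarrow> derives T \<Gamma> \<phi>"
| Asm: "\<phi> \<in> set \<Gamma> \<Longrightarrow> derives T \<Gamma> \<phi>"
| ImpI: "derives T (\<phi> # \<Gamma>) \<psi> \<Longrightarrow> derives T \<Gamma> (\<phi> \<^bold>\<longrightarrow> \<psi>)"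
| ImpE: "derives T \<Gamma> (\<phi> \<^bold>\<longrightarrow> \<psi>) \<Longrightarrow> derives T \<Gamma> \<phi> \<Longrightarrow> derives T \<Gamma> \<psi>"
| Classical: "derives T ((\<^bold>\<not> \<phi>) # \<Gamma>) Bot \<Longrightarrow> derives T \<Gamma> \<phi>"
| AllI: "derives T (map lift \<Gamma>) \<phi> \<Longrightarrow> derives T \<Gamma> (AllN \<phi>)"
| AllE: "derives T \<Gamma> (AllN \<phi>) \<Longrightarrow> derives T \<Gamma> (inst t \<phi>)"
| AllSI: "derives T (map liftS \<Gamma>) \<phi> \<Longrightarrow> derives T \<Gamma> (AllS \<phi>)"
| AllSE: "derives T \<Gamma> (AllS \<phi>) \<Longrightarrow> derives T \<Gamma> (instS X \<phi>)"
| Refl: "derives T \<Gamma> (t \<^bold>= t)"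
| Subst: "derives T \<Gamma> (t \<^bold>= u) \<Longrightarrow> derives T \<Gamma> (inst t \<phi>) \<Longrightarrow> derives T \<Gamma> (inst u \<phi>)"

definition provable :: "fm set \<Rightarrow> fm \<Rightarrow> bool" (infix \<open>\<turnstile>\<close> 30) where
  "T \<turnstile> \<phi> \<longleftrightarrow> derives T [] \<phi>"


section \<open>The theory \<open>RCA\<^sub>0\<close>\<close>

definition BAll :: "tm \<Rightarrow> fm \<Rightarrow> fm" where
  "BAll t \<phi> = AllN (Var 0 \<^bold>< shift 1 t \<^bold>\<longrightarrow> \<phi>)"

definition BEx :: "tm \<Rightarrow> fm \<Rightarrow> fm" where
  "BEx t \<phi> = \<^bold>\<not> BAll t (\<^bold>\<not> \<phi>)"

text \<open>Bounded formulas; number and set parameters are allowed.\<close>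

inductive bounded :: "fm \<Rightarrow> bool" where
  "bounded (t \<^bold>= u)"
| "bounded (t \<^bold>< u)"
| "bounded (t \<^bold>\<in> X)"
| "bounded Bot"
| "bounded \<phi> \<Longrightarrow> bounded \<psi> \<Longrightarrow> bounded (\<phi> \<^bold>\<longrightarrow> \<psi>)"
| "bounded \<phi> \<Longrightarrow> bounded (BAll t \<phi>)"

definition Sigma01 :: "fm set" where
  "Sigma01 = {ExN \<theta> | \<theta>. bounded \<theta>}"

definition Pi01 :: "fm set" where
  "Pi01 = {AllN \<theta> | \<theta>. bounded \<theta>}"

text \<open>Robinson arithmetic with the successor written as adding 1, and the order as a primitive.\<close>

definition Robinson :: "fm set" where
  "Robinson =
    (let m = Var 0; n = Var 1 in
     {\<^bold>\<not> (m \<^bold>+ One \<^bold>= Zero),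
      m \<^bold>+ One \<^bold>= n \<^bold>+ One \<^bold>\<longrightarrow> m \<^bold>= n,
      m \<^bold>= Zero \<^bold>\<or> ExN (Var 1 \<^bold>= Var 0 \<^bold>+ One),
      m \<^bold>+ Zero \<^bold>= m,
      m \<^bold>+ (n \<^bold>+ One) \<^bold>= (m \<^bold>+ n) \<^bold>+ One,
      m \<^bold>* Zero \<^bold>= Zero,
      m \<^bold>* (n \<^bold>+ One) \<^bold>= (m \<^bold>* n) \<^bold>+ m,
      \<^bold>\<not> (m \<^bold>< Zero),
      m \<^bold>< n \<^bold>+ One \<^bold>\<longleftrightarrow> (m \<^bold>< n \<^bold>\<or> m \<^bold>= n)})"

text \<open>
  In a scheme the distinguished number variable has index 0. In the induction step, the
  substitution sends index 0 to its successor and leaves the parameters alone.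
\<close>

definition induction_axiom :: "fm \<Rightarrow> fm" where
  "induction_axiom \<phi> =
    (inst Zero \<phi> \<^bold>\<and> AllN (\<phi> \<^bold>\<longrightarrow> nsub (case_nat (Var 0 \<^bold>+ One) (\<lambda>n. Var (Suc n))) \<phi>)
      \<^bold>\<longrightarrow> AllN \<phi>)"

text \<open>\<open>liftS\<close> ensures that the set being defined does not occur in its own definition.\<close>

definition comprehension_axiom :: "fm \<Rightarrow> fm" where
  "comprehension_axiom \<phi> = ExS (AllN (Var 0 \<^bold>\<in> 0 \<^bold>\<longleftrightarrow> liftS \<phi>))"

definition RCA0 :: "fm set" where
  "RCA0 = Robinson
    \<union> {induction_axiom \<phi> | \<phi>. \<phi> \<in> Sigma01}
    \<union> {AllN (\<phi> \<^bold>\<longleftrightarrow> \<psi>) \<^bold>\<longrightarrow> comprehension_axiom \<phi> | \<phi> \<psi>. \<phi> \<in> Sigma01 \<and> \<psi> \<in> Pi01}"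


section \<open>The Turing jump\<close>

text \<open>
  From here on, formulas depending on terms are functions on terms. Such a function shifts its
  arguments itself where it puts them below a binder, so that nothing is captured.
\<close>

primrec num :: "nat \<Rightarrow> tm" where
  "num 0 = Zero"
| "num (Suc n) = num n \<^bold>+ One"

definition le :: "tm \<Rightarrow> tm \<Rightarrow> fm" (infix \<open>\<^bold>\<le>\<close> 55) where
  "t \<^bold>\<le> u = (t \<^bold>< u \<^bold>\<or> t \<^bold>= u)"

text \<open>Twice the Cantor pairing function: a term, injective, and onto the even numbers\<close>

definition pair :: "tm \<Rightarrow> tm \<Rightarrow> tm" where
  "pair t u = (t \<^bold>+ u) \<^bold>* (t \<^bold>+ u \<^bold>+ One) \<^bold>+ num 2 \<^bold>* t"

definition triple :: "tm \<Rightarrow> tm \<Rightarrow> tm \<Rightarrow> tm" where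
  "triple t u w = pair t (pair u w)"

text \<open>
  Goedel's beta function: \<open>w\<close> is the remainder of \<open>c\<close> modulo \<open>1 + (i + 1) d\<close>, i.e. the \<open>i\<close>-th
  entry of the finite sequence coded by \<open>c\<close> and \<open>d\<close>. Entries are at most \<open>c\<close>.
\<close>

definition beta :: "tm \<Rightarrow> tm \<Rightarrow> tm \<Rightarrow> tm \<Rightarrow> fm" where
  "beta c d i w =
    (let m = One \<^bold>+ (i \<^bold>+ One) \<^bold>* d in
     w \<^bold>< m \<^bold>\<and> BEx (c \<^bold>+ One) (shift 1 c \<^bold>= Var 0 \<^bold>* shift 1 m \<^bold>+ shift 1 w))"

text \<open>
  Indices of the partial functions recursive in the oracle \<open>X\<close>, after Kleene and Shoenfield, in
  unary form (several arguments are passed as a \<open>pair\<close>). As in Shoenfield's book,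
  characteristic functions take the value 0 for true and 1 for false.

  \<^item> 0 identity; 1 and 2 first and second projection; 3 addition; 4 multiplication;
    5 characteristic function of the order; 6 characteristic function of \<open>X\<close>;
  \<^item> \<open>3 * pair f g + 7\<close>: the composition \<open>x \<mapsto> {f}({g}(x))\<close>;
  \<^item> \<open>3 * pair f g + 8\<close>: \<open>x \<mapsto> pair ({f}(x)) ({g}(x))\<close>;
  \<^item> \<open>3 * f + 9\<close>: \<open>x \<mapsto>\<close> the least \<open>y\<close> with \<open>{f}(pair x y) = 0\<close>, where \<open>{f}(pair x z)\<close> has to be
    defined and nonzero for all \<open>z < y\<close>.

  Functions 1 to 5 are undefined outside the range of \<open>pair\<close>; numbers that are not of
  one of these forms are indices of the nowhere defined function.

  A computation is a finite sequence of triples \<open>(e, x, y)\<close>, read as \<open>{e}(x) = y\<close>, each of which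
  is justified by earlier ones.
\<close>

definition comp_code :: "tm \<Rightarrow> tm \<Rightarrow> tm" where
  "comp_code f g = num 3 \<^bold>* pair f g \<^bold>+ num 7"

definition pairing_code :: "tm \<Rightarrow> tm \<Rightarrow> tm" where
  "pairing_code f g = num 3 \<^bold>* pair f g \<^bold>+ num 8"

definition mu_code :: "tm \<Rightarrow> tm" where
  "mu_code f = num 3 \<^bold>* f \<^bold>+ num 9"

text \<open>The triple \<open>(e, x, y)\<close> is one of the first \<open>i\<close> entries.\<close>

definition occurs :: "tm \<Rightarrow> tm \<Rightarrow> tm \<Rightarrow> tm \<Rightarrow> tm \<Rightarrow> tm \<Rightarrow> fm" where
  "occurs c d i e x y =
    BEx i (beta (shift 1 c) (shift 1 d) (Var 0) (shift 1 (triple e x y)))"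

definition basic_step :: "nat \<Rightarrow> tm \<Rightarrow> tm \<Rightarrow> tm \<Rightarrow> fm" where
  "basic_step X e x y =
    (let a = Var 1; b = Var 0; x2 = shift 2 x; y2 = shift 2 y;
         on_pair = (\<lambda>\<phi>. BEx (x \<^bold>+ One) (BEx (shift 1 x \<^bold>+ One) (x2 \<^bold>= pair a b \<^bold>\<and> \<phi>)))
     in (e \<^bold>= num 0 \<^bold>\<and> y \<^bold>= x)
      \<^bold>\<or> (e \<^bold>= num 1 \<^bold>\<and> on_pair (y2 \<^bold>= a))
      \<^bold>\<or> (e \<^bold>= num 2 \<^bold>\<and> on_pair (y2 \<^bold>= b))
      \<^bold>\<or> (e \<^bold>= num 3 \<^bold>\<and> on_pair (y2 \<^bold>= a \<^bold>+ b))
      \<^bold>\<or> (e \<^bold>= num 4 \<^bold>\<and> on_pair (y2 \<^bold>= a \<^bold>* b))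
      \<^bold>\<or> (e \<^bold>= num 5 \<^bold>\<and> on_pair ((a \<^bold>< b \<^bold>\<and> y2 \<^bold>= Zero) \<^bold>\<or> (\<^bold>\<not> (a \<^bold>< b) \<^bold>\<and> y2 \<^bold>= One)))
      \<^bold>\<or> (e \<^bold>= num 6 \<^bold>\<and> ((x \<^bold>\<in> X \<^bold>\<and> y \<^bold>= Zero) \<^bold>\<or> (\<^bold>\<not> (x \<^bold>\<in> X) \<^bold>\<and> y \<^bold>= One))))"

definition comp_step :: "tm \<Rightarrow> tm \<Rightarrow> tm \<Rightarrow> tm \<Rightarrow> tm \<Rightarrow> tm \<Rightarrow> fm" where
  "comp_step c d i e x y =
    BEx e (BEx (shift 1 e) (BEx (shift 2 c \<^bold>+ One)
      (let f = Var 2; g = Var 1; z = Var 0; s = shift 3 in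
       s e \<^bold>= comp_code f g
       \<^bold>\<and> occurs (s c) (s d) (s i) g (s x) z
       \<^bold>\<and> occurs (s c) (s d) (s i) f z (s y))))"

definition pairing_step :: "tm \<Rightarrow> tm \<Rightarrow> tm \<Rightarrow> tm \<Rightarrow> tm \<Rightarrow> tm \<Rightarrow> fm" where
  "pairing_step c d i e x y =
    BEx e (BEx (shift 1 e) (BEx (shift 2 y \<^bold>+ One) (BEx (shift 3 y \<^bold>+ One)
      (let f = Var 3; g = Var 2; a = Var 1; b = Var 0; s = shift 4 in
       s e \<^bold>= pairing_code f g
       \<^bold>\<and> s y \<^bold>= pair a b
       \<^bold>\<and> occurs (s c) (s d) (s i) f (s x) a
       \<^bold>\<and> occurs (s c) (s d) (s i) g (s x) b))))"

definition mu_step :: "tm \<Rightarrow> tm \<Rightarrow> tm \<Rightarrow> tm \<Rightarrow> tm \<Rightarrow> tm \<Rightarrow> fm" where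
  "mu_step c d i e x y =
    BEx e
      (let f = Var 0; s = shift 1 in
       s e \<^bold>= mu_code f
       \<^bold>\<and> occurs (s c) (s d) (s i) f (pair (s x) (s y)) Zero
       \<^bold>\<and> BAll (s y) (BEx (shift 2 c \<^bold>+ One)
           (let f = Var 2; z = Var 1; w = Var 0; s = shift 3 in
            \<^bold>\<not> (w \<^bold>= Zero) \<^bold>\<and> occurs (s c) (s d) (s i) f (pair (s x) z) w)))"

definition computation :: "nat \<Rightarrow> tm \<Rightarrow> tm \<Rightarrow> tm \<Rightarrow> fm" where
  "computation X c d l =
    BAll l (BEx (shift 1 c \<^bold>+ One) (BEx (shift 2 c \<^bold>+ One) (BEx (shift 3 c \<^bold>+ One)
      (let i = Var 3; e = Var 2; x = Var 1; y = Var 0; c' = shift 4 c; d' = shift 4 d in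
       beta c' d' i (triple e x y)
       \<^bold>\<and> (basic_step X e x y
          \<^bold>\<or> comp_step c' d' i e x y
          \<^bold>\<or> pairing_step c' d' i e x y
          \<^bold>\<or> mu_step c' d' i e x y)))))"

text \<open>\<open>{e}(x) = y\<close> relative to \<open>X\<close>\<close>

definition computes :: "nat \<Rightarrow> tm \<Rightarrow> tm \<Rightarrow> tm \<Rightarrow> fm" where
  "computes X e x y =
    ExN (ExN (ExN
      (let c = Var 2; d = Var 1; l = Var 0; s = shift 3 in
       computation X c d l \<^bold>\<and> occurs c d l (s e) (s x) (s y))))"

text \<open>\<open>Y = {e. {e}(e) is defined}\<close>, relative to \<open>X\<close>\<close>

definition is_jump :: "nat \<Rightarrow> nat \<Rightarrow> fm" where
  "is_jump X Y = AllN (Var 0 \<^bold>\<in> Y \<^bold>\<longleftrightarrow> ExN (computes X (Var 1) (Var 1) (Var 0)))"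

text \<open>\<open>W = {m. pair m i \<in> Z}\<close>, the \<open>i\<close>-th member of the sequence of sets coded by \<open>Z\<close>\<close>

definition is_section :: "nat \<Rightarrow> tm \<Rightarrow> nat \<Rightarrow> fm" where
  "is_section Z i W = AllN (Var 0 \<^bold>\<in> W \<^bold>\<longleftrightarrow> pair (Var 0) (shift 1 i) \<^bold>\<in> Z)"

text \<open>
  \<open>Y\<close> is the \<open>n\<close>-th jump of \<open>X\<close>: there is a sequence of sets \<open>Z\<close> (set index 0 below the binder,
  which pushes \<open>X\<close> and \<open>Y\<close> up by one) from \<open>X\<close> to \<open>Y\<close> with each of its first \<open>n\<close> members
  followed by its jump.
\<close>

definition is_iterated_jump :: "nat \<Rightarrow> tm \<Rightarrow> nat \<Rightarrow> fm" where
  "is_iterated_jump X n Y =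
    ExS (is_section 0 Zero (Suc X)
      \<^bold>\<and> is_section 0 n (Suc Y)
      \<^bold>\<and> BAll n (ExS (ExS
          (let Z = 2; W = 1; W' = 0; i = Var 0 in
           is_section Z i W \<^bold>\<and> is_section Z (i \<^bold>+ One) W' \<^bold>\<and> is_jump W W'))))"

definition ACA0' :: "fm set" where
  "ACA0' = RCA0 \<union> {AllS (AllN (ExS (is_iterated_jump 1 (Var 0) 0)))}"


section \<open>LTL inside second-order arithmetic\<close>

text \<open>
  The coding of LTL formulas is a bijection with the natural numbers: 0 is falsum, and the
  positive numbers are split according to their residue modulo 4, where \<open>2 * pair \<phi> \<psi>\<close> runs through
  all multiples of 4. The code of a formula exceeds those of its proper subformulas. So \<open>Fml\<close> is the set of all
  numbers, and \<open>Prop\<close> is the infinite set of all \<open>prop_code k\<close>.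
\<close>

definition bot_code :: tm where
  "bot_code = Zero"

definition prop_code :: "tm \<Rightarrow> tm" where
  "prop_code k = num 4 \<^bold>* k \<^bold>+ num 1"

definition imp_code :: "tm \<Rightarrow> tm \<Rightarrow> tm" where
  "imp_code \<phi> \<psi> = num 2 \<^bold>* pair \<phi> \<psi> \<^bold>+ num 2"

definition next_code :: "tm \<Rightarrow> tm" where
  "next_code \<phi> = num 4 \<^bold>* \<phi> \<^bold>+ num 3"

definition until_code :: "tm \<Rightarrow> tm \<Rightarrow> tm" where
  "until_code \<phi> \<psi> = num 2 \<^bold>* pair \<phi> \<psi> \<^bold>+ num 4"

text \<open>
  Classes, as formulas with one argument. They have no other free number variables, so
  \<open>product\<close> may use them below binders.
\<close>

definition Numbers :: "tm \<Rightarrow> fm" where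
  "Numbers t = (t \<^bold>= t)"

definition Bits :: "tm \<Rightarrow> fm" where
  "Bits t = (t \<^bold>= Zero \<^bold>\<or> t \<^bold>= One)"

definition Elements :: "nat \<Rightarrow> tm \<Rightarrow> fm" where
  "Elements S t = (t \<^bold>\<in> S)"

definition Fml :: "tm \<Rightarrow> fm" where
  "Fml t = Numbers t"

definition Prop :: "tm \<Rightarrow> fm" where
  "Prop t = ExN (shift 1 t \<^bold>= prop_code (Var 0))"

definition product :: "(tm \<Rightarrow> fm) \<Rightarrow> (tm \<Rightarrow> fm) \<Rightarrow> tm \<Rightarrow> fm" where
  "product A B t = ExN (ExN (shift 2 t \<^bold>= pair (Var 1) (Var 0) \<^bold>\<and> A (Var 1) \<^bold>\<and> B (Var 0)))"

definition included :: "nat \<Rightarrow> (tm \<Rightarrow> fm) \<Rightarrow> fm" where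
  "included X A = AllN (Var 0 \<^bold>\<in> X \<^bold>\<longrightarrow> A (Var 0))"

text \<open>The set \<open>F\<close> is (the graph of) a function from \<open>A\<close> to \<open>B\<close>.\<close>

definition is_function :: "nat \<Rightarrow> (tm \<Rightarrow> fm) \<Rightarrow> (tm \<Rightarrow> fm) \<Rightarrow> fm" where
  "is_function F A B =
    (included F (product A B)
     \<^bold>\<and> AllN (AllN (AllN (pair (Var 2) (Var 1) \<^bold>\<in> F \<^bold>\<and> pair (Var 2) (Var 0) \<^bold>\<in> F
          \<^bold>\<longrightarrow> Var 1 \<^bold>= Var 0)))
     \<^bold>\<and> AllN (A (Var 0) \<^bold>\<longrightarrow> ExN (pair (Var 1) (Var 0) \<^bold>\<in> F)))"

text \<open>
  \<open>(S, R)\<close> is an LTL-frame with \<open>S = {s\<^sub>i}\<^sub>i\<close> enumerated by the function \<open>s\<close>. The worlds \<open>s\<^sub>i\<close> are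
  distinct; with repetitions the valuation clauses, which determine truth at \<open>s\<^sub>i\<close> from \<open>i\<close>, would
  in general be unsatisfiable.
\<close>

definition is_frame :: "nat \<Rightarrow> nat \<Rightarrow> nat \<Rightarrow> fm" where
  "is_frame S R s =
    (included R (product (Elements S) (Elements S))
     \<^bold>\<and> is_function s Numbers (Elements S)
     \<^bold>\<and> AllN (Var 0 \<^bold>\<in> S \<^bold>\<longrightarrow> ExN (pair (Var 0) (Var 1) \<^bold>\<in> s))
     \<^bold>\<and> AllN (AllN (AllN (pair (Var 2) (Var 0) \<^bold>\<in> s \<^bold>\<and> pair (Var 1) (Var 0) \<^bold>\<in> s
          \<^bold>\<longrightarrow> Var 2 \<^bold>= Var 1)))
     \<^bold>\<and> AllN (AllN (AllN (AllN
          (let i = Var 3; j = Var 2; x = Var 1; y = Var 0 in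
           i \<^bold>< j \<^bold>\<and> pair i x \<^bold>\<in> s \<^bold>\<and> pair j y \<^bold>\<in> s \<^bold>\<longrightarrow> pair x y \<^bold>\<in> R)))))"

text \<open>\<open>V(s\<^sub>i, \<phi>) = a\<close>\<close>

definition val :: "nat \<Rightarrow> nat \<Rightarrow> tm \<Rightarrow> tm \<Rightarrow> tm \<Rightarrow> fm" where
  "val V s i \<phi> a =
    ExN (pair (shift 1 i) (Var 0) \<^bold>\<in> s \<^bold>\<and> pair (pair (Var 0) (shift 1 \<phi>)) (shift 1 a) \<^bold>\<in> V)"

text \<open>
  In the clause for implication, \<open>d\<close> is \<open>1 - V(s\<^sub>i, \<psi>)\<close>, and \<open>c = 1 - a * d\<close> is written without
  subtraction.
\<close>

definition is_valuation :: "nat \<Rightarrow> nat \<Rightarrow> nat \<Rightarrow> fm" where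
  "is_valuation V S s =
    (is_function V (product (Elements S) Fml) Bits
     \<^bold>\<and> AllN (val V s (Var 0) bot_code Zero)
     \<^bold>\<and> AllN (AllN (AllN (AllN (AllN (AllN (AllN
          (let i = Var 6; \<phi> = Var 5; \<psi> = Var 4; a = Var 3; b = Var 2; c = Var 1; d = Var 0 in
           Fml \<phi> \<^bold>\<and> Fml \<psi> \<^bold>\<and> val V s i \<phi> a \<^bold>\<and> val V s i \<psi> b \<^bold>\<and> val V s i (imp_code \<phi> \<psi>) c
           \<^bold>\<and> d \<^bold>+ b \<^bold>= One \<^bold>\<longrightarrow> c \<^bold>+ a \<^bold>* d \<^bold>= One)))))))
     \<^bold>\<and> AllN (AllN
          (let i = Var 1; \<phi> = Var 0 in
           Fml \<phi> \<^bold>\<longrightarrow> (val V s i (next_code \<phi>) One \<^bold>\<longleftrightarrow> val V s (i \<^bold>+ One) \<phi> One)))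
     \<^bold>\<and> AllN (AllN (AllN
          (let i = Var 2; \<phi> = Var 1; \<psi> = Var 0 in
           Fml \<phi> \<^bold>\<and> Fml \<psi> \<^bold>\<longrightarrow>
            (val V s i (until_code \<phi> \<psi>) One \<^bold>\<longleftrightarrow>
              ExN (let i = Var 3; \<phi> = Var 2; \<psi> = Var 1; n = Var 0 in
                i \<^bold>\<le> n
                \<^bold>\<and> AllN (let i = Var 4; \<phi> = Var 3; n = Var 1; j = Var 0 in
                      i \<^bold>\<le> j \<^bold>\<and> j \<^bold>< n \<^bold>\<longrightarrow> val V s j \<phi> One)
                \<^bold>\<and> val V s n \<psi> One))))))"

text \<open>
  Set indices: \<open>S = 3\<close>, \<open>R = 2\<close>, \<open>s = 1\<close>, \<open>v = 0\<close>; below the existential quantifier over \<open>V\<close> they go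
  up by one and \<open>V = 0\<close>. That \<open>V\<close> extends \<open>v\<close> is inclusion of graphs.
\<close>

definition valuation_extension_lemma :: fm where
  "valuation_extension_lemma =
    AllS (AllS (AllS (AllS
      (is_frame 3 2 1 \<^bold>\<and> is_function 0 (product (Elements 3) Prop) Bits \<^bold>\<longrightarrow>
       ExS (is_valuation 0 4 2 \<^bold>\<and> included 1 (Elements 0))))))"

end

theory Submission
  imports Defs "HOL-Library.Countable"
begin

text \<open>
  By completeness it suffices to verify the lemma in a model of \<open>ACA\<^sub>0'\<close> built from terms. There, the
  existence of jumps yields arithmetical comprehension, and this is enough for the lemma: no
  iteration of the jump along the nesting of until-formulas is needed. To evaluate \<open>\<phi> U \<psi>\<close> at \<open>i\<close>,
  one searches for the first place \<open>n \<ge> i\<close> that decides it because \<open>\<psi>\<close> is true or \<open>\<phi>\<close> is false there.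
  If such places exist beyond every bound, each search succeeds; otherwise \<open>\<phi> U \<psi>\<close> is false from some
  place \<open>m\<close> on, and searches may be stopped at \<open>m\<close>. So the truth values of the formulas below a given
  code are computable from \<open>v\<close> and a finite amount of advice, namely the numbers \<open>m\<close>. That an advice is
  correct is an arithmetical property; by induction on the code there is a correct one for each code,
  and arithmetical comprehension collects the resulting truth values in a single set.
\<close>

section \<open>Substitution\<close>

text \<open>The term model may be nonstandard. Induction, least elements and set formation are
  therefore available only for predicates known to be definable. This is why definability is
  organised as a closure calculus on predicates (\<open>tdef\<close>, \<open>bdef\<close>,
  \<open>sdef\<close>), and why arithmetic, sequence coding and primitive recursion are rebuilt
  inside the model. Arithmetical comprehension needs only the first jump of a set, used again and
  again: an unbounded quantifier over a set becomes halting relative to an oracle, the jump turns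
  halting into a set, and this set is a parameter for the next quantifier. Finitely many rounds make
  every arithmetical predicate bounded in some set parameter. A direct truth definition would spend
  a further jump on each nesting of until, and the depth of nesting is unbounded, possibly
  nonstandard. For fixed advice, however, every evaluation rule consults finitely many earlier
  values and consults them positively. Such a rule system has an arithmetical fixed point, the union
  of the finite sets that justify themselves. It treats all advices at once, so quantifying over
  advice is quantifying over numbers.\<close>

lemma tsub_tsub: "tsub \<sigma> (tsub \<tau> t) = tsub (\<lambda>n. tsub \<sigma> (\<tau> n)) t"
  by (induction t) auto

lemma tsub_Var [simp]: "tsub Var t = t"
  by (induction t) auto

lemma under_0 [simp]: "under \<sigma> 0 = Var 0"
  and under_Suc [simp]: "under \<sigma> (Suc n) = shift 1 (\<sigma> n)"
  by (simp_all add: under_def)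

lemma underS_0 [simp]: "underS \<rho> 0 = 0"
  and underS_Suc [simp]: "underS \<rho> (Suc n) = Suc (\<rho> n)"
  by (simp_all add: underS_def)

lemma under_Var [simp]: "under Var = Var"
proof
  show "under Var n = Var n" for n
    by (cases n) (simp_all add: shift_def)
qed

lemma underS_id [simp]: "underS (\<lambda>n. n) = (\<lambda>n. n)"
proof
  show "underS (\<lambda>n. n) n = n" for n
    by (cases n) simp_all
qed

lemma under_comp: "(\<lambda>n. tsub (under \<sigma>) (under \<tau> n)) = under (\<lambda>n. tsub \<sigma> (\<tau> n))"
proof
  show "tsub (under \<sigma>) (under \<tau> n) = under (\<lambda>n. tsub \<sigma> (\<tau> n)) n" for n
    by (cases n) (simp_all add: shift_def tsub_tsub)
qed

lemma underS_comp: "(\<lambda>n. underS \<rho> (underS \<pi> n)) = underS (\<lambda>n. \<rho> (\<pi> n))"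
proof
  show "underS \<rho> (underS \<pi> n) = underS (\<lambda>n. \<rho> (\<pi> n)) n" for n
    by (cases n) simp_all
qed

lemma nsub_nsub: "nsub \<sigma> (nsub \<tau> \<phi>) = nsub (\<lambda>n. tsub \<sigma> (\<tau> n)) \<phi>"
  by (induction \<phi> arbitrary: \<sigma> \<tau>) (auto simp: tsub_tsub under_comp)

lemma nsub_Var [simp]: "nsub Var \<phi> = \<phi>"
  by (induction \<phi>) auto

lemma ssub_ssub: "ssub \<rho> (ssub \<pi> \<phi>) = ssub (\<lambda>n. \<rho> (\<pi> n)) \<phi>"
  by (induction \<phi> arbitrary: \<rho> \<pi>) (auto simp: underS_comp)

lemma ssub_id [simp]: "ssub (\<lambda>n. n) \<phi> = \<phi>"
  by (induction \<phi>) auto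

lemma ssub_nsub: "ssub \<rho> (nsub \<sigma> \<phi>) = nsub \<sigma> (ssub \<rho> \<phi>)"
  by (induction \<phi> arbitrary: \<rho> \<sigma>) auto

lemma inst_nsub_under: "inst t (nsub (under \<sigma>) \<phi>) = nsub (case_nat t \<sigma>) \<phi>"
proof -
  have "(\<lambda>n. tsub (case_nat t Var) (under \<sigma> n)) = case_nat t \<sigma>"
  proof
    show "tsub (case_nat t Var) (under \<sigma> n) = case_nat t \<sigma> n" for n
      by (cases n) (simp_all add: shift_def tsub_tsub)
  qed
  then show ?thesis
    by (simp add: inst_def nsub_nsub)
qed

lemma instS_ssub_underS: "instS X (ssub (underS \<rho>) \<phi>) = ssub (case_nat X \<rho>) \<phi>"
proof -
  have "(\<lambda>n. case_nat X (\<lambda>n. n) (underS \<rho> n)) = case_nat X \<rho>"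
  proof
    show "case_nat X (\<lambda>n. n) (underS \<rho> n) = case_nat X \<rho> n" for n
      by (cases n) simp_all
  qed
  then show ?thesis
    by (simp add: instS_def ssub_ssub)
qed

lemma inst_nsub: "inst (tsub \<sigma> t) (nsub (under \<sigma>) \<phi>) = nsub \<sigma> (inst t \<phi>)"
proof -
  have "(\<lambda>n. tsub \<sigma> (case_nat t Var n)) = case_nat (tsub \<sigma> t) \<sigma>"
    by (rule ext) (simp split: nat.split)
  then have "nsub (case_nat (tsub \<sigma> t) \<sigma>) \<phi> = nsub \<sigma> (inst t \<phi>)"
    by (simp add: inst_def nsub_nsub)
  then show ?thesis
    by (simp only: inst_nsub_under)
qed

lemma instS_ssub: "instS (\<rho> X) (ssub (underS \<rho>) \<phi>) = ssub \<rho> (instS X \<phi>)"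
proof -
  have "(\<lambda>n. \<rho> (case_nat X (\<lambda>n. n) n)) = case_nat (\<rho> X) \<rho>"
    by (rule ext) (simp split: nat.split)
  then have "ssub (case_nat (\<rho> X) \<rho>) \<phi> = ssub \<rho> (instS X \<phi>)"
    by (simp add: instS_def ssub_ssub)
  then show ?thesis
    by (simp only: instS_ssub_underS)
qed

text \<open>Replaces the notion of a free variable: a bound on the variables that matter is all that
  is needed to close a formula or to choose a fresh variable. It is polymorphic so as to serve both
  sorts.\<close>

definition finite_support :: "((nat \<Rightarrow> 'b) \<Rightarrow> 'c) \<Rightarrow> bool" where
  "finite_support F \<longleftrightarrow> (\<exists>N. \<forall>\<sigma> \<tau>. (\<forall>n<N. \<sigma> n = \<tau> n) \<longrightarrow> F \<sigma> = F \<tau>)"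

lemma finite_support_place: "finite_support (\<lambda>\<sigma>. h (\<sigma> n))"
  unfolding finite_support_def by (intro exI[of _ "Suc n"]) simp

lemma finite_support_const: "finite_support (\<lambda>\<sigma>. c)"
  unfolding finite_support_def by simp

lemma finite_support_map2:
  assumes "finite_support F" "finite_support G"
  shows "finite_support (\<lambda>\<sigma>. h (F \<sigma>) (G \<sigma>))"
proof -
  obtain M N where "\<And>\<sigma> \<tau>. \<forall>n<M. \<sigma> n = \<tau> n \<Longrightarrow> F \<sigma> = F \<tau>" "\<And>\<sigma> \<tau>. \<forall>n<N. \<sigma> n = \<tau> n \<Longrightarrow> G \<sigma> = G \<tau>"
    using assms unfolding finite_support_def by metis
  then show ?thesis
    unfolding finite_support_def by (intro exI[of _ "max M N"]) (metis less_max_iff_disj)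
qed

lemma finite_support_map: "finite_support F \<Longrightarrow> finite_support (\<lambda>\<sigma>. h (F \<sigma>))"
  using finite_support_map2[of F F "\<lambda>x _. h x"] by simp

lemma finite_support_under:
  assumes "finite_support F" "\<And>\<sigma>. u \<sigma> 0 = c" "\<And>\<sigma> n. u \<sigma> (Suc n) = k (\<sigma> n)"
  shows "finite_support (\<lambda>\<sigma>. F (u \<sigma>))"
proof -
  obtain N where N: "\<And>\<sigma> \<tau>. \<forall>n<N. \<sigma> n = \<tau> n \<Longrightarrow> F \<sigma> = F \<tau>"
    using assms(1) unfolding finite_support_def by metis
  have "u \<sigma> n = u \<tau> n" if "\<forall>n<N. \<sigma> n = \<tau> n" "n < N" for \<sigma> \<tau> n
    using that by (cases n) (auto simp: assms)
  with N show ?thesis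
    unfolding finite_support_def by (intro exI[of _ N]) blast
qed

lemma tsub_finite_support: "finite_support (\<lambda>\<sigma>. tsub \<sigma> t)"
  by (induction t) (simp_all add: finite_support_place[of "\<lambda>t. t"] finite_support_const
      finite_support_map2[where h = Add] finite_support_map2[where h = Mul])

lemma nsub_finite_support: "finite_support (\<lambda>\<sigma>. nsub \<sigma> \<phi>)"
proof (induction \<phi>)
  case (AllN \<phi>)
  then have "finite_support (\<lambda>\<sigma>. nsub (under \<sigma>) \<phi>)"
    by (rule finite_support_under[of _ under "Var 0" "shift 1"]) simp_all
  then show ?case by (simp add: finite_support_map[where h = AllN])
qed (simp_all add: tsub_finite_support finite_support_const finite_support_map[where h = "\<lambda>t. t \<^bold>\<in> _"]
    finite_support_map[where h = AllS] finite_support_map2[where h = Eq] finite_support_map2[where h = Less]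
    finite_support_map2[where h = Imp])

lemma ssub_finite_support: "finite_support (\<lambda>\<rho>. ssub \<rho> \<phi>)"
proof (induction \<phi>)
  case (AllS \<phi>)
  then have "finite_support (\<lambda>\<rho>. ssub (underS \<rho>) \<phi>)"
    by (rule finite_support_under[of _ underS 0 Suc]) simp_all
  then show ?case by (simp add: finite_support_map[where h = AllS])
qed (simp_all add: finite_support_place finite_support_const finite_support_map[where h = AllN]
    finite_support_map2[where h = Imp])

lemma finite_support_list: "(\<And>\<phi>. finite_support (\<lambda>\<sigma>. f \<sigma> \<phi>)) \<Longrightarrow> finite_support (\<lambda>\<sigma>. map (f \<sigma>) \<Gamma>)"
  by (induction \<Gamma>) (simp_all add: finite_support_const finite_support_map2[where h = Cons])


section \<open>Derived rules of the calculus\<close>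

lemma derives_weaken: "derives T \<Gamma> \<phi> \<Longrightarrow> set \<Gamma> \<subseteq> set \<Delta> \<Longrightarrow> derives T \<Delta> \<phi>"
proof (induction arbitrary: \<Delta> rule: derives.induct)
  case (ImpI \<phi> \<Gamma> \<psi>)
  show ?case using ImpI.prems by (intro derives.ImpI ImpI.IH) auto
next
  case (ImpE \<Gamma> \<phi> \<psi>)
  show ?case by (rule derives.ImpE[OF ImpE.IH(1)[OF ImpE.prems] ImpE.IH(2)[OF ImpE.prems]])
next
  case (Classical \<phi> \<Gamma>)
  show ?case using Classical.prems by (intro derives.Classical[OF Classical.IH]) auto
next
  case (AllI \<Gamma> \<phi>)
  show ?case using AllI.prems by (intro derives.AllI AllI.IH) auto
next
  case (AllSI \<Gamma> \<phi>)
  show ?case using AllSI.prems by (intro derives.AllSI AllSI.IH) auto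
next
  case (Subst \<Gamma> t u \<phi>)
  show ?case by (rule derives.Subst[OF Subst.IH(1)[OF Subst.prems] Subst.IH(2)[OF Subst.prems]])
qed (auto intro: derives.Axm derives.Asm derives.AllE derives.AllSE derives.Refl)

lemma derives_mono: "derives T \<Gamma> \<phi> \<Longrightarrow> T \<subseteq> T' \<Longrightarrow> derives T' \<Gamma> \<phi>"
proof (induction rule: derives.induct)
  case (ImpE \<Gamma> \<phi> \<psi>)
  then show ?case by (metis derives.ImpE)
next
  case (Subst \<Gamma> t u \<phi>)
  then show ?case by (metis derives.Subst)
qed (auto intro: derives.Axm derives.Asm derives.ImpI derives.Classical derives.AllI derives.AllSI
    derives.AllE derives.AllSE derives.Refl)

text \<open>
  The universal closure of \<open>\<phi>\<close> is invariant under substitutions, and its instances are the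
  substitution instances of \<open>\<phi>\<close>. This covers both sorts of variables, \<open>id\<close> being the identical
  substitution.
\<close>

lemma derives_closed_instance:
  fixes sub :: "(nat \<Rightarrow> 'b) \<Rightarrow> fm \<Rightarrow> fm" and id :: "nat \<Rightarrow> 'b"
  assumes \<phi>: "derives T [] \<phi>" and supp: "finite_support (\<lambda>\<sigma>. sub \<sigma> \<phi>)"
    and sub: "\<And>\<psi>. sub id \<psi> = \<psi>" "\<And>\<sigma> \<psi>. sub \<sigma> (Q \<psi>) = Q (sub (up \<sigma>) \<psi>)"
    and up: "\<And>\<sigma>. up \<sigma> 0 = id 0" "\<And>\<sigma> n. \<sigma> n = id n \<Longrightarrow> up \<sigma> (Suc n) = id (Suc n)"
    and Q: "\<And>\<psi>. derives T [] \<psi> \<Longrightarrow> derives T [] (Q \<psi>)"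
      "\<And>\<sigma> \<psi>. derives T [] (Q (sub (up (\<lambda>n. \<sigma> (Suc n))) \<psi>)) \<Longrightarrow> derives T [] (sub \<sigma> \<psi>)"
  shows "derives T [] (sub \<sigma> \<phi>)"
proof -
  have closure: "sub \<sigma> ((Q ^^ m) \<phi>) = (Q ^^ m) (sub ((up ^^ m) \<sigma>) \<phi>)" for m \<sigma>
    by (induction m arbitrary: \<sigma>) (auto simp: sub funpow_swap1[of up])
  \<comment> \<open>Below \<open>m\<close> quantifiers the first \<open>m\<close> places are fixed,
    so an \<open>m\<close> beyond the support of \<open>\<phi>\<close> makes the closure invariant
    under every substitution.\<close>
  have low: "n < m \<Longrightarrow> (up ^^ m) \<sigma> n = id n" for m n \<sigma>
  proof (induction m arbitrary: n)
    case (Suc m)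
    then show ?case by (cases n) (auto simp: up)
  qed simp
  obtain m where m: "\<And>\<sigma> \<tau>. \<forall>n<m. \<sigma> n = \<tau> n \<Longrightarrow> sub \<sigma> \<phi> = sub \<tau> \<phi>"
    using supp unfolding finite_support_def by metis
  have closed: "sub \<sigma> ((Q ^^ m) \<phi>) = (Q ^^ m) \<phi>" for \<sigma>
    using m[of "(up ^^ m) \<sigma>" id] by (simp add: closure low sub)
  have "derives T [] ((Q ^^ m) \<phi>)" for m
    by (induction m) (auto simp: \<phi> intro: Q(1))
  then have "derives T [] (sub \<sigma> ((Q ^^ m) \<phi>))" for \<sigma>
    by (simp add: closed)
  \<comment> \<open>The quantifiers are instantiated from the outside in. Here
    \<open>\<sigma>\<close> has to be arbitrary, because removing one quantifier passes between
    \<open>\<sigma>\<close> and its tail.\<close>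
  then have "\<forall>\<sigma>. derives T [] (sub \<sigma> \<phi>)"
  proof (induction m)
    case (Suc m)
    have "derives T [] (sub \<sigma> ((Q ^^ m) \<phi>))" for \<sigma>
      using Suc.prems[of "\<lambda>n. \<sigma> (Suc n)"] by (intro Q(2)) (simp add: sub)
    then show ?case by (rule Suc.IH)
  qed simp
  then show ?thesis ..
qed

lemma case_nat_self: "case_nat (\<sigma> 0) (\<lambda>n. \<sigma> (Suc n)) = \<sigma>"
  by (rule ext) (simp split: nat.split)

lemma derives_closed_nsub: "derives T [] \<phi> \<Longrightarrow> derives T [] (nsub \<sigma> \<phi>)"
proof (rule derives_closed_instance[where sub = nsub and id = Var and Q = AllN and up = under])
  show "derives T [] (nsub \<sigma> \<psi>)" if "derives T [] (AllN (nsub (under (\<lambda>n. \<sigma> (Suc n))) \<psi>))" for \<sigma> \<psi>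
    using derives.AllE[OF that, of "\<sigma> 0"] by (simp add: inst_nsub_under case_nat_self)
qed (auto simp: nsub_finite_support shift_def intro: derives.AllI)

lemma derives_closed_ssub: "derives T [] \<phi> \<Longrightarrow> derives T [] (ssub \<sigma> \<phi>)"
proof (rule derives_closed_instance[where sub = ssub and id = "\<lambda>n. n" and Q = AllS and up = underS])
  show "derives T [] (ssub \<sigma> \<psi>)" if "derives T [] (AllS (ssub (underS (\<lambda>n. \<sigma> (Suc n))) \<psi>))" for \<sigma> \<psi>
    using derives.AllSE[OF that, of "\<sigma> 0"] by (simp add: instS_ssub_underS case_nat_self)
qed (auto simp: ssub_finite_support intro: derives.AllSI)

section \<open>Substitution under assumptions, and fresh variables\<close>

lemma derives_ImpI_iff: "derives T \<Gamma> (\<phi> \<^bold>\<longrightarrow> \<psi>) \<longleftrightarrow> derives T (\<phi> # \<Gamma>) \<psi>"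
proof
  assume "derives T \<Gamma> (\<phi> \<^bold>\<longrightarrow> \<psi>)"
  then have "derives T (\<phi> # \<Gamma>) (\<phi> \<^bold>\<longrightarrow> \<psi>)"
    by (rule derives_weaken) auto
  then show "derives T (\<phi> # \<Gamma>) \<psi>"
    by (rule derives.ImpE) (rule derives.Asm, simp)
qed (rule derives.ImpI)

text \<open>Discharging every assumption reduces substitution in a sequent to the case of an empty
  context, where the quantifier rules have nothing to lift.\<close>

lemma derives_append_iff: "derives T (\<Gamma> @ \<Delta>) \<phi> \<longleftrightarrow> derives T \<Delta> (foldr Imp \<Gamma> \<phi>)"
proof (induction \<Gamma> arbitrary: \<Delta>)
  case (Cons \<gamma> \<Gamma>)
  have "derives T ((\<gamma> # \<Gamma>) @ \<Delta>) \<phi> \<longleftrightarrow> derives T (\<Gamma> @ \<gamma> # \<Delta>) \<phi>"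
    by (auto intro: derives_weaken)
  then show ?case
    by (simp add: Cons.IH derives_ImpI_iff)
qed simp

lemma nsub_foldr_Imp: "nsub \<sigma> (foldr Imp \<Gamma> \<phi>) = foldr Imp (map (nsub \<sigma>) \<Gamma>) (nsub \<sigma> \<phi>)"
  by (induction \<Gamma>) auto

lemma ssub_foldr_Imp: "ssub \<sigma> (foldr Imp \<Gamma> \<phi>) = foldr Imp (map (ssub \<sigma>) \<Gamma>) (ssub \<sigma> \<phi>)"
  by (induction \<Gamma>) auto

lemma derives_nsub: "derives T \<Gamma> \<phi> \<Longrightarrow> derives T (map (nsub \<sigma>) \<Gamma>) (nsub \<sigma> \<phi>)"
  using derives_append_iff[of T \<Gamma> "[]" \<phi>] derives_append_iff[of T "map (nsub \<sigma>) \<Gamma>" "[]" "nsub \<sigma> \<phi>"]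
    derives_closed_nsub[of T "foldr Imp \<Gamma> \<phi>" \<sigma>]
  by (simp add: nsub_foldr_Imp)

lemma derives_ssub: "derives T \<Gamma> \<phi> \<Longrightarrow> derives T (map (ssub \<sigma>) \<Gamma>) (ssub \<sigma> \<phi>)"
  using derives_append_iff[of T \<Gamma> "[]" \<phi>] derives_append_iff[of T "map (ssub \<sigma>) \<Gamma>" "[]" "ssub \<sigma> \<phi>"]
    derives_closed_ssub[of T "foldr Imp \<Gamma> \<phi>" \<sigma>]
  by (simp add: ssub_foldr_Imp)

lemma derives_contradiction: "derives T \<Gamma> Bot \<Longrightarrow> derives T \<Gamma> \<phi>"
  by (rule derives.Classical) (rule derives_weaken, auto)

text \<open>Connects rule \<open>AllI\<close>, which lifts the context, with the usual rule for a
  fresh variable. A variable beyond the support of \<open>\<phi>\<close> and \<open>\<Gamma>\<close>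
  is renamed to index 0 while all others move up by one; this turns the given derivation into the
  premise of \<open>AllI\<close>.\<close>

lemma derives_AllN_fresh: "\<exists>k. derives T \<Gamma> (inst (Var k) \<phi>) \<longrightarrow> derives T \<Gamma> (AllN \<phi>)"
proof -
  obtain N where N: "\<And>\<sigma> \<tau>. \<forall>n<N. \<sigma> n = \<tau> n \<Longrightarrow> map (nsub \<sigma>) (AllN \<phi> # \<Gamma>) = map (nsub \<tau>) (AllN \<phi> # \<Gamma>)"
    using finite_support_list[of nsub, OF nsub_finite_support] unfolding finite_support_def by metis
  \<comment> \<open>On \<open>\<Gamma>\<close> and \<open>AllN \<phi>\<close> this agrees with the
    lifting substitution, as the two differ only at \<open>N\<close>.\<close>
  define \<sigma> where "\<sigma> n = (if n = N then Var 0 else Var (Suc n))" for n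
  have \<Gamma>: "map (nsub \<sigma>) \<Gamma> = map lift \<Gamma>" and "nsub \<sigma> (AllN \<phi>) = nsub (\<lambda>n. Var (Suc n)) (AllN \<phi>)"
    using N[of \<sigma> "\<lambda>n. Var (Suc n)"] by (simp_all add: \<sigma>_def lift_def)
  then have under: "nsub (under \<sigma>) \<phi> = nsub (under (\<lambda>n. Var (Suc n))) \<phi>"
    by simp
  have "nsub \<sigma> (inst (Var N) \<phi>) = inst (tsub \<sigma> (Var N)) (nsub (under \<sigma>) \<phi>)"
    by (rule inst_nsub[symmetric])
  also have "\<dots> = inst (Var 0) (nsub (under (\<lambda>n. Var (Suc n))) \<phi>)"
    by (simp add: under \<sigma>_def)
  also have "\<dots> = nsub (case_nat (Var 0) (\<lambda>n. Var (Suc n))) \<phi>"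
    by (rule inst_nsub_under)
  also have "case_nat (Var 0) (\<lambda>n. Var (Suc n)) = Var"
    by (rule ext) (simp split: nat.split)
  finally have inst: "nsub \<sigma> (inst (Var N) \<phi>) = \<phi>"
    by simp
  have "derives T \<Gamma> (AllN \<phi>)" if "derives T \<Gamma> (inst (Var N) \<phi>)"
    using derives_nsub[OF that, of \<sigma>] by (intro derives.AllI) (simp add: \<Gamma> inst)
  then show ?thesis by blast
qed

lemma derives_AllS_fresh: "\<exists>k. derives T \<Gamma> (instS k \<phi>) \<longrightarrow> derives T \<Gamma> (AllS \<phi>)"
proof -
  obtain N where N: "\<And>\<sigma> \<tau>. \<forall>n<N. \<sigma> n = \<tau> n \<Longrightarrow> map (ssub \<sigma>) (AllS \<phi> # \<Gamma>) = map (ssub \<tau>) (AllS \<phi> # \<Gamma>)"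
    using finite_support_list[of ssub, OF ssub_finite_support] unfolding finite_support_def by metis
  define \<sigma> where "\<sigma> n = (if n = N then 0 else Suc n)" for n
  have \<Gamma>: "map (ssub \<sigma>) \<Gamma> = map liftS \<Gamma>" and "ssub \<sigma> (AllS \<phi>) = ssub Suc (AllS \<phi>)"
    using N[of \<sigma> "Suc"] by (simp_all add: \<sigma>_def liftS_def)
  then have under: "ssub (underS \<sigma>) \<phi> = ssub (underS Suc) \<phi>"
    by simp
  have "ssub \<sigma> (instS N \<phi>) = instS (\<sigma> N) (ssub (underS \<sigma>) \<phi>)"
    by (rule instS_ssub[symmetric])
  also have "\<dots> = instS 0 (ssub (underS Suc) \<phi>)"
    by (simp add: under \<sigma>_def)
  also have "\<dots> = ssub (case_nat 0 Suc) \<phi>"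
    by (rule instS_ssub_underS)
  also have "case_nat 0 Suc = (\<lambda>n. n)"
    by (rule ext) (simp split: nat.split)
  finally have inst: "ssub \<sigma> (instS N \<phi>) = \<phi>"
    by simp
  have "derives T \<Gamma> (AllS \<phi>)" if "derives T \<Gamma> (instS N \<phi>)"
    using derives_ssub[OF that, of \<sigma>] by (intro derives.AllSI) (simp add: \<Gamma> inst)
  then show ?thesis by blast
qed


section \<open>Henkin sets\<close>

definition Henkin :: "fm set \<Rightarrow> fm set \<Rightarrow> bool" where
  "Henkin T H \<longleftrightarrow>
    (\<forall>\<Gamma> \<phi>. set \<Gamma> \<subseteq> H \<and> derives T \<Gamma> \<phi> \<longrightarrow> \<phi> \<in> H) \<and> Bot \<notin> H
    \<and> (\<forall>\<phi>. \<phi> \<in> H \<or> (\<^bold>\<not> \<phi>) \<in> H)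
    \<and> (\<forall>\<phi>. (\<^bold>\<not> AllN \<phi>) \<in> H \<longrightarrow> (\<exists>t. (\<^bold>\<not> inst t \<phi>) \<in> H))
    \<and> (\<forall>\<phi>. (\<^bold>\<not> AllS \<phi>) \<in> H \<longrightarrow> (\<exists>X. (\<^bold>\<not> instS X \<phi>) \<in> H))"

text \<open>The language needs no new constants: a stage is a finite list, so some variable is fresh
  for it and can serve as the witness of a negated universal formula.\<close>

lemma Henkin_step:
  assumes "\<not> derives T \<Gamma> Bot"
  shows "\<exists>\<Delta>. set \<Gamma> \<subseteq> set \<Delta> \<and> \<not> derives T \<Delta> Bot \<and> (\<phi> \<in> set \<Delta> \<or> (\<^bold>\<not> \<phi>) \<in> set \<Delta>)
    \<and> (\<forall>\<psi>. \<phi> = AllN \<psi> \<and> (\<^bold>\<not> \<phi>) \<in> set \<Delta> \<longrightarrow> (\<exists>t. (\<^bold>\<not> inst t \<psi>) \<in> set \<Delta>))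
    \<and> (\<forall>\<psi>. \<phi> = AllS \<psi> \<and> (\<^bold>\<not> \<phi>) \<in> set \<Delta> \<longrightarrow> (\<exists>X. (\<^bold>\<not> instS X \<psi>) \<in> set \<Delta>))"
proof (cases "derives T (\<phi> # \<Gamma>) Bot")
  case False
  \<comment> \<open>Makes both witness conditions vacuous when \<open>\<phi>\<close> itself is
    added.\<close>
  have "(\<^bold>\<not> \<phi>) \<notin> set (\<phi> # \<Gamma>)"
    using False by (metis derives.Asm derives.ImpE list.set_intros(1))
  with False show ?thesis
    by (intro exI[of _ "\<phi> # \<Gamma>"]) auto
next
  case True
  then have neg: "derives T \<Gamma> (\<^bold>\<not> \<phi>)"
    by (rule derives.ImpI)
  let ?\<Gamma> = "(\<^bold>\<not> \<phi>) # \<Gamma>"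
  have cons: "\<not> derives T ?\<Gamma> Bot"
    using assms neg by (metis derives.ImpE derives_ImpI_iff)
  then have not_derives: "\<not> derives T ?\<Gamma> \<phi>"
    by (metis derives.Asm derives.ImpE list.set_intros(1))
  consider \<psi> where "\<phi> = AllN \<psi>" | \<psi> where "\<phi> = AllS \<psi>" | "\<forall>\<psi>. \<phi> \<noteq> AllN \<psi> \<and> \<phi> \<noteq> AllS \<psi>"
    by blast
  then show ?thesis
  proof cases
    case 1
    then obtain k where "\<not> derives T ?\<Gamma> (inst (Var k) \<psi>)"
      using derives_AllN_fresh not_derives by metis
    then have "\<not> derives T ((\<^bold>\<not> inst (Var k) \<psi>) # ?\<Gamma>) Bot"
      using derives.Classical by blast
    with 1 show ?thesis
      by (intro exI[of _ "(\<^bold>\<not> inst (Var k) \<psi>) # ?\<Gamma>"]) auto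
  next
    case 2
    then obtain k where "\<not> derives T ?\<Gamma> (instS k \<psi>)"
      using derives_AllS_fresh not_derives by metis
    then have "\<not> derives T ((\<^bold>\<not> instS k \<psi>) # ?\<Gamma>) Bot"
      using derives.Classical by blast
    with 2 show ?thesis
      by (intro exI[of _ "(\<^bold>\<not> instS k \<psi>) # ?\<Gamma>"]) auto
  next
    case 3
    with cons show ?thesis by (intro exI[of _ ?\<Gamma>]) auto
  qed
qed

instance tm :: countable by countable_datatype
instance fm :: countable by countable_datatype

text \<open>Lindenbaum's construction along the enumeration of formulas: stage \<open>Suc n\<close>
  settles the formula with number \<open>n\<close> and, where required, supplies its
  witness.\<close>

lemma Henkin_extension:
  assumes "\<not> derives T \<Gamma> Bot"
  obtains H where "Henkin T H" "set \<Gamma> \<subseteq> H"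
proof -
  define good where "good \<phi> \<Delta> \<longleftrightarrow> (\<phi> \<in> set \<Delta> \<or> (\<^bold>\<not> \<phi>) \<in> set \<Delta>)
    \<and> (\<forall>\<psi>. \<phi> = AllN \<psi> \<and> (\<^bold>\<not> \<phi>) \<in> set \<Delta> \<longrightarrow> (\<exists>t. (\<^bold>\<not> inst t \<psi>) \<in> set \<Delta>))
    \<and> (\<forall>\<psi>. \<phi> = AllS \<psi> \<and> (\<^bold>\<not> \<phi>) \<in> set \<Delta> \<longrightarrow> (\<exists>X. (\<^bold>\<not> instS X \<psi>) \<in> set \<Delta>))"
    for \<phi> \<Delta>
  define C where "C = rec_nat \<Gamma> (\<lambda>n \<Delta>. SOME \<Delta>'. set \<Delta> \<subseteq> set \<Delta>' \<and> \<not> derives T \<Delta>' Bot \<and> good (from_nat n) \<Delta>')"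
  have step: "\<not> derives T (C n) Bot \<Longrightarrow>
    set (C n) \<subseteq> set (C (Suc n)) \<and> \<not> derives T (C (Suc n)) Bot \<and> good (from_nat n) (C (Suc n))" for n
    using someI_ex[OF Henkin_step[of T "C n" "from_nat n"], folded good_def] by (simp add: C_def)
  have cons: "\<not> derives T (C n) Bot" for n
  proof (induction n)
    case 0
    then show ?case using assms by (simp add: C_def)
  next
    case (Suc n)
    then show ?case using step by blast
  qed
  have mono: "m \<le> n \<Longrightarrow> set (C m) \<subseteq> set (C n)" for m n
    by (rule lift_Suc_mono_le[of "\<lambda>n. set (C n)"]) (use step cons in blast)+
  define H where "H = (\<Union>n. set (C n))"
  have fin: "\<exists>n. set \<Delta> \<subseteq> set (C n)" if "set \<Delta> \<subseteq> H" for \<Delta>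
    using that
  proof (induction \<Delta>)
    case (Cons \<phi> \<Delta>)
    then obtain m n where "\<phi> \<in> set (C m)" "set \<Delta> \<subseteq> set (C n)"
      by (auto simp: H_def)
    then show ?case
      using mono[of m "max m n"] mono[of n "max m n"] by (intro exI[of _ "max m n"]) auto
  qed simp
  have consistent: "\<not> derives T \<Delta> Bot" if "set \<Delta> \<subseteq> H" for \<Delta>
    using fin[OF that] cons derives_weaken by blast
  have decided: "\<phi> \<in> H \<or> (\<^bold>\<not> \<phi>) \<in> H" for \<phi>
    using step[OF cons, of "to_nat \<phi>"] by (auto simp: good_def H_def)
  have closed: "\<phi> \<in> H" if "set \<Delta> \<subseteq> H" "derives T \<Delta> \<phi>" for \<Delta> \<phi>
  proof (rule ccontr)
    assume "\<phi> \<notin> H"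
    then have "(\<^bold>\<not> \<phi>) \<in> H" using decided by blast
    moreover have "derives T ((\<^bold>\<not> \<phi>) # \<Delta>) Bot"
      using that(2) by (meson derives.Asm derives.ImpE derives_weaken list.set_intros(1) set_subset_Cons)
    ultimately show False
      using consistent[of "(\<^bold>\<not> \<phi>) # \<Delta>"] that(1) by simp
  qed
  \<comment> \<open>Witnesses are guaranteed only at the stage that treats \<open>\<phi>\<close>. A
    negation in \<open>H\<close> must be present by then, since otherwise that stage would have put
    \<open>\<phi>\<close> into \<open>H\<close> as well.\<close>
  have early: "(\<^bold>\<not> \<phi>) \<in> H \<Longrightarrow> (\<^bold>\<not> \<phi>) \<in> set (C (Suc (to_nat \<phi>)))" for \<phi>
  proof (rule ccontr)
    assume neg: "(\<^bold>\<not> \<phi>) \<in> H" and "(\<^bold>\<not> \<phi>) \<notin> set (C (Suc (to_nat \<phi>)))"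
    then have "\<phi> \<in> H"
      using step[OF cons, of "to_nat \<phi>"] by (auto simp: good_def H_def)
    moreover have "derives T [\<phi>, \<^bold>\<not> \<phi>] Bot"
      by (rule derives.ImpE[of _ _ \<phi>]) (simp_all add: derives.Asm)
    ultimately show False
      using neg consistent[of "[\<phi>, \<^bold>\<not> \<phi>]"] by simp
  qed
  have "Henkin T H"
    unfolding Henkin_def
  proof (intro conjI allI impI)
    show "Bot \<notin> H"
      using consistent[of "[Bot]"] derives.Asm[of Bot "[Bot]" T] by auto
    show "\<exists>t. (\<^bold>\<not> inst t \<phi>) \<in> H" if "(\<^bold>\<not> AllN \<phi>) \<in> H" for \<phi>
      using step[OF cons, of "to_nat (AllN \<phi>)"] early[OF that] by (auto simp: good_def H_def)
    show "\<exists>t. (\<^bold>\<not> instS t \<phi>) \<in> H" if "(\<^bold>\<not> AllS \<phi>) \<in> H" for \<phi>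
      using step[OF cons, of "to_nat (AllS \<phi>)"] early[OF that] by (auto simp: good_def H_def)
  qed (use closed decided in auto)
  moreover have "set \<Gamma> \<subseteq> H"
    using UN_upper[of 0 UNIV "\<lambda>n. set (C n)"] by (simp add: H_def C_def)
  ultimately show ?thesis by (rule that)
qed

context
  fixes T H
  assumes H: "Henkin T H"
begin

lemma Henkin_derives: "set \<Gamma> \<subseteq> H \<Longrightarrow> derives T \<Gamma> \<phi> \<Longrightarrow> \<phi> \<in> H"
  using H unfolding Henkin_def by blast

lemma Henkin_Bot: "Bot \<notin> H"
  using H unfolding Henkin_def by blast

lemma Henkin_Imp: "(\<phi> \<^bold>\<longrightarrow> \<psi>) \<in> H \<longleftrightarrow> (\<phi> \<in> H \<longrightarrow> \<psi> \<in> H)"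
proof
  assume "(\<phi> \<^bold>\<longrightarrow> \<psi>) \<in> H"
  moreover have "derives T [\<phi>, \<phi> \<^bold>\<longrightarrow> \<psi>] \<psi>"
    by (rule derives.ImpE[of _ _ \<phi>]) (simp_all add: derives.Asm)
  ultimately show "\<phi> \<in> H \<longrightarrow> \<psi> \<in> H"
    using Henkin_derives[of "[\<phi>, \<phi> \<^bold>\<longrightarrow> \<psi>]" \<psi>] by simp
next
  assume imp: "\<phi> \<in> H \<longrightarrow> \<psi> \<in> H"
  show "(\<phi> \<^bold>\<longrightarrow> \<psi>) \<in> H"
  proof (cases "\<phi> \<in> H")
    case True
    with imp show ?thesis
      using Henkin_derives[of "[\<psi>]" "\<phi> \<^bold>\<longrightarrow> \<psi>"] by (simp add: derives.ImpI derives.Asm)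
  next
    case False
    then have "(\<^bold>\<not> \<phi>) \<in> H" using H unfolding Henkin_def by blast
    moreover have "derives T [\<phi>, \<^bold>\<not> \<phi>] Bot"
      by (rule derives.ImpE[of _ _ \<phi>]) (simp_all add: derives.Asm)
    then have "derives T [\<^bold>\<not> \<phi>] (\<phi> \<^bold>\<longrightarrow> \<psi>)"
      by (rule derives.ImpI[OF derives_contradiction])
    ultimately show ?thesis
      using Henkin_derives[of "[\<^bold>\<not> \<phi>]"] by simp
  qed
qed

lemma Henkin_AllN: "AllN \<phi> \<in> H \<longleftrightarrow> (\<forall>t. inst t \<phi> \<in> H)"
proof
  assume "AllN \<phi> \<in> H"
  then show "\<forall>t. inst t \<phi> \<in> H"
    using Henkin_derives[of "[AllN \<phi>]"] derives.AllE[OF derives.Asm[of "AllN \<phi>" "[AllN \<phi>]"]] by auto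
next
  assume "\<forall>t. inst t \<phi> \<in> H"
  then show "AllN \<phi> \<in> H"
    using H Henkin_Imp Henkin_Bot unfolding Henkin_def by blast
qed

lemma Henkin_AllS: "AllS \<phi> \<in> H \<longleftrightarrow> (\<forall>X. instS X \<phi> \<in> H)"
proof
  assume "AllS \<phi> \<in> H"
  then show "\<forall>X. instS X \<phi> \<in> H"
    using Henkin_derives[of "[AllS \<phi>]"] derives.AllSE[OF derives.Asm[of "AllS \<phi>" "[AllS \<phi>]"]] by auto
next
  assume "\<forall>X. instS X \<phi> \<in> H"
  then show "AllS \<phi> \<in> H"
    using H Henkin_Imp Henkin_Bot unfolding Henkin_def by blast
qed

lemma Henkin_refl: "(t \<^bold>= t) \<in> H"
  using Henkin_derives[of "[]"] by (simp add: derives.Refl)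

lemma Henkin_subst: "(t \<^bold>= u) \<in> H \<Longrightarrow> inst t \<phi> \<in> H \<Longrightarrow> inst u \<phi> \<in> H"
  using Henkin_derives[of "[t \<^bold>= u, inst t \<phi>]" "inst u \<phi>"]
    derives.Subst[OF derives.Asm derives.Asm, of t u "[t \<^bold>= u, inst t \<phi>]" \<phi> T]
  by simp

text \<open>Free variables of an axiom count as universally quantified, so \<open>H\<close> contains
  all its substitution instances; \<open>valid_term\<close> rests on this.\<close>

lemma Henkin_axiom: "\<phi> \<in> T \<Longrightarrow> nsub \<sigma> (ssub \<rho> \<phi>) \<in> H"
  using Henkin_derives[of "[]" "nsub \<sigma> (ssub \<rho> \<phi>)"]
  by (simp add: derives.Axm derives_closed_nsub derives_closed_ssub)

end

section \<open>Semantics\<close>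

primrec ev :: "(nat \<Rightarrow> 'a::{zero,one,plus,times}) \<Rightarrow> tm \<Rightarrow> 'a" where
  "ev e (Var n) = e n"
| "ev e Zero = 0"
| "ev e One = 1"
| "ev e (t \<^bold>+ u) = ev e t + ev e u"
| "ev e (t \<^bold>* u) = ev e t * ev e u"

primrec sat :: "'a::{zero,one,plus,times,ord} set set \<Rightarrow> (nat \<Rightarrow> 'a) \<Rightarrow> (nat \<Rightarrow> 'a set) \<Rightarrow> fm \<Rightarrow> bool" where
  "sat \<S> e E (t \<^bold>= u) \<longleftrightarrow> ev e t = ev e u"
| "sat \<S> e E (t \<^bold>< u) \<longleftrightarrow> ev e t < ev e u"
| "sat \<S> e E (t \<^bold>\<in> X) \<longleftrightarrow> ev e t \<in> E X"
| "sat \<S> e E Bot \<longleftrightarrow> False"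
| "sat \<S> e E (\<phi> \<^bold>\<longrightarrow> \<psi>) \<longleftrightarrow> (sat \<S> e E \<phi> \<longrightarrow> sat \<S> e E \<psi>)"
| "sat \<S> e E (AllN \<phi>) \<longleftrightarrow> (\<forall>x. sat \<S> (case_nat x e) E \<phi>)"
| "sat \<S> e E (AllS \<phi>) \<longleftrightarrow> (\<forall>X\<in>\<S>. sat \<S> e (case_nat X E) \<phi>)"

definition valid :: "'a::{zero,one,plus,times,ord} set set \<Rightarrow> fm \<Rightarrow> bool" where
  "valid \<S> \<phi> \<longleftrightarrow> (\<forall>e E. range E \<subseteq> \<S> \<longrightarrow> sat \<S> e E \<phi>)"

lemma ev_tsub: "ev e (tsub \<sigma> t) = ev (\<lambda>n. ev e (\<sigma> n)) t"
  by (induction t) auto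

lemma ev_shift: "ev e (shift k t) = ev (\<lambda>n. e (n + k)) t"
  by (simp add: shift_def ev_tsub)

lemma ev_shift_0 [simp]: "ev e (shift 0 t) = ev e t"
  and ev_shift_Suc [simp]: "ev (case_nat x e) (shift (Suc k) t) = ev e (shift k t)"
  by (simp_all add: ev_shift)

lemma ev_under: "(\<lambda>n. ev (case_nat x e) (under \<sigma> n)) = case_nat x (\<lambda>n. ev e (\<sigma> n))"
  by (rule ext) (simp add: under_def split: nat.split)

lemma sat_nsub: "sat \<S> e E (nsub \<sigma> \<phi>) \<longleftrightarrow> sat \<S> (\<lambda>n. ev e (\<sigma> n)) E \<phi>"
  by (induction \<phi> arbitrary: e E \<sigma>) (auto simp: ev_tsub ev_under)

lemma case_nat_underS: "(\<lambda>n. case_nat X E (underS \<rho> n)) = case_nat X (\<lambda>n. E (\<rho> n))"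
  by (rule ext) (simp add: underS_def split: nat.split)

lemma sat_ssub: "sat \<S> e E (ssub \<rho> \<phi>) \<longleftrightarrow> sat \<S> e (\<lambda>n. E (\<rho> n)) \<phi>"
  by (induction \<phi> arbitrary: e E \<rho>) (auto simp: case_nat_underS)

lemma sat_inst: "sat \<S> e E (inst t \<phi>) \<longleftrightarrow> sat \<S> (case_nat (ev e t) e) E \<phi>"
proof -
  have "(\<lambda>n. ev e (case_nat t Var n)) = case_nat (ev e t) e"
    by (rule ext) (simp split: nat.split)
  then show ?thesis by (simp add: inst_def sat_nsub)
qed

lemma sat_instS: "sat \<S> e E (instS X \<phi>) \<longleftrightarrow> sat \<S> e (case_nat (E X) E) \<phi>"
proof -
  have "(\<lambda>n. E (case_nat X (\<lambda>n. n) n)) = case_nat (E X) E"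
    by (rule ext) (simp split: nat.split)
  then show ?thesis by (simp add: instS_def sat_ssub)
qed

lemma sat_lift: "sat \<S> (case_nat x e) E (lift \<phi>) \<longleftrightarrow> sat \<S> e E \<phi>"
  by (simp add: lift_def sat_nsub)

lemma sat_liftS: "sat \<S> e (case_nat X E) (liftS \<phi>) \<longleftrightarrow> sat \<S> e E \<phi>"
  by (simp add: liftS_def sat_ssub)

lemma range_case_nat: "range E \<subseteq> \<S> \<Longrightarrow> X \<in> \<S> \<Longrightarrow> range (case_nat X E) \<subseteq> \<S>"
  by (auto simp: image_subset_iff split: nat.split)

text \<open>Serves to show that \<open>RCA0\<close> is consistent, by way of the standard model with
  all sets of natural numbers.\<close>

lemma soundness:
  assumes "derives T \<Gamma> \<phi>" and T: "\<And>\<psi>. \<psi> \<in> T \<Longrightarrow> valid \<S> \<psi>"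
    and "range E \<subseteq> \<S>" "\<forall>\<psi>\<in>set \<Gamma>. sat \<S> e E \<psi>"
  shows "sat \<S> e E \<phi>"
  using assms(1,3,4)
proof (induction arbitrary: e E rule: derives.induct)
  case (Axm \<phi> \<Gamma>)
  then show ?case using T by (auto simp: valid_def)
next
  case (AllI \<Gamma> \<phi>)
  have "sat \<S> (case_nat x e) E \<phi>" for x
    using AllI.prems by (intro AllI.IH) (auto simp: sat_lift)
  then show ?case by simp
next
  case (AllSI \<Gamma> \<phi>)
  have "sat \<S> e (case_nat X E) \<phi>" if "X \<in> \<S>" for X
    using AllSI.prems that by (intro AllSI.IH range_case_nat) (auto simp: sat_liftS)
  then show ?case by simp
next
  case (AllSE \<Gamma> \<phi> X)
  then show ?case by (auto simp: sat_instS image_subset_iff)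
next
  case (Classical \<phi> \<Gamma>)
  then show ?case by fastforce
qed (auto simp: sat_inst)

lemma sat_induction_axiom:
  "sat \<S> e E (induction_axiom \<phi>) \<longleftrightarrow>
    (sat \<S> (case_nat 0 e) E \<phi> \<and> (\<forall>x. sat \<S> (case_nat x e) E \<phi> \<longrightarrow> sat \<S> (case_nat (x + 1) e) E \<phi>)
      \<longrightarrow> (\<forall>x. sat \<S> (case_nat x e) E \<phi>))"
proof -
  have "(\<lambda>n. ev (case_nat x e) (case_nat (Var 0 \<^bold>+ One) (\<lambda>n. Var (Suc n)) n)) = case_nat (x + 1) e" for x
    by (rule ext) (simp split: nat.split)
  then show ?thesis by (simp add: induction_axiom_def sat_inst sat_nsub)
qed

lemma sat_comprehension_axiom:
  "sat \<S> e E (comprehension_axiom \<phi>) \<longleftrightarrow> (\<exists>X\<in>\<S>. \<forall>x. x \<in> X \<longleftrightarrow> sat \<S> (case_nat x e) E \<phi>)"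
  by (auto simp: comprehension_axiom_def sat_liftS)

lemma RCA0_standard: "\<phi> \<in> RCA0 \<Longrightarrow> valid (UNIV :: nat set set) \<phi>"
proof -
  have "sat UNIV e E (induction_axiom \<psi>)" for e :: "nat \<Rightarrow> nat" and E \<psi>
    unfolding sat_induction_axiom
    using nat_induct[of "\<lambda>x. sat UNIV (case_nat x e) E \<psi>", unfolded Suc_eq_plus1] by blast
  moreover have "sat UNIV e E (comprehension_axiom \<psi>)" for e :: "nat \<Rightarrow> nat" and E \<psi>
    unfolding sat_comprehension_axiom by (rule bexI[of _ "{x. sat UNIV (case_nat x e) E \<psi>}"]) simp_all
  moreover have "sat UNIV e E \<psi>" if "\<psi> \<in> Robinson" for e :: "nat \<Rightarrow> nat" and E \<psi>
    using that not0_implies_Suc by (auto simp: Robinson_def Let_def)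
  ultimately show "\<phi> \<in> RCA0 \<Longrightarrow> valid (UNIV :: nat set set) \<phi>"
    by (auto simp: RCA0_def valid_def)
qed


section \<open>Definable predicates\<close>

text \<open>
  A predicate on environments is represented by a formula and a map that sends each variable of the
  formula either to a place of the environment or to a fixed element of the model, a parameter.
\<close>

definition assign :: "(nat \<Rightarrow> nat + 'a) \<Rightarrow> (nat \<Rightarrow> 'a) \<Rightarrow> nat \<Rightarrow> 'a" where
  "assign \<sigma> e n = (case \<sigma> n of Inl k \<Rightarrow> e k | Inr c \<Rightarrow> c)"

definition tdef :: "((nat \<Rightarrow> 'a::{zero,one,plus,times}) \<Rightarrow> 'a) \<Rightarrow> bool" where
  "tdef f \<longleftrightarrow> (\<exists>t \<sigma>. \<forall>e. f e = ev (assign \<sigma> e) t)"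

text \<open>Being a property of predicates, definability is proved by introduction rules that follow
  the shape of \<open>P\<close>, and no formula has to be written out. The set parameters in
  \<open>E\<close> come from \<open>\<S>\<close>; later they absorb unbounded quantifiers.\<close>

definition bdef :: "'a::{zero,one,plus,times,ord} set set \<Rightarrow> ((nat \<Rightarrow> 'a) \<Rightarrow> bool) \<Rightarrow> bool" where
  "bdef \<S> P \<longleftrightarrow> (\<exists>\<theta> \<sigma> E. bounded \<theta> \<and> range E \<subseteq> \<S> \<and> (\<forall>e. P e \<longleftrightarrow> sat \<S> (assign \<sigma> e) E \<theta>))"

definition sdef :: "'a::{zero,one,plus,times,ord} set set \<Rightarrow> ((nat \<Rightarrow> 'a) \<Rightarrow> bool) \<Rightarrow> bool" where
  "sdef \<S> P \<longleftrightarrow> (\<exists>Q. bdef \<S> Q \<and> (\<forall>e. P e \<longleftrightarrow> (\<exists>x. Q (case_nat x e))))"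

lemma nsub_BAll: "nsub \<sigma> (BAll t \<phi>) = BAll (tsub \<sigma> t) (nsub (under \<sigma>) \<phi>)"
  by (simp add: BAll_def shift_def tsub_tsub)

lemma bounded_nsub: "bounded \<phi> \<Longrightarrow> bounded (nsub \<sigma> \<phi>)"
  by (induction arbitrary: \<sigma> rule: bounded.induct) (auto simp: nsub_BAll intro: bounded.intros)

lemma bounded_ssub: "bounded \<phi> \<Longrightarrow> bounded (ssub \<rho> \<phi>)"
  by (induction arbitrary: \<rho> rule: bounded.induct)
    (auto simp: BAll_def intro: bounded.intros bounded.intros(6)[unfolded BAll_def One_nat_def])

text \<open>Keeps the variables of two representations apart: even variables for the first, odd ones
  for the second.\<close>

definition merge :: "(nat \<Rightarrow> 'b) \<Rightarrow> (nat \<Rightarrow> 'b) \<Rightarrow> nat \<Rightarrow> 'b" where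
  "merge f g n = (if even n then f (n div 2) else g (n div 2))"

lemma merge_even [simp]: "merge f g (2 * n) = f n"
  and merge_odd [simp]: "merge f g (Suc (2 * n)) = g n"
  by (simp_all add: merge_def)

lemma range_merge: "range f \<subseteq> A \<Longrightarrow> range g \<subseteq> A \<Longrightarrow> range (merge f g) \<subseteq> A"
  by (auto simp: merge_def)

lemma assign_merge [simp]:
  "assign (merge \<sigma> \<tau>) e (2 * n) = assign \<sigma> e n" "assign (merge \<sigma> \<tau>) e (Suc (2 * n)) = assign \<tau> e n"
  by (simp_all add: assign_def)

lemma ev_merge:
  "ev (assign (merge \<sigma> \<tau>) e) (tsub (\<lambda>n. Var (2 * n)) t) = ev (assign \<sigma> e) t"
  "ev (assign (merge \<sigma> \<tau>) e) (tsub (\<lambda>n. Var (Suc (2 * n))) t) = ev (assign \<tau> e) t"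
  by (simp_all add: ev_tsub)

lemma sat_merge:
  "sat \<S> (assign (merge \<sigma> \<tau>) e) (merge E F) (nsub (\<lambda>n. Var (2 * n)) (ssub (\<lambda>n. 2 * n) \<phi>))
    \<longleftrightarrow> sat \<S> (assign \<sigma> e) E \<phi>"
  "sat \<S> (assign (merge \<sigma> \<tau>) e) (merge E F) (nsub (\<lambda>n. Var (Suc (2 * n))) (ssub (\<lambda>n. Suc (2 * n)) \<phi>))
    \<longleftrightarrow> sat \<S> (assign \<tau> e) F \<phi>"
  by (simp_all add: sat_nsub sat_ssub)

section \<open>Closure properties of definable terms and bounded predicates\<close>

lemma tdef_var: "tdef (\<lambda>e. e k)"
  unfolding tdef_def by (intro exI[of _ "Var 0"] exI[of _ "\<lambda>_. Inl k"]) (simp add: assign_def)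

lemma tdef_const: "tdef (\<lambda>e. c)"
  unfolding tdef_def by (intro exI[of _ "Var 0"] exI[of _ "\<lambda>_. Inr c"]) (simp add: assign_def)

lemma tdef_add: "tdef f \<Longrightarrow> tdef g \<Longrightarrow> tdef (\<lambda>e. f e + g e)"
proof -
  assume "tdef f" "tdef g"
  then obtain t \<sigma> u \<tau> where "\<And>e. f e = ev (assign \<sigma> e) t" "\<And>e. g e = ev (assign \<tau> e) u"
    unfolding tdef_def by metis
  then show ?thesis
    unfolding tdef_def
    by (intro exI[of _ "tsub (\<lambda>n. Var (2 * n)) t \<^bold>+ tsub (\<lambda>n. Var (Suc (2 * n))) u"] exI[of _ "merge \<sigma> \<tau>"])
      (simp add: ev_merge)
qed

lemma tdef_mult: "tdef f \<Longrightarrow> tdef g \<Longrightarrow> tdef (\<lambda>e. f e * g e)"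
proof -
  assume "tdef f" "tdef g"
  then obtain t \<sigma> u \<tau> where "\<And>e. f e = ev (assign \<sigma> e) t" "\<And>e. g e = ev (assign \<tau> e) u"
    unfolding tdef_def by metis
  then show ?thesis
    unfolding tdef_def
    by (intro exI[of _ "tsub (\<lambda>n. Var (2 * n)) t \<^bold>* tsub (\<lambda>n. Var (Suc (2 * n))) u"] exI[of _ "merge \<sigma> \<tau>"])
      (simp add: ev_merge)
qed

lemmas tdef_intros = tdef_var tdef_const tdef_add tdef_mult

locale set_universe =
  fixes \<S> :: "'a::{zero,one,plus,times,ord} set set"
  assumes nonempty: "\<S> \<noteq> {}"
begin

lemma some_range: "\<exists>E :: nat \<Rightarrow> 'a set. range E \<subseteq> \<S>"
proof -
  obtain X where "X \<in> \<S>" using nonempty by blast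
  then show ?thesis by (intro exI[of _ "\<lambda>_. X"]) auto
qed

lemma bdefI:
  assumes "bounded \<theta>" "\<And>E e. P e \<longleftrightarrow> sat \<S> (assign \<sigma> e) E \<theta>"
  shows "bdef \<S> P"
proof -
  obtain E :: "nat \<Rightarrow> 'a set" where "range E \<subseteq> \<S>"
    using some_range ..
  with assms show ?thesis
    unfolding bdef_def by (intro exI[of _ \<theta>] exI[of _ \<sigma>] exI[of _ E]) simp
qed

lemma bdef_eq: "tdef f \<Longrightarrow> tdef g \<Longrightarrow> bdef \<S> (\<lambda>e. f e = g e)"
proof -
  assume "tdef f" "tdef g"
  then obtain t \<sigma> u \<tau> where "\<And>e. f e = ev (assign \<sigma> e) t" "\<And>e. g e = ev (assign \<tau> e) u"
    unfolding tdef_def by metis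
  then show ?thesis
    by (intro bdefI[of "tsub (\<lambda>n. Var (2 * n)) t \<^bold>= tsub (\<lambda>n. Var (Suc (2 * n))) u" _ "merge \<sigma> \<tau>"])
      (simp_all add: ev_merge bounded.intros)
qed

lemma bdef_less: "tdef f \<Longrightarrow> tdef g \<Longrightarrow> bdef \<S> (\<lambda>e. f e < g e)"
proof -
  assume "tdef f" "tdef g"
  then obtain t \<sigma> u \<tau> where "\<And>e. f e = ev (assign \<sigma> e) t" "\<And>e. g e = ev (assign \<tau> e) u"
    unfolding tdef_def by metis
  then show ?thesis
    by (intro bdefI[of "tsub (\<lambda>n. Var (2 * n)) t \<^bold>< tsub (\<lambda>n. Var (Suc (2 * n))) u" _ "merge \<sigma> \<tau>"])
      (simp_all add: ev_merge bounded.intros)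
qed

lemma bdef_mem:
  assumes "tdef f" "X \<in> \<S>"
  shows "bdef \<S> (\<lambda>e. f e \<in> X)"
proof -
  obtain t \<sigma> where "\<forall>e. f e = ev (assign \<sigma> e) t" using assms(1) unfolding tdef_def by metis
  then show ?thesis
    unfolding bdef_def using assms(2)
    by (intro exI[of _ "t \<^bold>\<in> 0"] exI[of _ \<sigma>] exI[of _ "\<lambda>_. X"]) (auto intro: bounded.intros)
qed

lemma bdef_False: "bdef \<S> (\<lambda>e. False)"
  by (rule bdefI[of Bot]) (simp_all add: bounded.intros)

lemma bdef_imp:
  assumes "bdef \<S> P" "bdef \<S> Q"
  shows "bdef \<S> (\<lambda>e. P e \<longrightarrow> Q e)"
proof -
  obtain \<theta> \<sigma> E where 1: "bounded \<theta>" "range E \<subseteq> \<S>" "\<And>e. P e \<longleftrightarrow> sat \<S> (assign \<sigma> e) E \<theta>"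
    using assms(1) unfolding bdef_def by metis
  obtain \<eta> \<tau> F where 2: "bounded \<eta>" "range F \<subseteq> \<S>" "\<And>e. Q e \<longleftrightarrow> sat \<S> (assign \<tau> e) F \<eta>"
    using assms(2) unfolding bdef_def by metis
  let ?\<theta> = "nsub (\<lambda>n. Var (2 * n)) (ssub (\<lambda>n. 2 * n) \<theta>) \<^bold>\<longrightarrow> nsub (\<lambda>n. Var (Suc (2 * n))) (ssub (\<lambda>n. Suc (2 * n)) \<eta>)"
  have "bounded ?\<theta>" "range (merge E F) \<subseteq> \<S>"
    using 1 2 by (auto intro!: bounded.intros bounded_nsub bounded_ssub simp: merge_def)
  moreover have "(P e \<longrightarrow> Q e) \<longleftrightarrow> sat \<S> (assign (merge \<sigma> \<tau>) e) (merge E F) ?\<theta>" for e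
    by (simp add: sat_merge 1 2)
  ultimately show ?thesis unfolding bdef_def by metis
qed

lemma bdef_not: "bdef \<S> P \<Longrightarrow> bdef \<S> (\<lambda>e. \<not> P e)"
  using bdef_imp[OF _ bdef_False] by simp

lemma bdef_const: "bdef \<S> (\<lambda>e. b)"
  using bdef_False bdef_not[OF bdef_False] by (cases b) simp_all

lemma bdef_conj: "bdef \<S> P \<Longrightarrow> bdef \<S> Q \<Longrightarrow> bdef \<S> (\<lambda>e. P e \<and> Q e)"
  using bdef_not[OF bdef_imp[OF _ bdef_not]] by simp

lemma bdef_disj: "bdef \<S> P \<Longrightarrow> bdef \<S> Q \<Longrightarrow> bdef \<S> (\<lambda>e. P e \<or> Q e)"
  using bdef_imp[OF bdef_not, of P Q] by (simp add: disj_imp)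

lemma bdef_iff: "bdef \<S> P \<Longrightarrow> bdef \<S> Q \<Longrightarrow> bdef \<S> (\<lambda>e. P e \<longleftrightarrow> Q e)"
  using bdef_conj[OF bdef_imp bdef_imp, of P Q Q P] by (simp add: iff_conv_conj_imp)

lemma bdef_ball:
  assumes "tdef f" "bdef \<S> (\<lambda>e. P (e 0) (\<lambda>n. e (Suc n)))"
  shows "bdef \<S> (\<lambda>e. \<forall>x<f e. P x e)"
proof -
  obtain \<theta> \<sigma> E where 1: "bounded \<theta>" "range E \<subseteq> \<S>"
    "\<And>e. P (e 0) (\<lambda>n. e (Suc n)) \<longleftrightarrow> sat \<S> (assign \<sigma> e) E \<theta>"
    using assms(2) unfolding bdef_def by metis
  obtain t \<tau> where 2: "\<And>e. f e = ev (assign \<tau> e) t"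
    using assms(1) unfolding tdef_def by metis
  \<comment> \<open>Variables that read place 0 become the bound variable through \<open>r\<close>;
    all other places drop by one. What \<open>\<sigma>'\<close> does with \<open>Inl 0\<close> does
    not affect the value, because \<open>r\<close> redirects exactly those variables.\<close>
  define \<sigma>' where "\<sigma>' n = (case \<sigma> n of Inl (Suc k) \<Rightarrow> Inl k | x \<Rightarrow> x)" for n
  define r where "r n = (if \<sigma> n = Inl 0 then Var 0 else Var (Suc (2 * n)))" for n
  let ?\<theta> = "BAll (tsub (\<lambda>n. Var (Suc (2 * n))) t) (nsub r \<theta>)"
  have r: "(\<lambda>n. ev (case_nat x (assign (merge \<sigma>' \<tau>) e)) (r n)) = assign \<sigma> (case_nat x e)" for x e
    by (rule ext) (auto simp: r_def assign_def \<sigma>'_def split: sum.split nat.split)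
  have P: "P x e \<longleftrightarrow> sat \<S> (assign \<sigma> (case_nat x e)) E \<theta>" for x e
    using 1(3)[of "case_nat x e"] by simp
  have "(\<forall>x<f e. P x e) \<longleftrightarrow> sat \<S> (assign (merge \<sigma>' \<tau>) e) E ?\<theta>" for e
    by (simp add: BAll_def sat_nsub r ev_merge P 2)
  moreover have "bounded ?\<theta>"
    using 1 by (intro bounded.intros bounded_nsub)
  ultimately show ?thesis
    unfolding bdef_def using 1(2) by blast
qed

lemma bdef_bex:
  assumes "tdef f" "bdef \<S> (\<lambda>e. P (e 0) (\<lambda>n. e (Suc n)))"
  shows "bdef \<S> (\<lambda>e. \<exists>x<f e. P x e)"
  using bdef_not[OF bdef_ball[OF assms(1), of "\<lambda>x e. \<not> P x e", OF bdef_not[OF assms(2)]]] by simp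

lemmas bdef_intros = tdef_intros bdef_eq bdef_less bdef_mem bdef_const bdef_conj bdef_disj bdef_not
  bdef_imp bdef_iff bdef_ball bdef_bex

lemma sdef_exI:
  assumes "bdef \<S> (\<lambda>e. P (e 0) (\<lambda>n. e (Suc n)))"
  shows "sdef \<S> (\<lambda>e. \<exists>x. P x e)"
  unfolding sdef_def using assms by (intro exI[of _ "\<lambda>e. P (e 0) (\<lambda>n. e (Suc n))"]) simp

lemma sdef_bdef: "bdef \<S> P \<Longrightarrow> sdef \<S> P"
  unfolding sdef_def bdef_def
proof (elim exE conjE)
  fix \<theta> \<sigma> E assume *: "bounded \<theta>" "range E \<subseteq> \<S>" "\<forall>e. P e \<longleftrightarrow> sat \<S> (assign \<sigma> e) E \<theta>"
  define \<sigma>' where "\<sigma>' n = (case \<sigma> n of Inl k \<Rightarrow> Inl (Suc k) | x \<Rightarrow> x)" for n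
  have "assign \<sigma>' (case_nat x e) = assign \<sigma> e" for x e
    by (rule ext) (simp add: assign_def \<sigma>'_def split: sum.split)
  then show "\<exists>Q. (\<exists>\<theta> \<sigma> E. bounded \<theta> \<and> range E \<subseteq> \<S> \<and> (\<forall>e. Q e \<longleftrightarrow> sat \<S> (assign \<sigma> e) E \<theta>))
      \<and> (\<forall>e. P e \<longleftrightarrow> (\<exists>x. Q (case_nat x e)))"
    using * by (intro exI[of _ "\<lambda>e. sat \<S> (assign \<sigma>' e) E \<theta>"]) auto
qed

end

locale rca0 = set_universe +
  assumes RCA0: "\<phi> \<in> RCA0 \<Longrightarrow> valid \<S> \<phi>"
begin

lemma RCA0_sat: "\<phi> \<in> RCA0 \<Longrightarrow> range E \<subseteq> \<S> \<Longrightarrow> sat \<S> e E \<phi>"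
  using RCA0 by (simp add: valid_def)

text \<open>The schemes of \<open>RCA0\<close> speak about formulas, so the element parameters of a
  definable predicate have to become free variables, valued by \<open>e\<close>, above the
  distinguished one.\<close>

lemma sdef_sat:
  assumes "sdef \<S> (\<lambda>e. P (e 0))"
  shows "\<exists>\<theta> e E. bounded \<theta> \<and> range E \<subseteq> \<S> \<and> (\<forall>x. P x \<longleftrightarrow> sat \<S> (case_nat x e) E (ExN \<theta>))"
proof -
  obtain Q where Q: "bdef \<S> Q" "\<forall>e. P (e 0) \<longleftrightarrow> (\<exists>x. Q (case_nat x e))"
    using assms unfolding sdef_def by blast
  then obtain \<theta> \<sigma> E where *: "bounded \<theta>" "range E \<subseteq> \<S>" "\<And>e. Q e \<longleftrightarrow> sat \<S> (assign \<sigma> e) E \<theta>"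
    unfolding bdef_def by metis
  \<comment> \<open>Every place above 1 may be given the value 0.\<close>
  define r where "r n = (case \<sigma> n of Inl 0 \<Rightarrow> Var 0 | Inl (Suc 0) \<Rightarrow> Var 1 | Inl _ \<Rightarrow> Zero | Inr _ \<Rightarrow> Var (Suc (Suc n)))" for n
  define e where "e n = (case \<sigma> n of Inl _ \<Rightarrow> 0 | Inr c \<Rightarrow> c)" for n
  have r: "(\<lambda>n. ev (case_nat y (case_nat x e)) (r n)) = assign \<sigma> (case_nat y (case_nat x (\<lambda>_. 0)))" for x y
    by (rule ext) (auto simp: r_def e_def assign_def split: sum.split nat.split)
  have "P x \<longleftrightarrow> sat \<S> (case_nat x e) E (ExN (nsub r \<theta>))" for x
    using Q(2)[rule_format, of "case_nat x (\<lambda>_. 0)"] by (simp add: sat_nsub r *)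
  with bounded_nsub[OF *(1), of r] *(2) show ?thesis
    by (intro exI[of _ "nsub r \<theta>"] exI[of _ e] exI[of _ E]) simp
qed

text \<open>The only source of induction on elements of the model. The case \<open>definable\<close>
  of each later induction certifies that the predicate is simple enough for the scheme.\<close>

lemma sdef_induct [case_names definable 0 step]:
  assumes "sdef \<S> (\<lambda>e. P (e 0))" "P 0" "\<And>x. P x \<Longrightarrow> P (x + 1)"
  shows "P x"
proof -
  obtain \<theta> e E where *: "bounded \<theta>" "range E \<subseteq> \<S>" "\<And>x. P x \<longleftrightarrow> sat \<S> (case_nat x e) E (ExN \<theta>)"
    using sdef_sat[where P = P, OF assms(1)] by metis
  then have "induction_axiom (ExN \<theta>) \<in> RCA0"
    unfolding RCA0_def Sigma01_def by blast
  then have "sat \<S> e E (induction_axiom (ExN \<theta>))"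
    by (rule RCA0_sat[OF _ *(2)])
  then have "P 0 \<and> (\<forall>x. P x \<longrightarrow> P (x + 1)) \<longrightarrow> (\<forall>x. P x)"
    unfolding sat_induction_axiom *(3) .
  with assms(2,3) show ?thesis by blast
qed

lemmas bdef_induct [case_names definable 0 step] = sdef_induct[OF sdef_bdef]

lemma delta_comprehension:
  assumes "sdef \<S> (\<lambda>e. P (e 0))" "sdef \<S> (\<lambda>e. \<not> P (e 0))"
  shows "{x. P x} \<in> \<S>"
proof -
  obtain \<theta> e E where 1: "bounded \<theta>" "range E \<subseteq> \<S>" "\<And>x. P x \<longleftrightarrow> sat \<S> (case_nat x e) E (ExN \<theta>)"
    using sdef_sat[where P = P, OF assms(1)] by metis
  obtain \<eta> f F where 2: "bounded \<eta>" "range F \<subseteq> \<S>" "\<And>x. \<not> P x \<longleftrightarrow> sat \<S> (case_nat x f) F (ExN \<eta>)"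
    using sdef_sat[where P = "\<lambda>x. \<not> P x", OF assms(2)] by metis
  \<comment> \<open>The two formulas share variables 0 and 1, the quantified witness and the
    element; their parameters go to the even and odd places above.\<close>
  define r where "r k n = (if n = 0 then Var 0 else if n = Suc 0 then Var 1 else Var (Suc (Suc (2 * (n - 2) + k))))" for k n :: nat
  let ?e = "merge e f"
  let ?\<theta> = "nsub (r 0) (ssub (\<lambda>n. 2 * n) \<theta>)" and ?\<eta> = "\<^bold>\<not> nsub (r 1) (ssub (\<lambda>n. Suc (2 * n)) \<eta>)"
  have r: "(\<lambda>n. ev (case_nat y (case_nat x ?e)) (r 0 n)) = case_nat y (case_nat x e)"
    "(\<lambda>n. ev (case_nat y (case_nat x ?e)) (r 1 n)) = case_nat y (case_nat x f)" for x y
    by (rule ext, auto simp: r_def split: nat.split)+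
  have s1: "sat \<S> (case_nat x ?e) (merge E F) (ExN ?\<theta>) \<longleftrightarrow> P x" for x
    by (simp add: sat_nsub sat_ssub r 1 del: One_nat_def)
  have s2: "sat \<S> (case_nat x ?e) (merge E F) (AllN ?\<eta>) \<longleftrightarrow> P x" for x
    using 2(3)[of x] by (auto simp: sat_nsub sat_ssub r simp del: One_nat_def)
  have "ExN ?\<theta> \<in> Sigma01" "AllN ?\<eta> \<in> Pi01"
    unfolding Sigma01_def Pi01_def using 1(1) 2(1) by (auto intro!: bounded.intros bounded_nsub bounded_ssub)
  then have "(AllN (ExN ?\<theta> \<^bold>\<longleftrightarrow> AllN ?\<eta>) \<^bold>\<longrightarrow> comprehension_axiom (ExN ?\<theta>)) \<in> RCA0"
    unfolding RCA0_def by blast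
  then have imp: "sat \<S> ?e (merge E F) (AllN (ExN ?\<theta> \<^bold>\<longleftrightarrow> AllN ?\<eta>) \<^bold>\<longrightarrow> comprehension_axiom (ExN ?\<theta>))"
    by (rule RCA0_sat[OF _ range_merge[OF 1(2) 2(2)]])
  have "sat \<S> (case_nat x ?e) (merge E F) (ExN ?\<theta> \<^bold>\<longleftrightarrow> AllN ?\<eta>)" for x
    using s1[of x] s2[of x] unfolding sat.simps(4,5) by blast
  then have "sat \<S> ?e (merge E F) (AllN (ExN ?\<theta> \<^bold>\<longleftrightarrow> AllN ?\<eta>))"
    by (simp only: sat.simps(6) simp_thms)
  with imp have "sat \<S> ?e (merge E F) (comprehension_axiom (ExN ?\<theta>))"
    by (rule iffD1[OF sat.simps(5), THEN mp])
  then have "\<exists>X\<in>\<S>. \<forall>x. x \<in> X \<longleftrightarrow> P x"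
    unfolding sat_comprehension_axiom s1 .
  then obtain X where "X \<in> \<S>" "\<forall>x. x \<in> X \<longleftrightarrow> P x" ..
  moreover from this have "{x. P x} = X" by auto
  ultimately show ?thesis by simp
qed

lemma comprehension: "bdef \<S> (\<lambda>e. P (e 0)) \<Longrightarrow> {x. P x} \<in> \<S>"
  by (rule delta_comprehension) (auto intro: sdef_bdef bdef_not)

lemma robinson: "x + 1 \<noteq> (0::'a) \<and> (x + 1 = y + 1 \<longrightarrow> x = y) \<and> (x \<noteq> 0 \<longrightarrow> (\<exists>z. x = z + 1))
  \<and> x + 0 = x \<and> x + (y + 1) = (x + y) + 1 \<and> x * 0 = 0 \<and> x * (y + 1) = x * y + x
  \<and> \<not> x < 0 \<and> (x < y + 1 \<longrightarrow> \<not> x < y \<longrightarrow> x = y) \<and> (\<not> x < y \<and> x \<noteq> y \<or> x < y + 1)"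
proof -
  obtain E :: "nat \<Rightarrow> 'a set" where "range E \<subseteq> \<S>"
    using some_range by blast
  then have "\<forall>\<phi>\<in>Robinson. sat \<S> (case_nat x (\<lambda>_. y)) E \<phi>"
    by (auto intro!: RCA0_sat simp: RCA0_def)
  then show ?thesis
    by (simp add: Robinson_def Let_def)
qed

section \<open>The axioms of Robinson arithmetic over the bare operations, before any algebraic
  class applies\<close>

lemma raw_suc_ne: "x + 1 \<noteq> (0::'a)"
  using robinson[of x x] by argo

lemma raw_suc_inj: "x + 1 = y + 1 \<Longrightarrow> x = (y::'a)"
  using robinson[of x y] by argo

lemma raw_zero_or_suc: "x = 0 \<or> (\<exists>y. x = y + (1::'a))"
  using robinson[of x x] by metis

lemma raw_add_0: "x + 0 = (x::'a)"
  and raw_mult_0: "x * 0 = (0::'a)"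
  and raw_not_less_0: "\<not> x < (0::'a)"
  using robinson[of x x] by argo+

lemma raw_add_suc: "x + (y + 1) = (x + y) + (1::'a)"
  and raw_mult_suc: "x * (y + 1) = x * y + (x::'a)"
  and raw_less_suc: "x < y + 1 \<longleftrightarrow> x < y \<or> x = (y::'a)"
  using robinson[of x y] by argo+

end

section \<open>Arithmetic\<close>

context rca0
begin

lemma raw_zero_add: "0 + x = (x::'a)"
proof (induction x rule: bdef_induct)
  case (step x)
  then show ?case by (metis raw_add_suc)
qed (intro bdef_intros raw_add_0)+

lemma raw_add_assoc: "(x + y) + z = x + (y + (z::'a))"
proof (induction z rule: bdef_induct)
  case 0
  show ?case by (simp only: raw_add_0)
next
  case (step z)
  then show ?case by (simp only: raw_add_suc)
qed (intro bdef_intros)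

lemma raw_suc_add: "(x + 1) + y = (x + y) + (1::'a)"
proof (induction y rule: bdef_induct)
  case 0
  show ?case by (simp only: raw_add_0)
next
  case (step y)
  then show ?case by (simp only: raw_add_suc)
qed (intro bdef_intros)

lemma raw_add_commute: "x + y = y + (x::'a)"
proof (induction y rule: bdef_induct)
  case 0
  show ?case by (simp only: raw_add_0 raw_zero_add)
next
  case (step y)
  then show ?case by (simp only: raw_add_suc raw_suc_add)
qed (intro bdef_intros)

lemma raw_add_cancel: "x + z = y + z \<Longrightarrow> x = (y::'a)"
proof (induction z rule: bdef_induct)
  case 0
  then show ?case by (simp only: raw_add_0)
next
  case (step z)
  then show ?case by (metis raw_add_suc raw_suc_inj)
qed (intro bdef_intros)

lemma raw_add_eq_0: "x + y = 0 \<Longrightarrow> x = (0::'a)"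
  by (metis raw_add_0 raw_add_suc raw_suc_ne raw_zero_or_suc)

lemma raw_distrib: "x * (y + z) = x * y + x * (z::'a)"
proof (induction z rule: bdef_induct)
  case 0
  show ?case by (simp only: raw_add_0 raw_mult_0)
next
  case (step z)
  then show ?case by (metis raw_add_suc raw_mult_suc raw_add_assoc)
qed (intro bdef_intros)

lemma raw_mult_assoc: "(x * y) * z = x * (y * (z::'a))"
proof (induction z rule: bdef_induct)
  case 0
  show ?case by (simp only: raw_mult_0)
next
  case (step z)
  then show ?case by (metis raw_mult_suc raw_distrib)
qed (intro bdef_intros)

lemma raw_zero_mult: "0 * x = (0::'a)"
proof (induction x rule: bdef_induct)
  case (step x)
  then show ?case by (simp only: raw_mult_suc raw_add_0)
qed (intro bdef_intros raw_mult_0)+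

lemma raw_suc_mult: "(x + 1) * y = x * y + (y::'a)"
proof (induction y rule: bdef_induct)
  case 0
  show ?case by (simp only: raw_add_0 raw_mult_0)
next
  case (step y)
  have "(x + 1) * (y + 1) = (x * y + y) + (x + 1)"
    by (simp only: raw_mult_suc step)
  also have "\<dots> = (x * y + x) + (y + 1)"
    by (metis raw_add_assoc raw_add_commute)
  finally show ?case by (simp only: raw_mult_suc)
qed (intro bdef_intros)

lemma raw_mult_commute: "x * y = y * (x::'a)"
proof (induction y rule: bdef_induct)
  case 0
  show ?case by (simp only: raw_mult_0 raw_zero_mult)
next
  case (step y)
  then show ?case by (simp only: raw_mult_suc raw_suc_mult)
qed (intro bdef_intros)

lemma raw_mult_1: "1 * x = (x::'a)"
  by (metis raw_suc_mult raw_zero_add raw_zero_mult)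

text \<open>The order is a primitive symbol governed by two axioms only. Expressing it by addition
  makes irreflexivity, transitivity and monotonicity consequences of the laws of addition and
  multiplication.\<close>

lemma raw_less_iff: "x < y \<longleftrightarrow> (\<exists>z. y = x + (z + (1::'a)))"
proof
  \<comment> \<open>The quantifier stands outside the implication to give the induction predicate
    the form of a Sigma01 formula.\<close>
  have "\<exists>z. x < y \<longrightarrow> y = x + (z + (1::'a))"
  proof (induction y rule: sdef_induct)
    case 0
    show ?case using raw_not_less_0 by blast
  next
    case (step y)
    then show ?case by (metis raw_less_suc raw_add_suc raw_zero_add)
  qed (intro sdef_exI bdef_intros)
  then show "x < y \<Longrightarrow> \<exists>z. y = x + (z + 1)" by blast
  have "x < x + (z + 1)" for z
  proof (induction z rule: bdef_induct)
    case 0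
    show ?case by (simp only: raw_zero_add raw_less_suc simp_thms)
  next
    case (step z)
    then show ?case by (metis raw_add_suc raw_less_suc)
  qed (intro bdef_intros)
  then show "\<exists>z. y = x + (z + 1) \<Longrightarrow> x < y" by blast
qed

lemma raw_total: "\<exists>z. y = x + z \<or> x = y + (z::'a)"
proof (induction y rule: sdef_induct)
  case 0
  show ?case by (metis raw_zero_add)
next
  case (step y)
  then show ?case by (metis raw_add_suc raw_suc_add raw_zero_or_suc raw_add_0)
qed (intro sdef_exI bdef_intros)

lemma raw_le_iff: "x < y \<or> x = y \<longleftrightarrow> (\<exists>z. y = x + (z::'a))"
  by (metis raw_add_0 raw_less_iff raw_zero_or_suc)

lemma raw_less_irrefl: "\<not> x < (x::'a)"
  by (metis raw_add_cancel raw_add_commute raw_less_iff raw_suc_ne raw_zero_add)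

lemma raw_less_trans: "x < y \<Longrightarrow> y < z \<Longrightarrow> x < (z::'a)"
  unfolding raw_less_iff by (metis raw_add_assoc)

lemma raw_mult_strict: "x < y \<Longrightarrow> 0 < z \<Longrightarrow> z * x < z * (y::'a)"
  unfolding raw_less_iff by (metis raw_add_suc raw_distrib raw_zero_add raw_suc_mult)

lemma raw_mult_eq_0: "x * y = 0 \<Longrightarrow> x = 0 \<or> y = (0::'a)"
  by (metis raw_add_eq_0 raw_add_commute raw_mult_suc raw_zero_or_suc)

end

class discrete_semiring = discrete_linordered_semidom + canonically_ordered_monoid_add

text \<open>Opens the library's arithmetic to any model of \<open>RCA0\<close>. The relation
  \<open>leq\<close> and the truncated subtraction \<open>diff\<close> are arguments because the
  type has neither at this point.\<close>

lemma (in rca0) discrete_semiring: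
  fixes leq :: "'a \<Rightarrow> 'a \<Rightarrow> bool" and diff :: "'a \<Rightarrow> 'a \<Rightarrow> 'a"
  assumes leq: "\<And>x y. leq x y \<longleftrightarrow> x < y \<or> x = y"
    and diff: "\<And>x y. diff x y = (if leq y x then THE z. x = y + z else 0)"
  shows "class.discrete_semiring (+) 0 leq (<) diff (*) (1::'a)"
proof -
  have diff_eq: "diff (y + z) y = z" for y z
  proof -
    have "leq y (y + z)" using raw_le_iff leq by blast
    moreover have "(THE w. y + z = y + w) = z"
      by (rule the_equality) (metis raw_add_cancel raw_add_commute)+
    ultimately show ?thesis by (simp add: diff)
  qed
  note leq_iff = leq[unfolded raw_le_iff]
  have diff_0: "diff x y = 0" if "\<not> leq y x" for x y
    using that by (simp add: diff)
  have diff_self: "diff x x = 0" for x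
    using diff_eq[of x 0] by (simp add: raw_add_0)
  have total: "leq x y \<or> leq y x" for x y
    using raw_total[of y x] unfolding leq_iff by blast
  have less: "x < y \<longleftrightarrow> leq x y \<and> \<not> leq y x" for x y
    using leq raw_less_irrefl raw_less_trans by metis
  show ?thesis
  proof (unfold_locales, goal_cases)
    \<comment> \<open>The law \<open>a - b - c = a - (b + c)\<close> for truncated subtraction, by
      cases on where the subtraction is cut off.\<close>
    case (10 a b c)
    consider d f where "a = b + d" "d = c + f" | d where "a = b + d" "\<not> leq c d" | "\<not> leq b a"
      unfolding leq_iff by blast
    then show ?case
    proof cases
      case 1
      then have "a = (b + c) + f" by (simp add: raw_add_assoc)
      with 1 show ?thesis by (metis diff_eq)
    next
      case 2
      then have "\<not> leq (b + c) a"
        unfolding leq_iff by (metis raw_add_assoc raw_add_cancel raw_add_commute)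
      with 2 show ?thesis by (metis diff_eq diff_0)
    next
      case 3
      then have "\<not> leq (b + c) a"
        unfolding leq_iff by (metis raw_add_assoc)
      moreover have "diff 0 c = 0"
        by (metis diff_0 diff_self leq_iff raw_add_eq_0)
      ultimately show ?thesis using 3 by (simp add: diff_0)
    qed
  next
    \<comment> \<open>Distributivity of multiplication over truncated subtraction,
      \<open>a * (b - c) = a * b - a * c\<close>.\<close>
    case (21 a b c)
    show ?case
    proof (cases "leq c b")
      case True
      then obtain d where "b = c + d" unfolding leq_iff ..
      then show ?thesis by (simp add: diff_eq raw_distrib)
    next
      case False
      then have "b < c" using less total by blast
      have "a = 0 \<or> 0 < a"
        by (metis leq leq_iff raw_zero_add)
      then have "diff (a * b) (a * c) = 0"
      proof
        assume "0 < a"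
        with \<open>b < c\<close> have "\<not> leq (a * c) (a * b)"
          using raw_mult_strict less by blast
        then show ?thesis by (rule diff_0)
      qed (simp add: raw_zero_mult diff_self)
      with False show ?thesis by (simp add: diff_0 raw_mult_0)
    qed
  next
    case (6 x y z)
    then show ?case unfolding leq_iff by (metis raw_add_assoc)
  next
    case (7 x y)
    then show ?case using leq raw_less_irrefl raw_less_trans by metis
  next
    case (11 a b c)
    then show ?case unfolding leq_iff by (metis raw_add_assoc)
  next
    case (25 b a)
    then show ?case unfolding leq_iff by (metis diff_eq raw_add_commute)
  next
    case (26 a b)
    show ?case unfolding leq_iff raw_less_iff by (metis raw_add_assoc raw_add_commute)
  next
    case 20
    show ?case by (metis raw_suc_ne raw_zero_add)
  next
    case 24
    show ?case by (metis raw_less_suc raw_zero_add)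
  next
    case (15 a b c)
    show ?case by (metis raw_distrib raw_mult_commute)
  next
    case (23 a b)
    then show ?case using raw_mult_eq_0 by blast
  qed (fact raw_add_assoc raw_add_commute raw_zero_add less leq_iff diff_eq total raw_mult_assoc raw_mult_commute
      raw_zero_mult raw_mult_0 raw_mult_1 raw_distrib | simp add: leq | erule (1) raw_mult_strict
      | simp add: diff_eq raw_add_commute)+
qed

section \<open>Closure properties of definable predicates\<close>

lemma less_add_1_iff [simp]: "x < y + 1 \<longleftrightarrow> x \<le> (y::'a::discrete_semiring)"
  by (simp add: less_iff_succ_less_eq)

lemma add_1_le_iff [simp]: "x + 1 \<le> y \<longleftrightarrow> x < (y::'a::discrete_semiring)"
  by (simp add: less_iff_succ_less_eq)

lemma less_1_iff [simp]: "x < 1 \<longleftrightarrow> x = (0::'a::discrete_semiring)"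
  using less_add_1_iff[of x 0] by simp

lemma tdef_case_nat: "tdef a \<Longrightarrow> (\<And>m. tdef (\<lambda>e. b e m)) \<Longrightarrow> tdef (\<lambda>e. case_nat (a e) (b e) n)"
  by (cases n) auto

text \<open>Composes representations. The infinitely many assignments \<open>\<tau> n\<close> are
  laid out on the even variables by a pairing of \<open>n\<close> and \<open>m\<close>, and the
  parameters of \<open>\<sigma>\<close> on the odd ones.\<close>

lemma assign_subst:
  "\<exists>\<sigma>' r. \<forall>e. (\<lambda>k. ev (assign \<sigma>' e) (r k)) = assign \<sigma> (\<lambda>n. ev (assign (\<tau> n) e) (u n))"
proof -
  let ?\<sigma>' = "merge (\<lambda>p. \<tau> (fst (prod_decode p)) (snd (prod_decode p))) \<sigma>"
  let ?r = "\<lambda>k. case \<sigma> k of Inl n \<Rightarrow> tsub (\<lambda>m. Var (2 * prod_encode (n, m))) (u n) | Inr _ \<Rightarrow> Var (Suc (2 * k))"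
  have pair: "assign ?\<sigma>' e (2 * prod_encode (n, m)) = assign (\<tau> n) e m" for n m e
    by (simp add: assign_def)
  have "(\<lambda>k. ev (assign ?\<sigma>' e) (?r k)) = assign \<sigma> (\<lambda>n. ev (assign (\<tau> n) e) (u n))" for e
  proof
    show "ev (assign ?\<sigma>' e) (?r k) = assign \<sigma> (\<lambda>n. ev (assign (\<tau> n) e) (u n)) k" for k
    proof (cases "\<sigma> k")
      case (Inl n)
      then show ?thesis by (simp add: ev_tsub pair del: assign_merge)
          (simp add: assign_def[of \<sigma>])
    qed (simp add: assign_def)
  qed
  then show ?thesis by (intro exI[of _ ?\<sigma>'] exI[of _ ?r]) simp
qed

lemma tdef_subst:
  assumes "tdef g" "\<And>n. tdef (f n)"
  shows "tdef (\<lambda>e. g (\<lambda>n. f n e))"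
proof -
  obtain t \<sigma> where t: "\<And>e. g e = ev (assign \<sigma> e) t"
    using assms(1) unfolding tdef_def by metis
  obtain u \<tau> where u: "\<And>n e. f n e = ev (assign (\<tau> n) e) (u n)"
    using assms(2) unfolding tdef_def by metis
  obtain \<sigma>' r where "\<And>e. (\<lambda>k. ev (assign \<sigma>' e) (r k)) = assign \<sigma> (\<lambda>n. f n e)"
    unfolding u using assign_subst[of \<sigma> \<tau> u] by metis
  then have "\<forall>e. g (\<lambda>n. f n e) = ev (assign \<sigma>' e) (tsub r t)"
    by (simp add: t ev_tsub)
  then show ?thesis unfolding tdef_def by blast
qed

context set_universe
begin

lemma bdef_subst:
  assumes "bdef \<S> Q" "\<And>n. tdef (f n)"
  shows "bdef \<S> (\<lambda>e. Q (\<lambda>n. f n e))"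
proof -
  obtain \<theta> \<sigma> E where \<theta>: "bounded \<theta>" "range E \<subseteq> \<S>" "\<And>e. Q e \<longleftrightarrow> sat \<S> (assign \<sigma> e) E \<theta>"
    using assms(1) unfolding bdef_def by metis
  obtain u \<tau> where u: "\<And>n e. f n e = ev (assign (\<tau> n) e) (u n)"
    using assms(2) unfolding tdef_def by metis
  obtain \<sigma>' r where "\<And>e. (\<lambda>k. ev (assign \<sigma>' e) (r k)) = assign \<sigma> (\<lambda>n. f n e)"
    unfolding u using assign_subst[of \<sigma> \<tau> u] by metis
  then have "\<forall>e. Q (\<lambda>n. f n e) \<longleftrightarrow> sat \<S> (assign \<sigma>' e) E (nsub r \<theta>)"
    by (simp add: \<theta>(3) sat_nsub)
  then show ?thesis
    unfolding bdef_def using bounded_nsub[OF \<theta>(1)] \<theta>(2) by blast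
qed

end

locale rca0_model = rca0 \<S> for \<S> :: "'a::discrete_semiring set set"
begin

lemma bdef_le: "tdef f \<Longrightarrow> tdef g \<Longrightarrow> bdef \<S> (\<lambda>e. f e \<le> g e)"
  unfolding le_less by (intro bdef_intros)

lemma bdef_ball_le:
  assumes "tdef f" "bdef \<S> (\<lambda>e. P (e 0) (\<lambda>n. e (Suc n)))"
  shows "bdef \<S> (\<lambda>e. \<forall>x\<le>f e. P x e)"
  using bdef_ball[OF tdef_add[OF assms(1) tdef_const[of 1]], of P, OF assms(2)] by simp

lemma bdef_bex_le:
  assumes "tdef f" "bdef \<S> (\<lambda>e. P (e 0) (\<lambda>n. e (Suc n)))"
  shows "bdef \<S> (\<lambda>e. \<exists>x\<le>f e. P x e)"
  using bdef_bex[OF tdef_add[OF assms(1) tdef_const[of 1]], of P, OF assms(2)] by simp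

lemmas bdef_intros = bdef_intros bdef_le bdef_ball_le bdef_bex_le

lemma sdef_cong: "sdef \<S> P \<Longrightarrow> (\<And>e. P e \<longleftrightarrow> Q e) \<Longrightarrow> sdef \<S> Q"
  using ext[of P Q] by simp

text \<open>Two unbounded quantifiers merge into one: quantify over a common bound of both witnesses
  and bound the witnesses by it.\<close>

lemma sdef_ex:
  assumes "sdef \<S> (\<lambda>e. P (e 0) (\<lambda>n. e (Suc n)))"
  shows "sdef \<S> (\<lambda>e. \<exists>x. P x e)"
proof -
  obtain Q where Q: "bdef \<S> Q" "\<And>e. P (e 0) (\<lambda>n. e (Suc n)) \<longleftrightarrow> (\<exists>y. Q (case_nat y e))"
    using assms unfolding sdef_def by metis
  have P: "P x e \<longleftrightarrow> (\<exists>y. Q (case_nat y (case_nat x e)))" for x e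
    using Q(2)[of "case_nat x e"] by simp
  \<comment> \<open>Skips place 2, which the common bound occupies below the two bounded
    quantifiers.\<close>
  define f :: "nat \<Rightarrow> (nat \<Rightarrow> 'a) \<Rightarrow> 'a" where
    "f n e = case_nat (e 0) (case_nat (e (Suc 0)) (\<lambda>n. e (Suc (Suc (Suc n))))) n" for n e
  have "tdef (f n)" for n
    unfolding f_def by (intro tdef_case_nat tdef_var)
  from bdef_subst[of Q f, OF Q(1) this]
  have "bdef \<S> (\<lambda>e. Q (case_nat (e 0) (case_nat (e (Suc 0)) (\<lambda>n. e (Suc (Suc (Suc n)))))))"
    by (simp add: f_def)
  then have "sdef \<S> (\<lambda>e. \<exists>b. \<exists>x<b. \<exists>y<b. Q (case_nat y (case_nat x e)))"
    by (intro sdef_exI bdef_intros)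
  then show ?thesis
  proof (rule sdef_cong)
    fix e :: "nat \<Rightarrow> 'a"
    have "\<exists>b. x < b \<and> y < b" for x y :: 'a
      by (intro exI[of _ "x + y + 1"]) (simp add: add_increasing add_increasing2)
    then show "(\<exists>b. \<exists>x<b. \<exists>y<b. Q (case_nat y (case_nat x e))) \<longleftrightarrow> (\<exists>x. P x e)"
      unfolding P by meson
  qed
qed

lemma bdef_under:
  assumes "bdef \<S> Q"
  shows "bdef \<S> (\<lambda>e. Q (case_nat (e k) (\<lambda>n. e (n + m))))"
proof -
  have "tdef (\<lambda>e. case_nat (e k) (\<lambda>n. e (n + m)) n :: 'a)" for n
    by (intro tdef_case_nat tdef_var)
  from bdef_subst[OF assms this] show ?thesis by simp
qed

lemma sdef_conj:
  assumes "sdef \<S> P" "sdef \<S> R"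
  shows "sdef \<S> (\<lambda>e. P e \<and> R e)"
proof -
  obtain Q Q' where Q: "bdef \<S> Q" "\<And>e. P e \<longleftrightarrow> (\<exists>y. Q (case_nat y e))"
    and Q': "bdef \<S> Q'" "\<And>e. R e \<longleftrightarrow> (\<exists>y. Q' (case_nat y e))"
    using assms unfolding sdef_def by metis
  have "sdef \<S> (\<lambda>e. \<exists>x. \<exists>y. Q (case_nat x e) \<and> Q' (case_nat y e))"
    using bdef_under[OF Q(1), of 1 2] bdef_under[OF Q'(1), of 0 2]
    by (intro sdef_ex sdef_exI bdef_conj) simp_all
  then show ?thesis
    by (rule sdef_cong) (auto simp: Q Q')
qed

lemma sdef_disj:
  assumes "sdef \<S> P" "sdef \<S> R"
  shows "sdef \<S> (\<lambda>e. P e \<or> R e)"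
proof -
  obtain Q Q' where Q: "bdef \<S> Q" "\<And>e. P e \<longleftrightarrow> (\<exists>y. Q (case_nat y e))"
    and Q': "bdef \<S> Q'" "\<And>e. R e \<longleftrightarrow> (\<exists>y. Q' (case_nat y e))"
    using assms unfolding sdef_def by metis
  have "sdef \<S> (\<lambda>e. \<exists>x. Q (case_nat x e) \<or> Q' (case_nat x e))"
    using bdef_under[OF Q(1), of 0 1] bdef_under[OF Q'(1), of 0 1]
    by (intro sdef_exI bdef_disj) simp_all
  then show ?thesis
    by (rule sdef_cong) (auto simp: Q Q')
qed

text \<open>This is Sigma01 collection: induction on \<open>k\<close> yields a single bound for the
  witnesses of all \<open>x < k\<close>, after which the unbounded quantifier can be moved to the
  front.\<close>

lemma sdef_ball:
  assumes "tdef f" "sdef \<S> (\<lambda>e. P (e 0) (\<lambda>n. e (Suc n)))"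
  shows "sdef \<S> (\<lambda>e. \<forall>x<f e. P x e)"
proof -
  obtain Q where Q: "bdef \<S> Q" "\<And>e. P (e 0) (\<lambda>n. e (Suc n)) \<longleftrightarrow> (\<exists>y. Q (case_nat y e))"
    using assms unfolding sdef_def by metis
  have P: "P x e \<longleftrightarrow> (\<exists>y. Q (case_nat y (case_nat x e)))" for x e
    using Q(2)[of "case_nat x e"] by simp
  define g :: "nat \<Rightarrow> (nat \<Rightarrow> 'a) \<Rightarrow> 'a" where
    "g n e = case_nat (e 0) (case_nat (e (Suc 0)) (\<lambda>n. e (Suc (Suc (Suc n))))) n" for n e
  have "tdef (g n)" for n
    unfolding g_def by (intro tdef_case_nat tdef_var)
  from bdef_subst[of Q g, OF Q(1) this]
  have "bdef \<S> (\<lambda>e. Q (case_nat (e 0) (case_nat (e (Suc 0)) (\<lambda>n. e (Suc (Suc (Suc n)))))))"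
    by (simp add: g_def)
  moreover have "tdef (\<lambda>e. f (\<lambda>n. e (Suc n)))"
    by (rule tdef_subst[OF assms(1), of "\<lambda>n e. e (Suc n)", OF tdef_var])
  ultimately have "sdef \<S> (\<lambda>e. \<exists>b. \<forall>x<f e. \<exists>y<b. Q (case_nat y (case_nat x e)))"
    by (intro sdef_exI bdef_intros)
  then show ?thesis
  proof (rule sdef_cong)
    fix e :: "nat \<Rightarrow> 'a"
    have "tdef (\<lambda>e'. case_nat (e' 0) (case_nat (e' (Suc 0)) e) n)" for n
      by (intro tdef_case_nat tdef_var tdef_const)
    from bdef_subst[OF Q(1), of "\<lambda>n e'. case_nat (e' 0) (case_nat (e' (Suc 0)) e) n", OF this]
    have def: "bdef \<S> (\<lambda>e'. Q (case_nat (e' 0) (case_nat (e' (Suc 0)) e)))" .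
    \<comment> \<open>The guard \<open>x < f e\<close> lets the induction run through all
      \<open>k\<close>, although witnesses are given only below \<open>f e\<close>.\<close>
    have "\<exists>b. \<forall>x<k. x < f e \<longrightarrow> (\<exists>y<b. Q (case_nat y (case_nat x e)))" if *: "\<forall>x<f e. P x e" for k
    proof (induction k rule: sdef_induct)
      case (step k)
      then obtain b where b: "\<forall>x<k. x < f e \<longrightarrow> (\<exists>y<b. Q (case_nat y (case_nat x e)))" ..
      obtain y where y: "k < f e \<longrightarrow> Q (case_nat y (case_nat k e))"
        using * unfolding P by blast
      have "y < b + y + 1" "b \<le> b + y + 1"
        by (simp add: add_increasing) (metis add.assoc le_iff_add)
      with b y show ?case
        by (intro exI[of _ "b + y + 1"]) (metis le_less less_add_1_iff order_less_le_trans)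
    qed (auto intro!: sdef_exI bdef_intros def)
    from this[of "f e"]
    show "(\<exists>b. \<forall>x<f e. \<exists>y<b. Q (case_nat y (case_nat x e))) \<longleftrightarrow> (\<forall>x<f e. P x e)"
      unfolding P by blast
  qed
qed

lemma sdef_eq: "tdef f \<Longrightarrow> tdef g \<Longrightarrow> sdef \<S> (\<lambda>e. f e = g e)"
  and sdef_less: "tdef f \<Longrightarrow> tdef g \<Longrightarrow> sdef \<S> (\<lambda>e. f e < g e)"
  and sdef_le: "tdef f \<Longrightarrow> tdef g \<Longrightarrow> sdef \<S> (\<lambda>e. f e \<le> g e)"
  and sdef_mem: "tdef f \<Longrightarrow> X \<in> \<S> \<Longrightarrow> sdef \<S> (\<lambda>e. f e \<in> X)"
  and sdef_const: "sdef \<S> (\<lambda>e. b)"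
  and sdef_not: "bdef \<S> P \<Longrightarrow> sdef \<S> (\<lambda>e. \<not> P e)"
  by (auto intro!: sdef_bdef bdef_intros)

lemma sdef_imp: "bdef \<S> P \<Longrightarrow> sdef \<S> Q \<Longrightarrow> sdef \<S> (\<lambda>e. P e \<longrightarrow> Q e)"
  unfolding imp_conv_disj by (intro sdef_disj sdef_not)

lemma sdef_bex:
  assumes "tdef f" "sdef \<S> (\<lambda>e. P (e 0) (\<lambda>n. e (Suc n)))"
  shows "sdef \<S> (\<lambda>e. \<exists>x<f e. P x e)"
proof -
  have "tdef (\<lambda>e. f (\<lambda>n. e (Suc n)))"
    by (rule tdef_subst[OF assms(1), of "\<lambda>n e. e (Suc n)", OF tdef_var])
  then show ?thesis
    by (intro sdef_ex sdef_conj sdef_less tdef_var assms(2))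
qed

lemma sdef_ball_le:
  assumes "tdef f" "sdef \<S> (\<lambda>e. P (e 0) (\<lambda>n. e (Suc n)))"
  shows "sdef \<S> (\<lambda>e. \<forall>x\<le>f e. P x e)"
  using sdef_ball[OF tdef_add[OF assms(1) tdef_const[of 1]], of P, OF assms(2)] by simp

lemma sdef_bex_le:
  assumes "tdef f" "sdef \<S> (\<lambda>e. P (e 0) (\<lambda>n. e (Suc n)))"
  shows "sdef \<S> (\<lambda>e. \<exists>x\<le>f e. P x e)"
  using sdef_bex[OF tdef_add[OF assms(1) tdef_const[of 1]], of P, OF assms(2)] by simp

lemmas sdef_intros = tdef_intros sdef_eq sdef_less sdef_le sdef_mem sdef_const sdef_not sdef_imp
  sdef_conj sdef_disj sdef_ball sdef_ball_le sdef_bex sdef_bex_le sdef_ex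

lemma bdef_less_induct [case_names definable less]:
  assumes "bdef \<S> (\<lambda>e. P (e 0))" "\<And>x. (\<And>y. y < x \<Longrightarrow> P y) \<Longrightarrow> P x"
  shows "P (x::'a)"
proof -
  have "\<forall>y<x. P y" for x
  proof (induction x rule: bdef_induct)
    case definable
    show ?case by (intro bdef_intros assms(1))
  next
    case (step x)
    then show ?case using assms(2) by (metis le_less less_add_1_iff)
  qed simp
  then show ?thesis using assms(2) by blast
qed

lemma bdef_least:
  assumes "bdef \<S> (\<lambda>e. P (e 0))" "P (x::'a)"
  shows "\<exists>y. P y \<and> (\<forall>z<y. \<not> P z)"
proof (rule ccontr)
  assume *: "\<not> ?thesis"
  have "\<not> P x" for x
  proof (induction x rule: bdef_less_induct)
    case definable
    show ?case by (intro bdef_intros assms(1))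
  qed (use * in blast)
  with assms(2) show False by blast
qed

end

section \<open>Coding finite sequences\<close>

text \<open>Congruence modulo \<open>m\<close>, with multiples added on both sides because
  subtraction is truncated.\<close>

definition ceq :: "'a::discrete_semiring \<Rightarrow> 'a \<Rightarrow> 'a \<Rightarrow> bool" where
  "ceq m x y \<longleftrightarrow> (\<exists>p q. x + m * p = y + m * q)"

lemma ceqI: "x + m * p = y + m * q \<Longrightarrow> ceq m x y"
  unfolding ceq_def by blast

lemma ceq_refl [simp]: "ceq m x x"
  by (rule ceqI) (rule refl)

lemma ceq_sym: "ceq m x y \<Longrightarrow> ceq m y x"
  unfolding ceq_def by metis

lemma ceq_trans [trans]: "ceq m x y \<Longrightarrow> ceq m y z \<Longrightarrow> ceq m x z"
proof -
  assume "ceq m x y" "ceq m y z"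
  then obtain p q p' q' where "x + m * p = y + m * q" "y + m * p' = z + m * q'"
    unfolding ceq_def by metis
  then have "(x + m * p) + m * p' = (z + m * q') + m * q"
    by (metis add.assoc add.commute)
  then show ?thesis
    by (intro ceqI[of _ _ "p + p'" _ "q' + q"]) (simp add: distrib_left add.assoc)
qed

lemma ceq_add: "ceq m x y \<Longrightarrow> ceq m x' y' \<Longrightarrow> ceq m (x + x') (y + y')"
proof -
  assume "ceq m x y" "ceq m x' y'"
  then obtain p q p' q' where "x + m * p = y + m * q" "x' + m * p' = y' + m * q'"
    unfolding ceq_def by metis
  then have "(x + m * p) + (x' + m * p') = (y + m * q) + (y' + m * q')"
    by simp
  then show ?thesis
    by (intro ceqI[of _ _ "p + p'" _ "q + q'"]) (simp add: algebra_simps)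
qed

lemma ceq_mult_right: "ceq m x y \<Longrightarrow> ceq m (x * z) (y * z)"
proof -
  assume "ceq m x y"
  then obtain p q where "x + m * p = y + m * q"
    unfolding ceq_def by metis
  then have "(x + m * p) * z = (y + m * q) * z"
    by simp
  then show ?thesis
    by (intro ceqI[of _ _ "p * z" _ "q * z"]) (simp add: distrib_right mult.assoc)
qed

lemma ceq_cancel: "ceq m (x + z) (y + z) \<Longrightarrow> ceq m x y"
proof -
  assume "ceq m (x + z) (y + z)"
  then obtain p q where "(x + m * p) + z = (y + m * q) + z"
    unfolding ceq_def by (metis add.assoc add.commute)
  then show ?thesis
    by (intro ceqI[of _ _ p _ q]) (simp only: add_right_cancel)
qed

lemma ceq_add_multiple: "ceq m (x + m * k) x"
  by (rule ceqI[of _ _ 0 _ k]) simp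

text \<open>The rule that -1 squares to 1, stated without negative numbers.\<close>

lemma ceq_square_of_minus_1:
  assumes "ceq m (x + 1) 0"
  shows "ceq m (x * x) 1"
proof -
  have "ceq m ((x + 1) * x) (0 * x)"
    using assms by (rule ceq_mult_right)
  also have "ceq m (0 * x) (x + 1)"
    using ceq_sym[OF assms] by simp
  finally have "ceq m (x * x + x) (1 + x)"
    by (simp add: algebra_simps)
  then show ?thesis by (rule ceq_cancel)
qed

text \<open>Invertibility modulo \<open>m\<close> stands in for coprimality; it is preserved by
  products directly, with no appeal to Bezout's identity.\<close>

definition cinv :: "'a::discrete_semiring \<Rightarrow> 'a \<Rightarrow> bool" where
  "cinv m a \<longleftrightarrow> (\<exists>u. ceq m (a * u) 1)"

lemma cinv_mult:
  assumes "cinv m a" "cinv m b"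
  shows "cinv m (a * b)"
proof -
  obtain u v where *: "ceq m (a * u) 1" "ceq m (b * v) 1"
    using assms unfolding cinv_def by blast
  have "ceq m ((a * u) * (b * v)) (1 * (b * v))"
    using *(1) by (rule ceq_mult_right)
  also have "ceq m (1 * (b * v)) 1"
    using *(2) by simp
  finally have "ceq m ((a * b) * (u * v)) 1"
    by (simp add: algebra_simps)
  then show ?thesis unfolding cinv_def by blast
qed

definition beta_mod :: "'a::discrete_semiring \<Rightarrow> 'a \<Rightarrow> 'a" where
  "beta_mod d i = 1 + (i + 1) * d"

text \<open>Write \<open>M\<close>, \<open>N\<close> for the moduli at \<open>i\<close> and
  \<open>j = i + k\<close>. Then \<open>(j + 1) * M - (i + 1) * N = k\<close>. Multiplying by
  \<open>(i + 1) * r\<close> gives \<open>(i + 1) * d = M - 1\<close> on the right, hence an inverse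
  of \<open>N\<close> modulo \<open>M\<close>.\<close>

lemma beta_mod_cinv:
  assumes "d = k * r"
  shows "cinv (beta_mod d i) (beta_mod d (i + k))" "cinv (beta_mod d (i + k)) (beta_mod d i)"
proof -
  let ?j = "i + k" let ?M = "beta_mod d i" and ?N = "beta_mod d (i + k)"
  have "?N * ((i + 1) * ((i + 1) * r)) + ?M * 1 = 1 + ?M * ((?j + 1) * (r * (i + 1)))"
    by (simp add: beta_mod_def assms algebra_simps)
  then show "cinv ?M ?N"
    unfolding cinv_def by (metis ceqI)
  \<comment> \<open>Multiplying by \<open>(?j + 1) * r\<close> instead gives \<open>?N - 1\<close>
    on the right, so this multiple of \<open>?M\<close> is only congruent to -1; its square is
    congruent to 1.\<close>
  let ?x = "?M * ((?j + 1) * ((?j + 1) * r))"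
  have "(?x + 1) + ?N * 0 = 0 + ?N * ((i + 1) * ((?j + 1) * r) + 1)"
    by (simp add: beta_mod_def assms algebra_simps)
  then have "ceq ?N (?x + 1) 0"
    by (rule ceqI)
  then have "ceq ?N (?x * ?x) 1"
    by (rule ceq_square_of_minus_1)
  then show "cinv ?N ?M"
    unfolding cinv_def by (metis mult.assoc)
qed

definition Beta :: "'a::discrete_semiring \<Rightarrow> 'a \<Rightarrow> 'a \<Rightarrow> 'a \<Rightarrow> bool" where
  "Beta c d i w \<longleftrightarrow> w < 1 + (i + 1) * d \<and> (\<exists>q<c + 1. c = q * (1 + (i + 1) * d) + w)"

lemma division_unique:
  assumes "q * m + r = q' * m + r'" "r < m" "r' < (m::'a::discrete_semiring)"
  shows "q = q' \<and> r = r'"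
proof -
  have *: False if "q < q'" "q * m + r = q' * m + r'" "r < m" for q r q' r' :: 'a
  proof -
    from \<open>q < q'\<close> obtain z where "q' = q + 1 + z"
      by (metis add_1_le_iff le_iff_add)
    then have "q' * m + r' = q * m + (m + (z * m + r'))"
      by (simp add: algebra_simps)
    with that(2) have "r = m + (z * m + r')"
      by simp
    with \<open>r < m\<close> show False
      by (metis le_iff_add not_less)
  qed
  have "q = q'"
    using *[of q q' r r'] *[of q' q r' r] assms by (metis linorder_neqE)
  with assms show ?thesis by simp
qed

lemma Beta_unique: "Beta c d i w \<Longrightarrow> Beta c d i w' \<Longrightarrow> w = w'"
  unfolding Beta_def using division_unique by blast

lemma Beta_le: "Beta c d i w \<Longrightarrow> w \<le> c"
  unfolding Beta_def by (metis add.commute le_iff_add)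

lemma BetaI:
  assumes "ceq (beta_mod d i) c w" "w < beta_mod d i"
  shows "Beta c d i w"
proof -
  let ?m = "beta_mod d i"
  obtain p q where *: "c + ?m * p = w + ?m * q"
    using assms(1) unfolding ceq_def by blast
  \<comment> \<open>Otherwise the surplus multiples on the left would force \<open>w\<close> to be
    at least the modulus.\<close>
  have "p \<le> q"
  proof (rule ccontr)
    assume "\<not> p \<le> q"
    then obtain z where "p = q + 1 + z"
      by (metis add_1_le_iff le_iff_add not_le)
    with * have "(c + ?m * z + ?m) + ?m * q = w + ?m * q"
      by (simp add: algebra_simps)
    then have "?m + (c + ?m * z) = w"
      by (metis add_right_cancel add.commute)
    with assms(2) show False
      by (metis le_iff_add not_less)
  qed
  then obtain z where "q = p + z"
    using le_iff_add by blast
  with * have "c + ?m * p = (z * ?m + w) + ?m * p"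
    by (simp add: algebra_simps)
  then have c: "c = z * ?m + w"
    by simp
  have "z \<le> z * ?m"
    by (simp add: beta_mod_def distrib_left)
  then have "z \<le> c"
    unfolding c by (simp add: add_increasing2)
  with c assms(2) show ?thesis
    unfolding Beta_def beta_mod_def by auto
qed

definition cpair :: "'a::discrete_semiring \<Rightarrow> 'a \<Rightarrow> 'a" where
  "cpair x y = (x + y) * (x + y + 1) + 2 * x"

text \<open>Pairs with sum \<open>s\<close> take values from \<open>s * (s + 1)\<close> up to less
  than \<open>(s + 1) * (s + 2)\<close>, so the code determines first the sum and then
  \<open>x\<close>.\<close>

lemma cpair_inj [simp]: "cpair x y = cpair x' y' \<longleftrightarrow> x = x' \<and> y = y'"
proof
  have *: "cpair x y < cpair x' y'" if "x + y < x' + y'" for x y x' y' :: 'a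
  proof -
    let ?s = "x + y" and ?s' = "x' + y'"
    have "cpair x y < ?s * (?s + 1) + 2 * (?s + 1)"
      unfolding cpair_def by (intro add_strict_left_mono mult_strict_left_mono) simp_all
    also have "\<dots> = (?s + 1) * (?s + 1 + 1)"
      by (simp add: algebra_simps one_add_one[symmetric] del: one_add_one)
    also have "\<dots> \<le> ?s' * (?s' + 1)"
      using that by (intro mult_mono add_right_mono) simp_all
    also have "\<dots> \<le> cpair x' y'"
      unfolding cpair_def by simp
    finally show ?thesis .
  qed
  assume eq: "cpair x y = cpair x' y'"
  then have "x + y = x' + y'"
    using *[of x y x' y'] *[of x' y' x y] by (metis less_irrefl linorder_neqE)
  moreover from this eq have "2 * x = 2 * x'"
    unfolding cpair_def by simp
  then have "x = x'"
    by (metis less_irrefl linorder_neqE mult_strict_left_mono zero_less_numeral)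
  ultimately show "x = x' \<and> y = y'"
    by simp
qed simp

lemma le_cpair1: "x \<le> cpair x y"
  and le_cpair2: "y \<le> cpair x y"
proof -
  have "x + y \<le> (x + y) * (x + y + 1)"
    by (simp add: distrib_left)
  also have "\<dots> \<le> cpair x y"
    by (simp add: cpair_def)
  finally have *: "x + y \<le> cpair x y" .
  show "x \<le> cpair x y" "y \<le> cpair x y"
    using * by (meson le_add_same_cancel1 le_add_same_cancel2 order_trans zero_le)+
qed

lemma tdef_cpair: "tdef f \<Longrightarrow> tdef g \<Longrightarrow> tdef (\<lambda>e. cpair (f e) (g e))"
  unfolding cpair_def by (intro tdef_intros)

lemma tdef_beta_mod: "tdef f \<Longrightarrow> tdef g \<Longrightarrow> tdef (\<lambda>e. beta_mod (f e) (g e))"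
  unfolding beta_mod_def by (intro tdef_intros)

section \<open>Division with remainder, the Chinese remainder theorem, sequences and primitive
  recursion\<close>

context rca0_model
begin

lemma bdef_Beta:
  "tdef c \<Longrightarrow> tdef d \<Longrightarrow> tdef i \<Longrightarrow> tdef w \<Longrightarrow> bdef \<S> (\<lambda>e. Beta (c e) (d e) (i e) (w e))"
  unfolding Beta_def
  by (intro bdef_intros tdef_subst[of _ "\<lambda>n e. e (Suc n)"]; assumption?)

lemma sdef_Beta:
  "tdef c \<Longrightarrow> tdef d \<Longrightarrow> tdef i \<Longrightarrow> tdef w \<Longrightarrow> sdef \<S> (\<lambda>e. Beta (c e) (d e) (i e) (w e))"
  by (intro sdef_bdef bdef_Beta)

lemma bdef_rel1:
  assumes "bdef \<S> (\<lambda>e. R (e 0))" "tdef a"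
  shows "bdef \<S> (\<lambda>e. R (a e))"
  using bdef_subst[OF assms(1), of "\<lambda>n. a", OF assms(2)] by simp

lemma bdef_rel2:
  assumes "bdef \<S> (\<lambda>e. R (e 0) (e (Suc 0)))" "tdef a" "tdef b"
  shows "bdef \<S> (\<lambda>e. R (a e) (b e))"
proof -
  have "tdef (\<lambda>e. case_nat (a e) (\<lambda>_. b e) n)" for n
    by (intro tdef_case_nat assms)
  from bdef_subst[OF assms(1), of "\<lambda>n e. case_nat (a e) (\<lambda>_. b e) n", OF this]
  show ?thesis by simp
qed

lemma division: "0 < m \<Longrightarrow> \<exists>q r. c = q * m + r \<and> r < (m::'a)"
proof (induction c rule: sdef_induct)
  case definable
  show ?case by (intro sdef_intros bdef_intros)
next
  case 0
  then show ?case by (intro exI[of _ 0]) simp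
next
  case (step c)
  then obtain q r where qr: "c = q * m + r" "r < m" by blast
  then consider "r + 1 = m" | "r + 1 < m"
    by (metis add_1_le_iff le_less)
  then show ?case
  proof cases
    case 1
    then have "c + 1 = (q + 1) * m + 0"
      using qr by (simp add: distrib_right add.assoc)
    with step.prems show ?thesis by blast
  next
    case 2
    then show ?thesis using qr by (metis add.assoc)
  qed
qed

lemma Beta_total: "\<exists>w. Beta c d i (w::'a)"
proof -
  have "0 < 1 + (i + 1) * d"
    by (simp add: add_pos_nonneg)
  then obtain q r where "c = q * (1 + (i + 1) * d) + r" "r < 1 + (i + 1) * d"
    using division[of _ c] by blast
  moreover from this have "q \<le> c"
    by (simp add: distrib_left add.assoc)
  ultimately show ?thesis
    unfolding Beta_def by auto
qed

text \<open>Takes the place of the factorial in the beta function argument: the factorial would need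
  recursion, which is itself obtained from coded sequences.\<close>

lemma common_multiple: "\<exists>d>0. \<forall>k<n. \<exists>r\<le>d. d = (k + 1) * (r::'a)"
proof (induction n rule: sdef_induct)
  case definable
  show ?case by (intro sdef_intros bdef_intros)
next
  case 0
  show ?case by (intro exI[of _ 1]) simp
next
  case (step n)
  then obtain d where d: "0 < d" "\<forall>k<n. \<exists>r. d = (k + 1) * r" by blast
  have "\<exists>r\<le>d * (n + 1). d * (n + 1) = (k + 1) * r" if "k < n + 1" for k
  proof -
    have "\<exists>r. d * (n + 1) = (k + 1) * r"
    proof (cases "k = n")
      case True
      then show ?thesis by (metis mult.commute)
    next
      case False
      with that have "k < n" by (simp add: le_less)
      with d(2) obtain r where "d = (k + 1) * r" by blast
      then show ?thesis by (metis mult.assoc)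
    qed
    then obtain r where r: "d * (n + 1) = (k + 1) * r" ..
    then have "d * (n + 1) = r + k * r" by (simp add: distrib_right add.commute)
    then have "r \<le> d * (n + 1)" by simp
    with r show ?thesis by blast
  qed
  moreover have "0 < d * (n + 1)"
    using d(1) by (simp add: distrib_left add_nonneg_pos)
  ultimately show ?case by blast
qed

text \<open>Induction on the number \<open>k\<close> of congruences solved, carrying along a number
  \<open>p\<close> that is a multiple of the moduli treated so far and invertible modulo the
  remaining ones. The hypothesis \<open>neg\<close> provides additive inverses.\<close>

lemma chinese_remainder:
  assumes f: "bdef \<S> (\<lambda>e. f (e 0) = e (Suc 0))" and M: "bdef \<S> (\<lambda>e. M (e 0) = e (Suc 0))"
    and inv: "\<And>i j. i < j \<Longrightarrow> j < l \<Longrightarrow> cinv (M i) (M j) \<and> cinv (M j) (M i)"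
    and neg: "\<And>i c. \<exists>z. ceq (M i) (c + z) 0"
  shows "\<exists>c. \<forall>i<l. ceq (M i) c (f i :: 'a)"
proof -
  \<comment> \<open>Values of \<open>f\<close> and \<open>M\<close> are not definable terms; inside
    the induction predicate they are reached through their graphs.\<close>
  define F where "F i w \<longleftrightarrow> f i = w" for i w
  define G where "G i m \<longleftrightarrow> M i = m" for i m
  have F: "bdef \<S> (\<lambda>e. F (e 0) (e (Suc 0)))" and G: "bdef \<S> (\<lambda>e. G (e 0) (e (Suc 0)))"
    unfolding F_def G_def by (fact f M)+
  have "k \<le> l \<longrightarrow> (\<exists>c p. (\<forall>i<k. \<exists>m. G i m \<and> (\<exists>w. F i w \<and> ceq m c w)) \<and> (\<forall>i<k. \<exists>m. G i m \<and> (\<exists>q. p = m * q))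
    \<and> (\<forall>i<l. k \<le> i \<longrightarrow> (\<exists>m. G i m \<and> (\<exists>u. ceq m (p * u) 1))))" for k
  proof (induction k rule: sdef_induct)
    case definable
    show ?case unfolding ceq_def
      by (intro sdef_intros bdef_intros sdef_bdef[OF bdef_rel2[OF F]] sdef_bdef[OF bdef_rel2[OF G]])
  next
    case 0
    show ?case
      by (intro impI exI[of _ 1]) (auto simp: G_def intro: exI[of _ 1])
  next
    case (step k)
    show ?case
    proof
      assume kl: "k + 1 \<le> l"
      then have "k \<le> l" "k < l" by auto
      with step obtain c p where c: "\<And>i. i < k \<Longrightarrow> ceq (M i) c (f i)"
        and p: "\<And>i. i < k \<Longrightarrow> \<exists>q. p = M i * q" and u: "\<And>i. i < l \<Longrightarrow> k \<le> i \<Longrightarrow> cinv (M i) p"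
        unfolding cinv_def F_def G_def by blast
      obtain u where u': "ceq (M k) (p * u) 1"
        using u[of k] \<open>k < l\<close> unfolding cinv_def by auto
      obtain z where z: "ceq (M k) (c + z) 0"
        using neg by blast
      \<comment> \<open>Modulo \<open>M k\<close> we have \<open>p * u\<close> congruent to 1 and
        \<open>c + z\<close> to 0, so \<open>?c\<close> is congruent to \<open>f k\<close>; modulo
        the earlier moduli \<open>p\<close> vanishes and \<open>c\<close> is unchanged.\<close>
      let ?c = "c + p * (u * (f k + z))" and ?p = "p * M k"
      have 1: "ceq (M i) ?c (f i)" if "i < k + 1" for i
      proof (cases "i = k")
        case True
        have "ceq (M k) ((p * u) * (f k + z)) (1 * (f k + z))"
          using u' by (rule ceq_mult_right)
        then have "ceq (M k) (c + (p * u) * (f k + z)) (c + 1 * (f k + z))"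
          by (intro ceq_add ceq_refl)
        also have "c + 1 * (f k + z) = (c + z) + f k"
          by (simp add: add_ac)
        also have "ceq (M k) ((c + z) + f k) (0 + f k)"
          by (intro ceq_add ceq_refl z)
        finally show ?thesis using True by (simp add: mult.assoc)
      next
        case False
        with that have "i < k" by simp
        then obtain q where "p = M i * q" using p by blast
        then have "ceq (M i) ?c c"
          using ceq_add_multiple[of "M i" c "q * (u * (f k + z))"] by (simp add: mult.assoc)
        also have "ceq (M i) c (f i)" using c \<open>i < k\<close> .
        finally show ?thesis .
      qed
      have 2: "\<exists>q. ?p = M i * q" if "i < k + 1" for i
      proof (cases "i = k")
        case True
        then show ?thesis by (metis mult.commute)
      next
        case False
        with that have "i < k" by simp
        then show ?thesis using p by (metis mult.assoc)
      qed
      have 3: "cinv (M i) ?p" if "i < l" "k + 1 \<le> i" for i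
        using that u[of i] inv[of k i] by (intro cinv_mult) auto
      show "\<exists>c p. (\<forall>i<k + 1. \<exists>m. G i m \<and> (\<exists>w. F i w \<and> ceq m c w)) \<and> (\<forall>i<k + 1. \<exists>m. G i m \<and> (\<exists>q. p = m * q))
        \<and> (\<forall>i<l. k + 1 \<le> i \<longrightarrow> (\<exists>m. G i m \<and> (\<exists>u. ceq m (p * u) 1)))"
      proof (rule exI[of _ ?c], rule exI[of _ ?p], intro conjI allI impI)
        show "\<exists>m. G i m \<and> (\<exists>w. F i w \<and> ceq m ?c w)" if "i < k + 1" for i
          using 1[OF that] unfolding F_def G_def by blast
        show "\<exists>m. G i m \<and> (\<exists>q. ?p = m * q)" if "i < k + 1" for i
          using 2[OF that] unfolding G_def by blast
        show "\<exists>m. G i m \<and> (\<exists>u. ceq m (?p * u) 1)" if "i < l" "k + 1 \<le> i" for i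
          using 3[OF that] unfolding G_def cinv_def by blast
      qed
    qed
  qed
  from this[of l] show ?thesis unfolding F_def G_def by auto
qed

lemma beta_sequence:
  assumes f: "bdef \<S> (\<lambda>e. f (e 0) = e (Suc 0))" and B: "\<And>i. i < l \<Longrightarrow> f i \<le> B"
  shows "\<exists>c d. \<forall>i<l. Beta c d i (f i :: 'a)"
proof -
  obtain d0 where d0: "0 < d0" "\<forall>k<l. \<exists>r. d0 = (k + 1) * r"
    using common_multiple[of l] by blast
  \<comment> \<open>The factor \<open>d0\<close> makes the moduli invertible modulo each other; the
    factor \<open>B + 1\<close> makes them exceed all entries.\<close>
  define d where "d = d0 * (B + 1)"
  have d: "\<exists>r. d = (k + 1) * r" if "k < l" for k
    using d0(2) that unfolding d_def by (metis mult.assoc)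
  have "B < d"
  proof -
    have "B + 1 \<le> d0 * (B + 1)"
      using d0(1) mult_right_mono[of 1 d0 "B + 1"] add_1_le_iff[of 0 d0] by simp
    then show ?thesis by (simp add: d_def)
  qed
  have "\<exists>c. \<forall>i<l. ceq (beta_mod d i) c (f i)"
  proof (rule chinese_remainder[OF f])
    show "bdef \<S> (\<lambda>e. beta_mod d (e 0) = e (Suc 0))"
      by (intro bdef_intros tdef_beta_mod)
    show "cinv (beta_mod d i) (beta_mod d j) \<and> cinv (beta_mod d j) (beta_mod d i)" if "i < j" "j < l" for i j
    proof -
      obtain k where j: "j = i + (k + 1)"
        using \<open>i < j\<close> by (metis add_1_le_iff le_iff_add add.assoc add.commute)
      then have "k < l"
        using \<open>j < l\<close> by (metis add.assoc add_1_le_iff le_add_same_cancel2 less_imp_le order_le_less_trans zero_le)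
      then obtain r where "d = (k + 1) * r" using d by blast
      from beta_mod_cinv[OF this, of i] show ?thesis by (simp add: j)
    qed
    show "\<exists>z. ceq (beta_mod d i) (c + z) 0" for i c
    proof (intro exI ceqI)
      show "(c + c * ((i + 1) * d)) + beta_mod d i * 0 = 0 + beta_mod d i * c"
        by (simp add: beta_mod_def algebra_simps)
    qed
  qed
  then obtain c where c: "\<forall>i<l. ceq (beta_mod d i) c (f i)" ..
  have "f i < beta_mod d i" if "i < l" for i
  proof -
    have "f i < d" using B[OF that] \<open>B < d\<close> by simp
    also have "d \<le> beta_mod d i" by (simp add: beta_mod_def distrib_right add_increasing add_increasing2)
    finally show ?thesis .
  qed
  with c show ?thesis by (blast intro: BetaI)
qed

text \<open>Every code has an entry at every place, and entries never exceed \<open>c\<close>; so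
  the old sequence followed by \<open>x\<close> is a bounded definable function and can be coded
  afresh.\<close>

lemma beta_append: "\<exists>c' d'. (\<forall>i w. i < l \<longrightarrow> Beta c d i w \<longrightarrow> Beta c' d' i w) \<and> Beta c' d' l (x::'a)"
proof -
  define f where "f i = (if i < l then THE w. Beta c d i w else x)" for i
  have f_Beta: "f i = w \<longleftrightarrow> Beta c d i w" if "i < l" for i w
    using that Beta_total[of c d i] Beta_unique[of c d i] by (simp add: f_def) (metis the_equality)
  have "f i = w \<longleftrightarrow> (i < l \<longrightarrow> Beta c d i w) \<and> (\<not> i < l \<longrightarrow> w = x)" for i w
    using f_Beta by (auto simp: f_def)
  then have "bdef \<S> (\<lambda>e. f (e 0) = e (Suc 0))"
    by (simp only:) (intro bdef_intros bdef_Beta)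
  moreover have "f i \<le> c + x" for i
    using f_Beta[of i "f i"] Beta_le[of c d i "f i"] by (cases "i < l") (auto simp: f_def add_increasing add_increasing2)
  ultimately obtain c' d' where *: "\<forall>i<l + 1. Beta c' d' i (f i)"
    using beta_sequence[of f "l + 1"] by blast
  have "f l = x" by (simp add: f_def)
  with * have "Beta c' d' l x" by fastforce
  moreover have "Beta c' d' i w" if "i < l" "Beta c d i w" for i w
    using f_Beta[of i w] that * by (metis le_less less_add_1_iff)
  ultimately show ?thesis by blast
qed

text \<open>The relation \<open>R\<close> says that some coded run of length \<open>x\<close> ends
  in \<open>y\<close>. Runs agree on common places by induction and can always be prolonged, so
  \<open>R\<close> is the graph of a function.\<close>

lemma primitive_recursion:
  assumes g: "bdef \<S> (\<lambda>e. g (e 0) = e (Suc 0))"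
  shows "\<exists>h. h 0 = a \<and> (\<forall>x. h (x + 1) = g (h x)) \<and> {z. \<exists>x. z = cpair x (h x :: 'a)} \<in> \<S>"
proof -
  define G where "G w w' \<longleftrightarrow> g w = w'" for w w'
  have G: "bdef \<S> (\<lambda>e. G (e 0) (e (Suc 0)))"
    unfolding G_def by (fact g)
  define run where "run c d n \<longleftrightarrow> Beta c d 0 a \<and> (\<forall>i<n. \<exists>w. Beta c d i w \<and> (\<exists>w'. G w w' \<and> Beta c d (i + 1) w'))" for c d n
  define R where "R x y \<longleftrightarrow> (\<exists>c d. run c d x \<and> Beta c d x y)" for x y
  have run_unique: "Beta c' d' i w" if "run c d n" "run c' d' n'" "i \<le> n" "i \<le> n'" "Beta c d i w" for c d n c' d' n' i w
  proof -
    have "i \<le> n \<longrightarrow> i \<le> n' \<longrightarrow> (\<exists>w. Beta c d i w \<and> Beta c' d' i w)"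
    proof (induction i rule: sdef_induct)
      case definable
      show ?case by (intro sdef_intros sdef_Beta bdef_intros)
    next
      case 0
      show ?case using that unfolding run_def by blast
    next
      case (step i)
      show ?case
      proof (intro impI)
        assume "i + 1 \<le> n" "i + 1 \<le> n'"
        then have "i < n" "i < n'" by auto
        with step that(1,2) show "\<exists>w. Beta c d (i + 1) w \<and> Beta c' d' (i + 1) w"
          unfolding run_def G_def by (metis Beta_unique order_less_imp_le)
      qed
    qed
    with that show ?thesis using Beta_unique by blast
  qed
  have R_unique: "y = y'" if "R x y" "R x y'" for x y y'
    using that run_unique Beta_unique unfolding R_def by blast
  have R_def_sdef: "sdef \<S> (\<lambda>e. R (e i) (e j))" for i j
    unfolding R_def run_def by (intro sdef_intros sdef_Beta sdef_bdef[OF bdef_rel2[OF G]])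
  have R_0: "R 0 a"
    unfolding R_def run_def using beta_append[of 0 0 0 a] by auto
  have R_suc: "R (x + 1) (g y)" if xy: "R x y" for x y
  proof -
    obtain c d where cd: "run c d x" "Beta c d x y"
      using xy unfolding R_def by blast
    obtain c' d' where c'd': "\<And>i w. i < x + 1 \<Longrightarrow> Beta c d i w \<Longrightarrow> Beta c' d' i w" "Beta c' d' (x + 1) (g y)"
      using beta_append[of "x + 1" c d "g y"] by blast
    have "\<exists>w. Beta c' d' i w \<and> (\<exists>w'. G w w' \<and> Beta c' d' (i + 1) w')" if "i < x + 1" for i
    proof (cases "i = x")
      case True
      then show ?thesis using cd c'd' by (auto simp: G_def)
    next
      case False
      with that have "i < x" by simp
      then have "i + 1 < x + 1" by simp
      with cd c'd'(1) that \<open>i < x\<close> show ?thesis unfolding run_def by metis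
    qed
    moreover have "Beta c' d' 0 a"
      using cd(1) c'd'(1)[of 0 a] unfolding run_def by simp
    ultimately show ?thesis using c'd'(2) unfolding R_def run_def by blast
  qed
  have R_total: "\<exists>y. R x y" for x
  proof (induction x rule: sdef_induct)
    case definable
    show ?case by (intro sdef_ex R_def_sdef)
  qed (use R_0 R_suc in blast)+
  define h where "h x = (THE y. R x y)" for x
  have h: "h x = y \<longleftrightarrow> R x y" for x y
    unfolding h_def using R_total R_unique by (metis the_equality)
  have "{z. \<exists>x. z = cpair x (h x)} = {z. \<exists>x y. z = cpair x y \<and> R x y}"
    by (auto simp: h[symmetric])
  moreover have "\<dots> \<in> \<S>"
  proof (rule delta_comprehension)
    show "sdef \<S> (\<lambda>e. \<exists>x y. e 0 = cpair x y \<and> R x y)"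
      by (intro sdef_intros R_def_sdef tdef_cpair)
    \<comment> \<open>Since \<open>R\<close> is total and single-valued, a non-member is recognised
      by a different value; so the complement is Sigma01 too and Delta01 comprehension
      applies.\<close>
    have "(\<nexists>x y. z = cpair x y \<and> R x y) \<longleftrightarrow> (\<forall>x\<le>z. \<forall>y\<le>z. z = cpair x y \<longrightarrow> (\<exists>y'. y' \<noteq> y \<and> R x y'))" for z
      using R_total R_unique le_cpair1 le_cpair2 by metis
    then show "sdef \<S> (\<lambda>e. \<nexists>x y. e 0 = cpair x y \<and> R x y)"
      by (simp only:) (intro sdef_intros R_def_sdef bdef_intros tdef_cpair)
  qed
  moreover have "h 0 = a" "h (x + 1) = g (h x)" for x
    using h R_0 R_suc by blast+
  ultimately show ?thesis by auto
qed

end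

section \<open>Computations and the jump\<close>

lemma sat_BAll [simp]: "sat \<S> e E (BAll t \<phi>) \<longleftrightarrow> (\<forall>x<ev e t. sat \<S> (case_nat x e) E \<phi>)"
  by (simp add: BAll_def)

lemma sat_BEx [simp]: "sat \<S> e E (BEx t \<phi>) \<longleftrightarrow> (\<exists>x<ev e t. sat \<S> (case_nat x e) E \<phi>)"
  by (simp add: BEx_def)

lemma ev_num [simp]: "ev e (num n) = (of_nat n :: 'a::discrete_semiring)"
  by (induction n) (simp_all add: add.commute)

lemma ev_pair [simp]: "ev e (pair t u) = cpair (ev e t) (ev e u :: 'a::discrete_semiring)"
  by (simp add: pair_def cpair_def)

definition ctriple :: "'a::discrete_semiring \<Rightarrow> 'a \<Rightarrow> 'a \<Rightarrow> 'a" where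
  "ctriple x y z = cpair x (cpair y z)"

lemma ev_triple [simp]: "ev e (triple t u w) = ctriple (ev e t) (ev e u) (ev e w :: 'a::discrete_semiring)"
  by (simp add: triple_def ctriple_def)

lemma ctriple_inj [simp]: "ctriple x y z = ctriple x' y' z' \<longleftrightarrow> x = x' \<and> y = y' \<and> z = z'"
  by (simp add: ctriple_def)

lemma le_ctriple: "x \<le> ctriple x y z" "y \<le> ctriple x y z" "z \<le> ctriple x y z"
  unfolding ctriple_def
  by (rule le_cpair1 order_trans[OF le_cpair1 le_cpair2] order_trans[OF le_cpair2 le_cpair2])+

lemma sat_beta [simp]:
  "sat \<S> e E (beta c d i w) \<longleftrightarrow> Beta (ev e c) (ev e d) (ev e i) (ev e w :: 'a::discrete_semiring)"
  by (simp add: beta_def Beta_def Let_def)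

definition Occ :: "'a::discrete_semiring \<Rightarrow> 'a \<Rightarrow> 'a \<Rightarrow> 'a \<Rightarrow> 'a \<Rightarrow> 'a \<Rightarrow> bool" where
  "Occ c d l e x y \<longleftrightarrow> (\<exists>i<l. Beta c d i (ctriple e x y))"

lemma sat_occurs [simp]:
  "sat \<S> a E (occurs c d i e x y) \<longleftrightarrow>
    Occ (ev a c) (ev a d) (ev a i) (ev a e) (ev a x) (ev a y :: 'a::discrete_semiring)"
  by (simp add: occurs_def Occ_def)

lemma Occ_le:
  assumes "Occ c d l e x y"
  shows "e \<le> c" "x \<le> c" "y \<le> c"
proof -
  have "ctriple e x y \<le> c"
    using assms Beta_le unfolding Occ_def by blast
  then show "e \<le> c" "x \<le> c" "y \<le> c"
    using le_ctriple order_trans by metis+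
qed

text \<open>Read off from the formula rather than restated. The facts extracted below are the bound
  6 on the index and the clauses for the identity (0) and for the oracle (6).\<close>

definition Basic :: "'a::discrete_semiring set \<Rightarrow> 'a \<Rightarrow> 'a \<Rightarrow> 'a \<Rightarrow> bool" where
  "Basic X e x y \<longleftrightarrow>
    sat UNIV (case_nat e (case_nat x (\<lambda>_. y))) (\<lambda>_. X) (basic_step 0 (Var 0) (Var 1) (Var 2))"

lemma sat_basic_step [simp]:
  "sat \<S> a E (basic_step X e x y) \<longleftrightarrow> Basic (E X) (ev a e) (ev a x) (ev a y :: 'a::discrete_semiring)"
  by (simp add: Basic_def basic_step_def Let_def numeral_2_eq_2)

lemma Basic_le: "Basic X e x y \<Longrightarrow> e \<le> 6"
  unfolding Basic_def basic_step_def by (auto simp: Let_def numeral_2_eq_2)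

lemma Basic_0: "Basic X 0 x y \<longleftrightarrow> y = x"
  unfolding Basic_def basic_step_def by (simp add: Let_def numeral_2_eq_2)

lemma Basic_6: "Basic X 6 x y \<longleftrightarrow> x \<in> X \<and> y = 0 \<or> x \<notin> X \<and> y = 1"
  unfolding Basic_def basic_step_def by (simp add: Let_def numeral_2_eq_2)

text \<open>\<open>R\<close> is the relation of the earlier entries of a computation.\<close>

definition Step :: "'a::discrete_semiring set \<Rightarrow> ('a \<Rightarrow> 'a \<Rightarrow> 'a \<Rightarrow> bool) \<Rightarrow> 'a \<Rightarrow> 'a \<Rightarrow> 'a \<Rightarrow> bool" where
  "Step X R e x y \<longleftrightarrow>
      Basic X e x y
    \<or> (\<exists>f g z. e = 3 * cpair f g + 7 \<and> R g x z \<and> R f z y)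
    \<or> (\<exists>f g a b. e = 3 * cpair f g + 8 \<and> y = cpair a b \<and> R f x a \<and> R g x b)
    \<or> (\<exists>f. e = 3 * f + 9 \<and> R f (cpair x y) 0 \<and> (\<forall>z<y. \<exists>w. w \<noteq> 0 \<and> R f (cpair x z) w))"

definition Comp :: "'a::discrete_semiring set \<Rightarrow> 'a \<Rightarrow> 'a \<Rightarrow> 'a \<Rightarrow> bool" where
  "Comp X c d l \<longleftrightarrow> (\<forall>i<l. \<exists>e x y. Beta c d i (ctriple e x y) \<and> Step X (Occ c d i) e x y)"

lemma less_3_times: "p < 3 * p + (numeral k :: 'a::discrete_semiring)"
proof -
  have "p + 0 < 3 * p + (numeral k :: 'a)"
    by (intro add_le_less_mono) (simp_all add: mult_le_cancel_right1 mult_right_mono[of 1 3 p, simplified])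
  then show ?thesis by simp
qed

text \<open>The bounds in the formula hold automatically: the components of an index lie below it,
  and an intermediate result occurs in the sequence, hence is at most \<open>c\<close>.\<close>

lemma sat_comp_step: "sat \<S> a E (comp_step c d i e x y) \<longleftrightarrow>
    (\<exists>f g z. ev a e = 3 * cpair f g + 7
      \<and> Occ (ev a c) (ev a d) (ev a i) g (ev a x) z \<and> Occ (ev a c) (ev a d) (ev a i) f z (ev a y :: 'a::discrete_semiring))"
proof -
  have "f < 3 * cpair f g + 7" "g < 3 * cpair f g + (7::'a)" for f g :: 'a
    using le_cpair1 le_cpair2 less_3_times by (metis order_le_less_trans)+
  moreover have "sat \<S> a E (comp_step c d i e x y) \<longleftrightarrow>
    (\<exists>f<ev a e. \<exists>g<ev a e. \<exists>z<ev a c + 1. ev a e = 3 * cpair f g + 7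
      \<and> Occ (ev a c) (ev a d) (ev a i) g (ev a x) z \<and> Occ (ev a c) (ev a d) (ev a i) f z (ev a y :: 'a))"
    by (simp add: comp_step_def Let_def comp_code_def eval_nat_numeral)
  ultimately show ?thesis
    by (metis Occ_le(3) less_add_1_iff)
qed

lemma sat_pairing_step: "sat \<S> a E (pairing_step c d i e x y) \<longleftrightarrow>
    (\<exists>f g v w. ev a e = 3 * cpair f g + 8 \<and> ev a y = cpair v w
      \<and> Occ (ev a c) (ev a d) (ev a i) f (ev a x) v \<and> Occ (ev a c) (ev a d) (ev a i) g (ev a x) (w :: 'a::discrete_semiring))"
proof -
  have "f < 3 * cpair f g + 8" "g < 3 * cpair f g + (8::'a)" for f g :: 'a
    using le_cpair1 le_cpair2 less_3_times by (metis order_le_less_trans)+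
  moreover have "sat \<S> a E (pairing_step c d i e x y) \<longleftrightarrow>
    (\<exists>f<ev a e. \<exists>g<ev a e. \<exists>v<ev a y + 1. \<exists>w<ev a y + 1. ev a e = 3 * cpair f g + 8
      \<and> Occ (ev a c) (ev a d) (ev a i) f (ev a x) v \<and> ev a y = cpair v w \<and> Occ (ev a c) (ev a d) (ev a i) g (ev a x) (w :: 'a))"
    by (simp add: pairing_step_def Let_def pairing_code_def eval_nat_numeral)
  ultimately show ?thesis
    by (metis le_cpair1 le_cpair2 less_add_1_iff)
qed

lemma sat_mu_step: "sat \<S> a E (mu_step c d i e x y) \<longleftrightarrow>
    (\<exists>f. ev a e = 3 * f + 9 \<and> Occ (ev a c) (ev a d) (ev a i) f (cpair (ev a x) (ev a y)) 0
      \<and> (\<forall>z<ev a y. \<exists>w. w \<noteq> 0 \<and> Occ (ev a c) (ev a d) (ev a i) f (cpair (ev a x) z) (w :: 'a::discrete_semiring)))"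
proof -
  have "sat \<S> a E (mu_step c d i e x y) \<longleftrightarrow>
    (\<exists>f<ev a e. ev a e = 3 * f + 9 \<and> Occ (ev a c) (ev a d) (ev a i) f (cpair (ev a x) (ev a y)) 0
      \<and> (\<forall>z<ev a y. \<exists>w<ev a c + 1. w \<noteq> 0 \<and> Occ (ev a c) (ev a d) (ev a i) f (cpair (ev a x) z) (w :: 'a)))"
    by (simp add: mu_step_def Let_def mu_code_def eval_nat_numeral)
  then show ?thesis
    by (metis Occ_le(3) less_add_1_iff less_3_times)
qed

lemma sat_computation [simp]:
  "sat \<S> a E (computation X c d l) \<longleftrightarrow> Comp (E X) (ev a c) (ev a d) (ev a l :: 'a::discrete_semiring)"
proof -
  have "e \<le> c \<and> x \<le> c \<and> y \<le> c" if "Beta c d i (ctriple e x y)" for c d i e x y :: 'a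
    using Beta_le[OF that] le_ctriple(1)[of e x y] le_ctriple(2)[of x e y] le_ctriple(3)[of y e x]
    by (meson order_trans)
  moreover have "sat \<S> a E (computation X c d l) \<longleftrightarrow>
    (\<forall>i<ev a l. \<exists>e<ev a c + 1. \<exists>x<ev a c + 1. \<exists>y<ev a c + 1.
      Beta (ev a c) (ev a d) i (ctriple e x y) \<and> Step (E X) (Occ (ev a c) (ev a d) i) e x y)"
    by (simp add: computation_def Step_def Let_def eval_nat_numeral sat_comp_step sat_pairing_step sat_mu_step
        disj_imp)
  ultimately show ?thesis
    unfolding Comp_def by (metis less_add_1_iff)
qed

definition Computes :: "'a::discrete_semiring set \<Rightarrow> 'a \<Rightarrow> 'a \<Rightarrow> 'a \<Rightarrow> bool" where
  "Computes X e x y \<longleftrightarrow> (\<exists>c d l. Comp X c d l \<and> Occ c d l e x y)"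

lemma sat_computes [simp]:
  "sat \<S> a E (computes X e x y) \<longleftrightarrow> Computes (E X) (ev a e) (ev a x) (ev a y :: 'a::discrete_semiring)"
  by (simp add: computes_def Computes_def Let_def eval_nat_numeral)

lemma sat_is_jump [simp]:
  "sat \<S> a E (is_jump X Y) \<longleftrightarrow> (\<forall>x::'a::discrete_semiring. x \<in> E Y \<longleftrightarrow> (\<exists>y. Computes (E X) x x y))"
  by (simp add: is_jump_def) blast

lemma sat_is_section [simp]:
  "sat \<S> a E (is_section Z i W) \<longleftrightarrow> (\<forall>x::'a::discrete_semiring. x \<in> E W \<longleftrightarrow> cpair x (ev a i) \<in> E Z)"
  by (simp add: is_section_def) blast

lemma Step_mono:
  assumes "Step X R e x y" "\<And>e x y. R e x y \<Longrightarrow> R' e x y"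
  shows "Step X R' e x y"
  using assms(1) unfolding Step_def by (elim disjE) (blast dest: assms(2))+

lemma Occ_mono: "Occ c d l e x y \<Longrightarrow> l \<le> l' \<Longrightarrow> Occ c d l' e x y"
  unfolding Occ_def by (meson order_less_le_trans)

lemma Comp_Step:
  assumes "Comp X c d l" "Occ c d l e x y"
  shows "Step X (Occ c d l) e x y"
proof -
  obtain i where i: "i < l" "Beta c d i (ctriple e x y)"
    using assms(2) unfolding Occ_def by blast
  then obtain e' x' y' where "Beta c d i (ctriple e' x' y')" "Step X (Occ c d i) e' x' y'"
    using assms(1) unfolding Comp_def by blast
  with i(2) have "Step X (Occ c d i) e x y"
    using Beta_unique[of c d i "ctriple e x y" "ctriple e' x' y'"] by simp
  then show ?thesis
    by (rule Step_mono) (rule Occ_mono[OF _ less_imp_le[OF i(1)]])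
qed

lemma mod_3:
  assumes "3 * p + r = 3 * q + s" "r < 3" "s < (3::'a::discrete_semiring)"
  shows "p = q" "r = s"
  using division_unique[of p 3 r q s] assms by (simp_all add: mult.commute)

text \<open>An index has at most one form: basic indices are at most 6, and 7, 8, 9 leave the
  distinct residues 1, 2, 0 modulo 3.\<close>

lemma Step_comp_code:
  assumes "Step X R (3 * cpair f g + 7) x (y::'a::discrete_semiring)"
  obtains z where "R g x z" "R f z y"
proof -
  have e: "3 * p + 7 = 3 * (p + 2) + (1::'a)" "3 * p + 8 = 3 * (p + 2) + (2::'a)"
    "3 * p + 9 = 3 * (p + 3) + (0::'a)" for p :: 'a
    by (simp_all add: distrib_left add.assoc)
  have "6 < (7::'a)" by simp
  also have "7 \<le> 3 * cpair f g + (7::'a)" by simp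
  finally have 1: "\<not> Basic X (3 * cpair f g + 7) x y"
    using Basic_le by (meson not_less)
  have 2: "3 * p + 7 \<noteq> 3 * q + (8::'a)" "3 * p + 7 \<noteq> 3 * q + (9::'a)" for p q :: 'a
    unfolding e using mod_3(2)[of "p + 2" 1 "q + 2" 2] mod_3(2)[of "p + 2" 1 "q + 3" 0] by auto
  have 3: "p = q" if "3 * p + 7 = 3 * q + (7::'a)" for p q :: 'a
    using that mod_3(1)[of "p + 2" 1 "q + 2" 1] unfolding e by auto
  show ?thesis
    using assms that 1 2 3 unfolding Step_def by (metis cpair_inj)
qed

lemma Step_0: "Step X R 0 x (y::'a::discrete_semiring) \<Longrightarrow> y = x"
  unfolding Step_def Basic_0 by auto

lemma Step_6:
  assumes "Step X R 6 x (0::'a::discrete_semiring)"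
  shows "x \<in> X"
proof -
  have "6 < 3 * p + (7::'a)" "6 < 3 * p + (8::'a)" "6 < 3 * p + (9::'a)" for p :: 'a
    by (rule order_less_le_trans[of 6 7] order_less_le_trans[of 6 8] order_less_le_trans[of 6 9]; simp)+
  then have "6 \<noteq> 3 * p + (7::'a)" "6 \<noteq> 3 * p + (8::'a)" "6 \<noteq> 3 * p + (9::'a)" for p :: 'a
    by (metis less_irrefl)+
  then show ?thesis
    using assms unfolding Step_def Basic_6 by auto
qed

text \<open>The number 27 is \<open>3 * 6 + 9\<close>, the search applied to index 6, the oracle's
  characteristic function, whose value 0 means membership.\<close>

lemma Step_27:
  assumes "Step X R 27 x (y::'a::discrete_semiring)"
  shows "R 6 (cpair x y) 0"
proof -
  have e: "3 * p + 7 = 3 * (p + 2) + (1::'a)" "3 * p + 8 = 3 * (p + 2) + (2::'a)"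
    "3 * p + 9 = 3 * (p + 3) + (0::'a)" "27 = 3 * 9 + (0::'a)" for p :: 'a
    by (simp_all add: distrib_left add.assoc)
  have 1: "\<not> Basic X 27 x y"
    using Basic_le[of X 27 x y] by auto
  have 2: "27 \<noteq> 3 * q + (8::'a)" "27 \<noteq> 3 * q + (7::'a)" for q :: 'a
    unfolding e using mod_3(2)[of 9 0 "q + 2" 2] mod_3(2)[of 9 0 "q + 2" 1] by auto
  have 3: "f = 6" if "27 = 3 * f + (9::'a)" for f :: 'a
  proof -
    have "9 = f + (3::'a)"
      using that mod_3(1)[of 9 0 "f + 3" 0] unfolding e by simp
    then have "6 + 3 = f + (3::'a)" by simp
    then show ?thesis by (metis add_right_cancel)
  qed
  show ?thesis
    using assms 1 2 3 unfolding Step_def by metis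
qed

lemma bounded_BEx: "bounded \<phi> \<Longrightarrow> bounded (BEx t \<phi>)"
  unfolding BEx_def by (intro bounded.intros)

lemma bounded_computation: "bounded (computation X c d l)"
  unfolding computation_def basic_step_def comp_step_def pairing_step_def mu_step_def occurs_def beta_def Let_def
  by (intro bounded.intros bounded_BEx)

context rca0_model
begin

text \<open>Comes from the formula \<open>computation\<close> itself, in which every quantifier is
  bounded.\<close>

lemma bdef_Comp:
  assumes "X \<in> \<S>" "tdef c" "tdef d" "tdef l"
  shows "bdef \<S> (\<lambda>e. Comp X (c e) (d e) (l e :: 'a))"
proof -
  have "bdef \<S> (\<lambda>e. Comp X (e 0) (e (Suc 0)) (e (Suc (Suc 0))))"
    unfolding bdef_def
    by (intro exI[of _ "computation 0 (Var 0) (Var 1) (Var 2)"] exI[of _ Inl] exI[of _ "\<lambda>_. X"])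
      (auto simp: assms(1) bounded_computation assign_def numeral_2_eq_2)
  moreover have "tdef (\<lambda>e. case_nat (c e) (case_nat (d e) (\<lambda>_. l e)) n)" for n
    by (intro tdef_case_nat assms)
  ultimately show ?thesis
    using bdef_subst[of _ "\<lambda>n e. case_nat (c e) (case_nat (d e) (\<lambda>_. l e)) n"] by fastforce
qed

lemma tdef_ctriple: "tdef f \<Longrightarrow> tdef g \<Longrightarrow> tdef h \<Longrightarrow> tdef (\<lambda>e. ctriple (f e) (g e) (h e))"
  unfolding ctriple_def by (intro tdef_cpair)

lemma Comp_extend:
  assumes "Comp X c d l" "Step X (Occ c d l) e x y"
  obtains c' d' l' where "Comp X c' d' l'" "\<And>e x y. Occ c d l e x y \<Longrightarrow> Occ c' d' l' e x y" "Occ c' d' l' e x (y::'a)"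
proof -
  obtain c' d' where 1: "\<And>i w. i < l \<Longrightarrow> Beta c d i w \<Longrightarrow> Beta c' d' i w" and 2: "Beta c' d' l (ctriple e x y)"
    using beta_append[of l c d "ctriple e x y"] by blast
  have occ: "Occ c' d' i e x y" if "Occ c d i e x y" "i \<le> l" for i e x y
    using that 1 unfolding Occ_def by (meson order_less_le_trans)
  have "Comp X c' d' (l + 1)"
    unfolding Comp_def
  proof (intro allI impI)
    fix i assume "i < l + 1"
    then consider "i < l" | "i = l" by (auto simp: le_less)
    then show "\<exists>e x y. Beta c' d' i (ctriple e x y) \<and> Step X (Occ c' d' i) e x y"
    proof cases
      case 1
      then obtain e x y where "Beta c d i (ctriple e x y)" "Step X (Occ c d i) e x y"
        using assms(1) unfolding Comp_def by blast
      with 1 show ?thesis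
        using \<open>\<And>i w. i < l \<Longrightarrow> Beta c d i w \<Longrightarrow> Beta c' d' i w\<close> Step_mono[of X "Occ c d i" e x y "Occ c' d' i"] occ[of i]
        by (meson less_imp_le)
    next
      case 2
      then show ?thesis
        using \<open>Beta c' d' l (ctriple e x y)\<close> Step_mono[OF assms(2), of "Occ c' d' l"] occ by blast
    qed
  qed
  moreover have "Occ c' d' (l + 1) e' x' y'" if "Occ c d l e' x' y'" for e' x' y'
    using Occ_mono[OF occ[OF that]] by simp
  moreover have "Occ c' d' (l + 1) e x y"
    using 2 unfolding Occ_def by auto
  ultimately show ?thesis by (rule that)
qed

end

section \<open>Arithmetical comprehension\<close>

lemma sat_finite_support: "\<exists>N. \<forall>e e'. (\<forall>n<N. e n = e' n) \<longrightarrow> sat \<S> e E \<phi> = sat \<S> e' E \<phi>"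
proof -
  obtain N where N: "\<And>\<sigma> \<tau>. (\<forall>n<N. \<sigma> n = \<tau> n) \<Longrightarrow> nsub \<sigma> \<phi> = nsub \<tau> \<phi>"
    using nsub_finite_support unfolding finite_support_def by metis
  define \<sigma> where "\<sigma> n = (if n < N then Var n else Zero)" for n
  have "nsub \<sigma> \<phi> = \<phi>"
    using N[of \<sigma> Var] by (simp add: \<sigma>_def)
  moreover have "(\<lambda>n. ev e (\<sigma> n)) = (\<lambda>n. ev e' (\<sigma> n))" if "\<forall>n<N. e n = e' n" for e e' :: "nat \<Rightarrow> 'a"
    using that by (auto simp: \<sigma>_def)
  ultimately show ?thesis
    using sat_nsub[of \<S> _ E \<sigma> \<phi>] by (intro exI[of _ N]) metis
qed

text \<open>Supplies the number of relevant places on which the removal of a quantifier proceeds by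
  induction.\<close>

lemma bdef_finite_support:
  assumes "bdef \<S> Q"
  shows "\<exists>N. \<forall>e e'. (\<forall>n\<le>N. e n = e' n) \<longrightarrow> Q e = Q e'"
proof -
  obtain \<theta> \<sigma> E where Q: "\<And>e. Q e \<longleftrightarrow> sat \<S> (assign \<sigma> e) E \<theta>"
    using assms unfolding bdef_def by metis
  obtain N where N: "\<And>e e'. (\<forall>n<N. e n = e' n) \<Longrightarrow> sat \<S> e E \<theta> = sat \<S> e' E \<theta>"
    using sat_finite_support by blast
  define M where "M = (\<Sum>n<N. case \<sigma> n of Inl k \<Rightarrow> k | Inr _ \<Rightarrow> 0)"
  have M: "k \<le> M" if "n < N" "\<sigma> n = Inl k" for n k
    using member_le_sum[of n "{..<N}" "\<lambda>n. case \<sigma> n of Inl k \<Rightarrow> k | Inr _ \<Rightarrow> 0"] that by (simp add: M_def)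
  have "Q e = Q e'" if "\<forall>n\<le>M. e n = e' n" for e e'
    unfolding Q using that M by (intro N) (auto simp: assign_def split: sum.split)
  then show ?thesis by blast
qed

definition jump_axiom :: fm where
  "jump_axiom = AllS (AllN (ExS (is_iterated_jump 1 (Var 0) 0)))"

lemma sat_is_iterated_jump:
  "sat \<S> a E (is_iterated_jump X n Y) \<longleftrightarrow>
    (\<exists>Z\<in>\<S>. (\<forall>x. x \<in> E X \<longleftrightarrow> cpair x 0 \<in> Z) \<and> (\<forall>x. x \<in> E Y \<longleftrightarrow> cpair x (ev a n) \<in> Z)
      \<and> (\<forall>i<ev a n. \<exists>W\<in>\<S>. (\<forall>x. x \<in> W \<longleftrightarrow> cpair x i \<in> Z)
        \<and> (\<exists>W'\<in>\<S>. \<forall>x. x \<in> W' \<longleftrightarrow> cpair x (i + 1) \<in> Z)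
        \<and> (\<forall>x::'a::discrete_semiring. cpair x (i + 1) \<in> Z \<longleftrightarrow> (\<exists>y. Computes W x x y))))"
  by (simp add: is_iterated_jump_def Let_def numeral_2_eq_2)

locale aca0_model = rca0_model +
  assumes jump_axiom: "valid \<S> jump_axiom"
begin

text \<open>The instance \<open>n = 1\<close> of the axiom: the sequence \<open>Z\<close> has
  \<open>X\<close> as section 0 and its jump as section 1.\<close>

lemma jump_exists:
  assumes "X \<in> \<S>"
  shows "\<exists>Y\<in>\<S>. \<forall>x. x \<in> Y \<longleftrightarrow> (\<exists>y. Computes X x x y)"
proof -
  obtain E :: "nat \<Rightarrow> 'a set" where "range E \<subseteq> \<S>"
    using some_range ..
  then have "sat \<S> (\<lambda>_. 0) E jump_axiom"
    using jump_axiom unfolding valid_def by blast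
  then have "\<forall>n. \<exists>Y\<in>\<S>. sat \<S> (case_nat n (\<lambda>_. 0)) (case_nat Y (case_nat X E)) (is_iterated_jump 1 (Var 0) 0)"
    using assms by (simp add: jump_axiom_def)
  then obtain Y where "sat \<S> (case_nat 1 (\<lambda>_. 0)) (case_nat Y (case_nat X E)) (is_iterated_jump 1 (Var 0) 0)"
    by blast
  then obtain Z where Z: "\<forall>x. x \<in> X \<longleftrightarrow> cpair x 0 \<in> Z"
    and *: "\<forall>i<1. \<exists>W\<in>\<S>. (\<forall>x. x \<in> W \<longleftrightarrow> cpair x i \<in> Z) \<and> (\<exists>W'\<in>\<S>. \<forall>x. x \<in> W' \<longleftrightarrow> cpair x (i + 1) \<in> Z)
      \<and> (\<forall>x. cpair x (i + 1) \<in> Z \<longleftrightarrow> (\<exists>y. Computes W x x y))"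
    unfolding sat_is_iterated_jump by auto
  from *[THEN spec, THEN mp, OF zero_less_one] obtain W where W: "\<forall>x. x \<in> W \<longleftrightarrow> cpair x 0 \<in> Z"
    "\<exists>W'\<in>\<S>. \<forall>x. x \<in> W' \<longleftrightarrow> cpair x (0 + 1) \<in> Z" "\<forall>x. cpair x (0 + 1) \<in> Z \<longleftrightarrow> (\<exists>y. Computes W x x y)"
    by (rule bexE, elim conjE) (rule that)
  have "W = X" using W(1) Z by blast
  with W(2,3) show ?thesis by simp
qed

text \<open>An application of \<open>h\<close> is not a definable term; its value is named by an
  existential quantifier over the graph \<open>H\<close>.\<close>

lemma sdef_graph:
  assumes "H \<in> \<S>" "\<And>x y. cpair x y \<in> H \<longleftrightarrow> h x = y" "tdef f" "sdef \<S> (\<lambda>e. P (e 0) (\<lambda>n. e (Suc n)))"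
  shows "sdef \<S> (\<lambda>e. P (h (f e)) e)"
proof -
  have "sdef \<S> (\<lambda>e. \<exists>k. cpair (f e) k \<in> H \<and> P k e)"
    using assms(1,3,4)
    by (intro sdef_ex sdef_conj sdef_mem tdef_cpair tdef_var tdef_subst[of f "\<lambda>n e. e (Suc n)"])
  then show ?thesis
    by (rule sdef_cong) (simp add: assms(2))
qed

text \<open>
  The index \<open>h x\<close> is the index 27 of the search through the oracle, \<open>x\<close> times composed with the
  identity. Run on itself as input, it searches for some \<open>y\<close> with \<open>cpair (h x) y\<close> in the oracle.
\<close>

lemma projection:
  assumes A: "A \<in> \<S>"
  shows "{x. \<exists>y. cpair x y \<in> A} \<in> \<S>"
proof -
  \<comment> \<open>The right-hand index is that of the identity composed with the given one. This
    padding keeps the function and changes the index, so the diagonal input \<open>h x\<close>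
    itself carries \<open>x\<close>; no s-m-n theorem is required.\<close>
  have "bdef \<S> (\<lambda>e. 3 * cpair 0 (e 0) + 7 = e (Suc 0))"
    by (intro bdef_intros tdef_cpair)
  from primitive_recursion[OF this, of 27] obtain h where
    h: "h 0 = (27::'a)" "\<And>x. h (x + 1) = 3 * cpair 0 (h x) + 7" and graph: "{z. \<exists>x. z = cpair x (h x)} \<in> \<S>"
    by blast
  define H where "H = {z. \<exists>x. z = cpair x (h x)}"
  have H: "H \<in> \<S>" "\<And>x y. cpair x y \<in> H \<longleftrightarrow> h x = y"
    using graph by (auto simp: H_def)
  note sdef_h = sdef_graph[OF H]
  have h_less: "h x < h (x + 1)" for x
  proof -
    have "h x \<le> cpair 0 (h x)" by (rule le_cpair2)
    also have "\<dots> < 3 * cpair 0 (h x) + 7" by (rule less_3_times)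
    finally show ?thesis by (simp add: h)
  qed
  have h_mono: "y < x \<longrightarrow> h y < h x" for x y
  proof (induction x rule: sdef_induct)
    case definable
    show ?case
      by (rule sdef_imp, intro bdef_intros, rule sdef_h[of "\<lambda>e. e 0" "\<lambda>k e. h y < k"]) (intro sdef_intros)+
  next
    case (step x)
    then show ?case using h_less by (metis le_less less_add_1_iff less_trans)
  qed simp
  have h_inj: "h x = h y \<longleftrightarrow> x = y" for x y
    using h_mono by (metis less_irrefl linorder_neqE)
  have le_h: "x \<le> h x" for x
  proof (induction x rule: sdef_induct)
    case definable
    show ?case
      by (rule sdef_h[of "\<lambda>e. e 0" "\<lambda>k e. e 0 \<le> k"]) (intro sdef_intros)+
  next
    case (step x)
    then show ?case using h_less[of x] by (simp add: order_le_less_trans)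
  qed simp
  \<comment> \<open>The set \<open>A\<close> with first components renamed along \<open>h\<close>,
    because the search on input \<open>h x\<close> queries pairs with first component
    \<open>h x\<close>. As \<open>x \<le> h x\<close>, all quantifiers can be bounded by
    \<open>z\<close>.\<close>
  define X where "X = {z. \<exists>x\<le>z. \<exists>k\<le>z. \<exists>y\<le>z. cpair x k \<in> H \<and> z = cpair k y \<and> cpair x y \<in> A}"
  have X: "X \<in> \<S>"
    unfolding X_def by (rule comprehension) (intro bdef_intros tdef_cpair H A)
  have X_iff: "cpair (h x) y \<in> X \<longleftrightarrow> cpair x y \<in> A" for x y
    unfolding X_def using le_h[of x] le_cpair1[of "h x" y] le_cpair2[of y "h x"] order_trans[OF le_h le_cpair1]
    by (auto simp: H(2) h_inj)
  have down: "Occ c d l 27 z w" if C: "Comp X c d l" and O: "Occ c d l (h x) z w" for c d l x z w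
  proof -
    \<comment> \<open>Strips off the compositions with the identity one by one. Results occur in the
      sequence, so bounding \<open>w\<close> by \<open>c\<close> loses nothing and keeps the
      condition on \<open>w\<close> bounded.\<close>
    have "\<forall>w\<le>c. Occ c d l (h x) z w \<longrightarrow> Occ c d l 27 z w" for x
    proof (induction x rule: sdef_induct)
      case definable
      show ?case unfolding Occ_def
        by (rule sdef_h[of "\<lambda>e. e 0" "\<lambda>k e. \<forall>w\<le>c. (\<exists>i<l. Beta c d i (ctriple k z w)) \<longrightarrow> (\<exists>i<l. Beta c d i (ctriple 27 z w))"])
          (intro tdef_var sdef_bdef bdef_intros bdef_Beta tdef_ctriple)+
    next
      case (step x)
      show ?case
      proof (intro allI impI)
        fix w assume "w \<le> c" and "Occ c d l (h (x + 1)) z w"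
        with C have "Step X (Occ c d l) (3 * cpair 0 (h x) + 7) z w"
          using Comp_Step h(2) by metis
        then obtain w' where w': "Occ c d l (h x) z w'" "Occ c d l 0 w' w"
          by (rule Step_comp_code)
        have "w = w'"
          using Step_0 Comp_Step[OF C w'(2)] by blast
        with w' \<open>w \<le> c\<close> step show "Occ c d l 27 z w" by blast
      qed
    qed (simp add: h)
    then show ?thesis using O Occ_le(3) by blast
  qed
  have up: "\<exists>w. Computes X (h x) (h x) w" if ex: "cpair x y \<in> A" for x y
  proof -
    let ?z = "h x"
    have "bdef \<S> (\<lambda>e. cpair ?z (e 0) \<in> X)"
      by (intro bdef_intros tdef_cpair X)
    \<comment> \<open>The search returns a least zero, so the least member is taken; all smaller
      queries then have the value 1.\<close>
    then obtain y where y: "cpair ?z y \<in> X" "\<forall>u<y. cpair ?z u \<notin> X"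
      using bdef_least[of "\<lambda>y. cpair ?z y \<in> X" y] ex X_iff by auto
    \<comment> \<open>Enters the failed queries below \<open>y\<close> into one computation. Their
      number may be nonstandard, so this takes an induction in the model.\<close>
    have "j \<le> y \<longrightarrow> (\<exists>c d l. Comp X c d l \<and> (\<forall>i<j. Occ c d l 6 (cpair ?z i) 1))" for j
    proof (induction j rule: sdef_induct)
      case definable
      show ?case unfolding Occ_def
        by (rule sdef_imp, intro bdef_intros) (intro sdef_ex sdef_bdef bdef_intros bdef_Comp bdef_Beta tdef_ctriple tdef_cpair X)
    next
      case 0
      have "Comp X 0 0 0" by (simp add: Comp_def)
      then show ?case by (meson not_less_zero)
    next
      case (step j)
      show ?case
      proof
        assume "j + 1 \<le> y"
        then have "j < y" by simp
        with step obtain c d l where *: "Comp X c d l" "\<forall>i<j. Occ c d l 6 (cpair ?z i) 1"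
          by auto
        have "Step X (Occ c d l) 6 (cpair ?z j) 1"
          unfolding Step_def Basic_6 using y(2) \<open>j < y\<close> by blast
        from Comp_extend[OF *(1) this] obtain c' d' l' where "Comp X c' d' l'"
          "\<And>e x y. Occ c d l e x y \<Longrightarrow> Occ c' d' l' e x y" "Occ c' d' l' 6 (cpair ?z j) 1" by metis
        with *(2) show "\<exists>c d l. Comp X c d l \<and> (\<forall>i<j + 1. Occ c d l 6 (cpair ?z i) 1)"
          by (metis le_less less_add_1_iff)
      qed
    qed
    then obtain c d l where 1: "Comp X c d l" "\<forall>i<y. Occ c d l 6 (cpair ?z i) 1"
      by blast
    have "Step X (Occ c d l) 6 (cpair ?z y) 0"
      unfolding Step_def Basic_6 using y(1) by blast
    from Comp_extend[OF 1(1) this] obtain c' d' l' where 2: "Comp X c' d' l'"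
      "\<And>e x y. Occ c d l e x y \<Longrightarrow> Occ c' d' l' e x y" "Occ c' d' l' 6 (cpair ?z y) 0" by metis
    have "27 = 3 * 6 + (9::'a)" by simp
    moreover have "\<forall>i<y. \<exists>w. w \<noteq> 0 \<and> Occ c' d' l' 6 (cpair ?z i) w"
      using 1(2) 2(2) zero_neq_one by metis
    ultimately have "Step X (Occ c' d' l') 27 ?z y"
      unfolding Step_def using 2(3) by blast
    from Comp_extend[OF 2(1) this] have 3: "\<exists>c d l. Comp X c d l \<and> Occ c d l 27 ?z y" by metis
    \<comment> \<open>The input \<open>?z\<close> stays fixed while the index climbs from
      \<open>h 0 = 27\<close>; each step appends an application of the identity and the
      composition.\<close>
    have "\<exists>c d l. Comp X c d l \<and> Occ c d l (h i) ?z y" for i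
    proof (induction i rule: sdef_induct)
      case definable
      show ?case unfolding Occ_def
        by (rule sdef_h[of "\<lambda>e. e 0" "\<lambda>k e. \<exists>c d l. Comp X c d l \<and> (\<exists>i<l. Beta c d i (ctriple k ?z y))"])
          (intro tdef_var sdef_ex sdef_bdef bdef_intros bdef_Comp bdef_Beta tdef_ctriple X)+
    next
      case 0
      show ?case using 3 by (simp add: h)
    next
      case (step i)
      then obtain c d l where *: "Comp X c d l" "Occ c d l (h i) ?z y" by blast
      have "Step X (Occ c d l) 0 y y"
        unfolding Step_def Basic_0 by blast
      from Comp_extend[OF *(1) this] obtain c' d' l' where **: "Comp X c' d' l'"
        "\<And>e x y. Occ c d l e x y \<Longrightarrow> Occ c' d' l' e x y" "Occ c' d' l' 0 y y" by metis
      have "Step X (Occ c' d' l') (h (i + 1)) ?z y"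
        unfolding Step_def h(2) using **(2)[OF *(2)] **(3) by blast
      from Comp_extend[OF **(1) this] show ?case by metis
    qed
    then show ?thesis unfolding Computes_def by blast
  qed
  obtain J where J: "J \<in> \<S>" "\<And>x. x \<in> J \<longleftrightarrow> (\<exists>y. Computes X x x y)"
    using jump_exists[OF X] by blast
  have "(\<exists>y. cpair x y \<in> A) \<longleftrightarrow> h x \<in> J" for x
  proof
    assume "h x \<in> J"
    then obtain c d l y where *: "Comp X c d l" "Occ c d l (h x) (h x) y"
      unfolding J Computes_def by blast
    then have "Occ c d l 6 (cpair (h x) y) 0"
      using down Comp_Step Step_27 by blast
    then have "cpair (h x) y \<in> X"
      using Comp_Step[OF *(1)] Step_6 by blast
    then show "\<exists>y. cpair x y \<in> A"
      using X_iff by blast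
  qed (use up J in blast)
  then have "{x. \<exists>y. cpair x y \<in> A} = {x. h x \<in> J}" by blast
  also have "\<dots> \<in> \<S>"
  proof (rule delta_comprehension)
    show "sdef \<S> (\<lambda>e. h (e 0) \<in> J)"
      by (rule sdef_h[of "\<lambda>e. e 0" "\<lambda>k e. k \<in> J"]) (intro sdef_intros J)+
    show "sdef \<S> (\<lambda>e. h (e 0) \<notin> J)"
      by (rule sdef_h[of "\<lambda>e. e 0" "\<lambda>k e. k \<notin> J"]) (intro sdef_intros bdef_intros J)+
  qed
  finally show ?thesis .
qed

text \<open>Induction, outside the model, on the number of relevant places. With one place besides
  the quantified one, the predicate is a set of pairs and \<open>projection\<close> applies;
  otherwise two places are packed into one.\<close>

lemma bdef_ex_support:
  assumes "bdef \<S> Q" "\<And>e e'. (\<forall>n\<le>Suc N. e n = e' n) \<Longrightarrow> Q e = Q e'"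
  shows "bdef \<S> (\<lambda>e. \<exists>x. Q (case_nat x e))"
  using assms
proof (induction N arbitrary: Q)
  case 0
  define Q' where "Q' a x \<longleftrightarrow> Q (case_nat x (\<lambda>_. a))" for a x
  have "tdef (\<lambda>e. case_nat (e (Suc 0)) (\<lambda>_. e 0) n :: 'a)" for n
    by (intro tdef_case_nat tdef_var)
  from bdef_subst[OF 0(1), of "\<lambda>n e. case_nat (e (Suc 0)) (\<lambda>_. e 0) n", OF this]
  have Q': "bdef \<S> (\<lambda>e. Q' (e 0) (e (Suc 0)))"
    unfolding Q'_def .
  have Q_iff: "Q (case_nat x e) \<longleftrightarrow> Q' (e 0) x" for x e
    unfolding Q'_def by (rule 0(2)) (auto simp: le_Suc_eq)
  define A where "A = {z. \<exists>a\<le>z. \<exists>x\<le>z. z = cpair a x \<and> Q' a x}"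
  have "A \<in> \<S>"
    unfolding A_def by (rule comprehension) (intro bdef_intros tdef_cpair bdef_rel2[OF Q'])
  have A: "cpair a x \<in> A \<longleftrightarrow> Q' a x" for a x
    unfolding A_def using le_cpair1 le_cpair2 by auto
  define A' where "A' = {a. \<exists>x. cpair a x \<in> A}"
  have "A' \<in> \<S>"
    unfolding A'_def by (rule projection[OF \<open>A \<in> \<S>\<close>])
  then have "bdef \<S> (\<lambda>e. e 0 \<in> A')"
    by (intro bdef_intros)
  then show ?case
    unfolding Q_iff A'_def A by simp
next
  case (Suc N)
  define f :: "'a \<Rightarrow> 'a \<Rightarrow> 'a \<Rightarrow> (nat \<Rightarrow> 'a) \<Rightarrow> nat \<Rightarrow> 'a" where
    "f x a b e = case_nat x (case_nat a (case_nat b e))" for x a b e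
  \<comment> \<open>Place 1 now holds the pair of the former places 1 and 2, so \<open>Q'\<close>
    depends on one place fewer than \<open>Q\<close>.\<close>
  define Q' where "Q' e \<longleftrightarrow> (\<exists>a\<le>e (Suc 0). \<exists>b\<le>e (Suc 0). e (Suc 0) = cpair a b \<and> Q (f (e 0) a b (\<lambda>n. e (Suc (Suc n)))))" for e
  have "tdef (\<lambda>e. f (e (Suc (Suc 0))) (e (Suc 0)) (e 0) (\<lambda>n. e (Suc (Suc (Suc (Suc n))))) n :: 'a)" for n
    unfolding f_def by (intro tdef_case_nat tdef_var)
  from bdef_subst[OF Suc(2), of "\<lambda>n e. f (e (Suc (Suc 0))) (e (Suc 0)) (e 0) (\<lambda>n. e (Suc (Suc (Suc (Suc n))))) n", OF this]
  have "bdef \<S> Q'"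
    unfolding Q'_def by (intro bdef_intros tdef_cpair)
  moreover have "Q' e = Q' e'" if *: "\<forall>n\<le>Suc N. e n = e' n" for e e'
  proof -
    have "Q (f (e 0) a b (\<lambda>n. e (Suc (Suc n)))) = Q (f (e' 0) a b (\<lambda>n. e' (Suc (Suc n))))" for a b
      using * by (intro Suc(3)) (auto simp: f_def split: nat.split)
    moreover have "e (Suc 0) = e' (Suc 0)" using * by simp
    ultimately show ?thesis unfolding Q'_def by simp
  qed
  ultimately have *: "bdef \<S> (\<lambda>e. \<exists>x. Q' (case_nat x e))"
    by (rule Suc(1))
  have "tdef (\<lambda>e. case_nat (cpair (e 0) (e (Suc 0))) (\<lambda>n. e (Suc (Suc n))) n :: 'a)" for n
    by (intro tdef_case_nat tdef_var tdef_cpair)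
  from bdef_subst[OF *, of "\<lambda>n e. case_nat (cpair (e 0) (e (Suc 0))) (\<lambda>n. e (Suc (Suc n))) n", OF this]
  have "bdef \<S> (\<lambda>e. \<exists>x. Q' (case_nat x (case_nat (cpair (e 0) (e (Suc 0))) (\<lambda>n. e (Suc (Suc n))))))" .
  moreover have "Q' (case_nat x (case_nat (cpair (e 0) (e (Suc 0))) (\<lambda>n. e (Suc (Suc n))))) \<longleftrightarrow> Q (case_nat x e)" for x e
  proof -
    have "f x (e 0) (e (Suc 0)) (\<lambda>n. e (Suc (Suc n))) = case_nat x e"
      unfolding f_def by (intro ext) (simp split: nat.split)
    then show ?thesis
      unfolding Q'_def using le_cpair1 le_cpair2 by auto
  qed
  ultimately show ?case by simp
qed

text \<open>From here on \<open>bdef\<close> is closed under unbounded quantifiers, so induction,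
  least elements and comprehension cover all arithmetical predicates.\<close>

lemma bdef_ex:
  assumes "bdef \<S> (\<lambda>e. P (e 0) (\<lambda>n. e (Suc n)))"
  shows "bdef \<S> (\<lambda>e. \<exists>x. P x e)"
proof -
  define Q where "Q e \<longleftrightarrow> P (e 0) (\<lambda>n. e (Suc n))" for e
  have "bdef \<S> Q" using assms unfolding Q_def .
  moreover from this obtain N where "\<forall>e e'. (\<forall>n\<le>N. e n = e' n) \<longrightarrow> Q e = Q e'"
    using bdef_finite_support by blast
  then have "\<forall>e e'. (\<forall>n\<le>Suc N. e n = e' n) \<longrightarrow> Q e = Q e'"
    by simp
  ultimately have "bdef \<S> (\<lambda>e. \<exists>x. Q (case_nat x e))"
    by (intro bdef_ex_support[of Q N]) auto
  then show ?thesis unfolding Q_def by simp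
qed

lemma bdef_all:
  assumes "bdef \<S> (\<lambda>e. P (e 0) (\<lambda>n. e (Suc n)))"
  shows "bdef \<S> (\<lambda>e. \<forall>x. P x e)"
  using bdef_not[OF bdef_ex[of "\<lambda>x e. \<not> P x e", OF bdef_not[OF assms]]] by simp

end

section \<open>Finite sets and finitary inductive definitions\<close>

lemma cpair_mono: "x \<le> x' \<Longrightarrow> y \<le> y' \<Longrightarrow> cpair x y \<le> cpair x' y'"
  unfolding cpair_def by (intro add_mono mult_mono) simp_all

text \<open>A number codes a finite set through a beta-coded characteristic sequence of length
  \<open>n\<close>. Numbers that are not triples code the empty set, so every number is a
  code.\<close>

definition Fin :: "'a::discrete_semiring \<Rightarrow> 'a \<Rightarrow> bool" where
  "Fin t x \<longleftrightarrow> (\<exists>c\<le>t. \<exists>d\<le>t. \<exists>n\<le>t. t = ctriple c d n \<and> x < n \<and> Beta c d x 1)"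

lemma Fin_less: "Fin t x \<Longrightarrow> x < t"
  unfolding Fin_def by (meson order_less_le_trans)

context aca0_model
begin

lemmas bdef_intros = bdef_intros bdef_ex bdef_all tdef_cpair tdef_ctriple

lemma bdef_Fin: "tdef f \<Longrightarrow> tdef g \<Longrightarrow> bdef \<S> (\<lambda>e. Fin (f e) (g e))"
proof -
  assume fg: "tdef f" "tdef g"
  have "bdef \<S> (\<lambda>e. Fin (e 0) (e (Suc 0)))"
    unfolding Fin_def by (intro bdef_intros bdef_Beta)
  from bdef_rel2[OF this fg] show ?thesis .
qed

lemma Fin_code:
  assumes "X \<in> \<S>"
  shows "\<exists>t. \<forall>x. Fin t x \<longleftrightarrow> x < n \<and> x \<in> X"
proof -
  define f where "f i = (if i \<in> X then 1 else 0 :: 'a)" for i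
  have "f i = y \<longleftrightarrow> (i \<in> X \<and> y = 1 \<or> i \<notin> X \<and> y = 0)" for i y
    by (auto simp: f_def)
  then have "bdef \<S> (\<lambda>e. f (e 0) = e (Suc 0))"
    by (simp only:) (intro bdef_intros assms)
  moreover have "f i \<le> 1" for i
    by (simp add: f_def)
  ultimately obtain c d where cd: "\<forall>i<n. Beta c d i (f i)"
    using beta_sequence[of f n 1] by blast
  have "Beta c d i 1 \<longleftrightarrow> i \<in> X" if "i < n" for i
    using cd that Beta_unique[of c d i "f i" 1] by (auto simp: f_def split: if_splits)
  moreover have "Fin (ctriple c d n) x \<longleftrightarrow> x < n \<and> Beta c d x 1" for x
    unfolding Fin_def
    using le_ctriple(1)[of c d n] le_ctriple(2)[of d c n] le_ctriple(3)[of n c d] by auto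
  ultimately show ?thesis by blast
qed

text \<open>Arithmetical collection, by induction on the length of the initial segment already
  bounded.\<close>

lemma collection:
  assumes Q: "bdef \<S> (\<lambda>e. Q (e 0) (e (Suc 0)))" and ex: "\<forall>y<n. \<exists>t. Q y t"
  shows "\<exists>B. \<forall>y<n. \<exists>t<B. Q y (t::'a)"
proof -
  have "\<exists>B. \<forall>y<k. y < n \<longrightarrow> (\<exists>t<B. Q y t)" for k
  proof (induction k rule: bdef_induct)
    case definable
    show ?case by (intro bdef_intros bdef_rel2[OF Q])
  next
    case (step k)
    then obtain B where B: "\<forall>y<k. y < n \<longrightarrow> (\<exists>t<B. Q y t)" ..
    obtain t where t: "k < n \<longrightarrow> Q k t" using ex by blast
    have "t < B + t + 1" "B \<le> B + t + 1"
      by (simp add: add_increasing) (metis add.assoc le_iff_add)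
    with B t show ?case
      by (intro exI[of _ "B + t + 1"]) (metis le_less less_add_1_iff order_less_le_trans)
  qed simp
  then show ?thesis by blast
qed

text \<open>Let \<open>L\<close> be the union of all coded finite sets that justify each of their
  own elements; this definition is arithmetical. If \<open>x\<close> follows from finitely many
  elements of \<open>L\<close>, finitely many such sets, united and joined with \<open>x\<close>,
  again justify themselves. The result is a fixed point, not claimed to be the least.\<close>

lemma finitary_fixpoint:
  assumes mono: "\<And>A B x. J A x \<Longrightarrow> (\<And>y. A y \<Longrightarrow> B y) \<Longrightarrow> J B x"
    and finitary: "\<And>A x. J A x \<Longrightarrow> \<exists>n. J (\<lambda>y. y < n \<and> A y) x"
    and J: "bdef \<S> (\<lambda>e. J (Fin (e 0)) (e (Suc 0)))"
  shows "\<exists>L\<in>\<S>. \<forall>x. x \<in> L \<longleftrightarrow> J (\<lambda>y. y \<in> L) (x::'a)"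
proof -
  define just where "just t \<longleftrightarrow> (\<forall>y. Fin t y \<longrightarrow> J (Fin t) y)" for t
  have just: "bdef \<S> (\<lambda>e. just (e 0))"
    unfolding just_def by (intro bdef_intros bdef_Fin bdef_rel2[OF J])
  define L where "L = {x. \<exists>t. just t \<and> Fin t x}"
  have L: "L \<in> \<S>"
    unfolding L_def by (rule comprehension) (intro bdef_intros bdef_Fin bdef_rel1[OF just])
  have "x \<in> L \<longleftrightarrow> J (\<lambda>y. y \<in> L) x" for x
  proof
    assume "x \<in> L"
    then obtain t where "just t" "Fin t x" unfolding L_def by blast
    then show "J (\<lambda>y. y \<in> L) x"
      using mono[of "Fin t" x "\<lambda>y. y \<in> L"] unfolding just_def L_def by blast
  next
    assume "J (\<lambda>y. y \<in> L) x"
    then obtain n where n: "J (\<lambda>y. y < n \<and> y \<in> L) x"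
      using finitary by blast
    have "\<exists>B. \<forall>y<n. \<exists>t<B. y \<in> L \<longrightarrow> just t \<and> Fin t y"
    proof (rule collection)
      show "bdef \<S> (\<lambda>e. e 0 \<in> L \<longrightarrow> just (e (Suc 0)) \<and> Fin (e (Suc 0)) (e 0))"
        by (intro bdef_intros bdef_Fin bdef_rel1[OF just] L)
    qed (auto simp: L_def)
    then obtain B where B: "\<forall>y<n. \<exists>t<B. y \<in> L \<longrightarrow> just t \<and> Fin t y" ..
    \<comment> \<open>By the bound \<open>B\<close> obtained from \<open>collection\<close>, the
      relevant sets have codes below \<open>B\<close>. Elements are smaller than their codes, so
      this union is bounded and has a code itself.\<close>
    define T where "T = {y. y = x \<or> (\<exists>t<B. just t \<and> Fin t y)}"
    have "T \<in> \<S>"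
      unfolding T_def by (rule comprehension) (intro bdef_intros bdef_Fin bdef_rel1[OF just])
    then obtain s where "\<forall>y. Fin s y \<longleftrightarrow> y < B + x + 1 \<and> y \<in> T"
      using Fin_code by blast
    moreover have "y < B + x + 1" if "y \<in> T" for y
      using that unfolding T_def by (auto simp: add_increasing add_increasing2 dest!: Fin_less)
    ultimately have s: "Fin s y \<longleftrightarrow> y \<in> T" for y by blast
    have "J (Fin s) y" if "y \<in> T" for y
      using that unfolding T_def
    proof (elim CollectE disjE exE conjE)
      assume "y = x"
      with n show ?thesis
        using mono[of "\<lambda>y. y < n \<and> y \<in> L" x "Fin s"] B by (force simp: s T_def)
    next
      fix t assume "t < B" "just t" "Fin t y"
      then show ?thesis
        using mono[of "Fin t" y "Fin s"] by (force simp: s T_def just_def)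
    qed
    then have "just s" unfolding just_def s by blast
    moreover have "Fin s x" by (simp add: s T_def)
    ultimately show "x \<in> L" unfolding L_def by blast
  qed
  with L show ?thesis by blast
qed

end


section \<open>Codes of formulas\<close>

definition impc :: "'a::discrete_semiring \<Rightarrow> 'a \<Rightarrow> 'a" where
  "impc p q = 2 * cpair p q + 2"

definition nextc :: "'a::discrete_semiring \<Rightarrow> 'a" where
  "nextc p = 4 * p + 3"

definition untilc :: "'a::discrete_semiring \<Rightarrow> 'a \<Rightarrow> 'a" where
  "untilc p q = 2 * cpair p q + 4"

lemma numeral_times_inj: "numeral k * x = numeral k * y \<longleftrightarrow> x = (y::'a::discrete_semiring)"
  by (metis less_irrefl linorder_neqE mult_strict_left_mono zero_less_numeral)

lemma impc_inj [simp]: "impc p q = impc p' q' \<longleftrightarrow> p = p' \<and> q = q'"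
  by (simp add: impc_def numeral_times_inj)

lemma untilc_inj [simp]: "untilc p q = untilc p' q' \<longleftrightarrow> p = p' \<and> q = q'"
  by (simp add: untilc_def numeral_times_inj)

lemma nextc_inj [simp]: "nextc p = nextc p' \<longleftrightarrow> p = p'"
  by (simp add: nextc_def numeral_times_inj)

lemma less_code: "p < numeral k * p + (numeral l :: 'a::discrete_semiring)"
proof -
  have "1 \<le> (numeral k :: 'a)" by simp
  then have "1 * p \<le> numeral k * p" by (rule mult_right_mono) simp
  then have "p + 0 < numeral k * p + (numeral l :: 'a)" by (intro add_le_less_mono) simp_all
  then show ?thesis by simp
qed

lemma less_impc: "p < impc p q" "q < impc p q"
  and less_nextc: "p < nextc p"
  and less_untilc: "p < untilc p q" "q < untilc p q"
  unfolding impc_def nextc_def untilc_def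
  by (rule order_le_less_trans[OF le_cpair1 less_code] order_le_less_trans[OF le_cpair2 less_code] less_code)+

lemma tdef_codes:
  "tdef f \<Longrightarrow> tdef g \<Longrightarrow> tdef (\<lambda>e. impc (f e) (g e))"
  "tdef f \<Longrightarrow> tdef (\<lambda>e. nextc (f e))"
  "tdef f \<Longrightarrow> tdef g \<Longrightarrow> tdef (\<lambda>e. untilc (f e) (g e))"
  unfolding impc_def nextc_def untilc_def by (intro tdef_intros tdef_cpair; assumption)+

lemma mod_4:
  assumes "4 * p + r = 4 * q + s" "r < 4" "s < (4::'a::discrete_semiring)"
  shows "r = s"
  using division_unique[of p 4 r q s] assms by (simp add: mult.commute)

context rca0_model
begin

lemma cpair_even: "\<exists>k. cpair x y = 2 * (k::'a)"
proof -
  have "\<exists>k. s * (s + 1) = 2 * (k::'a)" for s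
  proof (induction s rule: sdef_induct)
    case definable
    show ?case by (intro sdef_intros)
  next
    case (step s)
    then obtain k where k: "s * (s + 1) = 2 * k" ..
    have "(s + 1) * (s + 1 + 1) = s * (s + 1) + 2 * (s + 1)"
      by (simp add: algebra_simps one_add_one[symmetric] del: one_add_one)
    also have "\<dots> = 2 * (k + (s + 1))"
      unfolding k by (simp add: distrib_left)
    finally show ?case by blast
  qed (intro exI[of _ 0], simp)
  then obtain k where "(x + y) * (x + y + 1) = 2 * k" by blast
  then have "cpair x y = 2 * (k + x)"
    by (simp add: cpair_def distrib_left)
  then show ?thesis ..
qed

text \<open>As \<open>cpair\<close> is even, implications, next-formulas, until-formulas and
  variables have the residues 2, 3, 0 and 1 modulo 4; falsum shares the residue 0 but until-codes
  are positive.\<close>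

lemma codes_distinct [simp]:
  "impc p q \<noteq> nextc r" "nextc r \<noteq> impc p q"
  "impc p q \<noteq> untilc p' q'" "untilc p' q' \<noteq> impc p q"
  "nextc r \<noteq> untilc p' q'" "untilc p' q' \<noteq> nextc (r::'a)"
  "0 \<noteq> impc p q" "0 \<noteq> nextc r" "0 \<noteq> untilc p q"
  and prop_code_distinct [simp]: "4 * k + 1 \<noteq> impc p q" "4 * k + 1 \<noteq> nextc r" "4 * k + 1 \<noteq> untilc p q"
proof -
  have imp: "\<exists>k. impc p q = 4 * k + 2" for p q :: 'a
  proof -
    obtain k where "cpair p q = 2 * k" using cpair_even by blast
    then have "impc p q = 4 * k + 2" by (simp add: impc_def mult.assoc[symmetric])
    then show ?thesis ..
  qed
  have until: "\<exists>k. untilc p q = 4 * k + 0" for p q :: 'a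
  proof -
    obtain k where "cpair p q = 2 * k" using cpair_even by blast
    then have "untilc p q = 4 * (k + 1) + 0" by (simp add: untilc_def mult.assoc[symmetric] distrib_left)
    then show ?thesis ..
  qed
  have [simp]: "(0::'a) < 4" "(1::'a) < 4" "(2::'a) < 4" "(3::'a) < 4" by simp_all
  have *: "4 * k + r \<noteq> 4 * l + s" if "r < 4" "s < 4" "r \<noteq> s" for k l r s :: 'a
    using mod_4 that by blast
  show "impc p q \<noteq> nextc r" "nextc r \<noteq> impc p q"
    using imp[of p q] *[of 2 3] unfolding nextc_def by (auto simp: eq_commute)
  show "impc p q \<noteq> untilc p' q'" "untilc p' q' \<noteq> impc p q"
    using imp[of p q] until[of p' q'] *[of 2 0] by (metis numeral_neq_zero \<open>0 < 4\<close> \<open>2 < 4\<close>)+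
  show "nextc r \<noteq> untilc p' q'" "untilc p' q' \<noteq> nextc r"
    using until[of p' q'] *[of 3 0] unfolding nextc_def by (metis numeral_neq_zero \<open>0 < 4\<close> \<open>3 < 4\<close>)+
  show "0 \<noteq> impc p q" "0 \<noteq> nextc r" "0 \<noteq> untilc p q"
    by (simp_all add: impc_def nextc_def untilc_def)
  show "4 * k + 1 \<noteq> impc p q"
    using imp[of p q] *[of 1 2] by auto
  show "4 * k + 1 \<noteq> nextc r"
    using *[of 1 3] unfolding nextc_def by auto
  show "4 * k + 1 \<noteq> untilc p q"
    using until[of p q] *[of 1 0] by (metis one_neq_zero \<open>0 < 4\<close> \<open>1 < 4\<close>)
qed

end

section \<open>The truth predicate\<close>

text \<open>
  The local evaluation rules. \<open>T i p b\<close> says that \<open>p\<close> has already been found to have the value \<open>b\<close>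
  at \<open>i\<close>, and \<open>s n\<close> is the advice that the search for a decision about an until-formula may stop
  at \<open>n\<close> with the answer 0.
\<close>

definition evaluates ::
  "('a::discrete_semiring \<Rightarrow> 'a \<Rightarrow> bool) \<Rightarrow> ('a \<Rightarrow> 'a \<Rightarrow> 'a \<Rightarrow> bool) \<Rightarrow> ('a \<Rightarrow> bool) \<Rightarrow> 'a \<Rightarrow> 'a \<Rightarrow> 'a \<Rightarrow> bool" where
  "evaluates \<alpha> T s i p b \<longleftrightarrow>
      (\<exists>q r. p = impc q r \<and> ((T i q 0 \<or> T i r 1) \<and> b = 1 \<or> T i q 1 \<and> T i r 0 \<and> b = 0))
    \<or> (\<exists>q. p = nextc q \<and> T (i + 1) q b)
    \<or> (\<exists>q r. p = untilc q r \<and> (\<exists>n. i \<le> n \<and> (\<forall>j. i \<le> j \<and> j < n \<longrightarrow> T j q 1 \<and> T j r 0)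
        \<and> (T n r 1 \<and> b = 1 \<or> T n r 0 \<and> T n q 0 \<and> b = 0 \<or> s n \<and> b = 0)))
    \<or> ((\<forall>q r. p \<noteq> impc q r) \<and> (\<forall>q. p \<noteq> nextc q) \<and> (\<forall>q r. p \<noteq> untilc q r)
        \<and> (\<alpha> i p \<and> b = 1 \<or> \<not> \<alpha> i p \<and> b = 0))"

definition until_holds ::
  "('a::discrete_semiring \<Rightarrow> 'a \<Rightarrow> bool) \<Rightarrow> 'a \<Rightarrow> 'a \<Rightarrow> 'a \<Rightarrow> bool" where
  "until_holds t i q r \<longleftrightarrow> (\<exists>n. i \<le> n \<and> (\<forall>j. i \<le> j \<and> j < n \<longrightarrow> t j q) \<and> t n r)"

text \<open>The advice \<open>a\<close> is part of the entry, so that a single set holds the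
  evaluations for all advices.\<close>

definition entry :: "'a::discrete_semiring \<Rightarrow> 'a \<Rightarrow> 'a \<Rightarrow> 'a \<Rightarrow> 'a" where
  "entry a i p b = cpair (cpair a i) (cpair p b)"

lemma entry_inj [simp]: "entry a i p b = entry a' i' p' b' \<longleftrightarrow> a = a' \<and> i = i' \<and> p = p' \<and> b = b'"
  by (auto simp: entry_def)

lemma entry_mono: "i \<le> i' \<Longrightarrow> b \<le> b' \<Longrightarrow> entry a i p b \<le> entry a i' p b'"
  unfolding entry_def by (intro cpair_mono) simp_all

lemma tdef_entry: "tdef f \<Longrightarrow> tdef g \<Longrightarrow> tdef h \<Longrightarrow> tdef k \<Longrightarrow> tdef (\<lambda>e. entry (f e) (g e) (h e) (k e))"
  unfolding entry_def by (intro tdef_cpair)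

text \<open>The advice \<open>a\<close> is a finite set of pairs \<open>cpair p m\<close>: stop the search for \<open>p\<close> from \<open>m\<close> on.\<close>

definition stop :: "'a::discrete_semiring \<Rightarrow> 'a \<Rightarrow> 'a \<Rightarrow> bool" where
  "stop a p n \<longleftrightarrow> (\<exists>m\<le>n. Fin a (cpair p m))"

text \<open>\<open>T\<close> occurs only positively: that a formula is false is recorded as the
  positive fact that its value 0 has been found.\<close>

lemma evaluates_mono:
  assumes "evaluates \<alpha> T s i p b" "\<And>j q c. T j q c \<Longrightarrow> T' j q c"
  shows "evaluates \<alpha> T' s i p b"
  using assms(1) unfolding evaluates_def by (elim disjE) (blast dest: assms(2))+

text \<open>Rules consult only immediate subformulas, whose codes are smaller; this is what makes
  induction on codes determine the values.\<close>

lemma evaluates_smaller: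
  assumes "evaluates \<alpha> T s i p b"
  shows "evaluates \<alpha> (\<lambda>j q c. q < p \<and> T j q c) s i p b"
  using assms unfolding evaluates_def
proof (elim disjE, goal_cases)
  case 1
  then show ?case using less_impc by (intro disjI1) blast
next
  case 2
  then show ?case using less_nextc by (intro disjI2[OF disjI1]) blast
next
  case 3
  then obtain q r where *: "p = untilc q r \<and> (\<exists>n. i \<le> n \<and> (\<forall>j. i \<le> j \<and> j < n \<longrightarrow> T j q 1 \<and> T j r 0)
      \<and> (T n r 1 \<and> b = 1 \<or> T n r 0 \<and> T n q 0 \<and> b = 0 \<or> s n \<and> b = 0))"
    by (elim exE) (rule that)
  then have "q < p" "r < p" using less_untilc(1)[of q r] less_untilc(2)[of r q] by simp_all
  with * show ?case
    by (intro disjI2[OF disjI2[OF disjI1]] exI[of _ q] exI[of _ r]) simp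
qed blast

lemma evaluates_cong:
  assumes "\<And>j q c. q < p \<Longrightarrow> T j q c \<longleftrightarrow> T' j q c"
  shows "evaluates \<alpha> T s i p b \<longleftrightarrow> evaluates \<alpha> T' s i p b"
  using evaluates_mono[OF evaluates_smaller, of \<alpha> T s i p b T'] evaluates_mono[OF evaluates_smaller, of \<alpha> T' s i p b T] assms
  by blast

context rca0_model
begin

lemma evaluates_simps:
  "evaluates \<alpha> T s i (impc q r) (b::'a) \<longleftrightarrow>
    (T i q 0 \<or> T i r 1) \<and> b = 1 \<or> T i q 1 \<and> T i r 0 \<and> b = 0"
  "evaluates \<alpha> T s i (nextc q) b \<longleftrightarrow> T (i + 1) q b"
  "evaluates \<alpha> T s i (untilc q r) b \<longleftrightarrow> (\<exists>n. i \<le> n \<and> (\<forall>j. i \<le> j \<and> j < n \<longrightarrow> T j q 1 \<and> T j r 0)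
        \<and> (T n r 1 \<and> b = 1 \<or> T n r 0 \<and> T n q 0 \<and> b = 0 \<or> s n \<and> b = 0))"
  by (auto simp: evaluates_def)

lemma evaluates_atom:
  assumes "\<forall>q r. p \<noteq> impc q r" "\<forall>q. p \<noteq> nextc q" "\<forall>q r. p \<noteq> untilc q r"
  shows "evaluates \<alpha> T s i p b \<longleftrightarrow> \<alpha> i p \<and> b = 1 \<or> \<not> \<alpha> i p \<and> b = 0"
  using assms unfolding evaluates_def by (simp add: all_not_in_conv)

text \<open>A search ending at \<open>n\<close> looks at no place beyond \<open>n\<close>, and
  \<open>entry\<close> is monotone in place and value, so one bound covers all entries consulted.
  This is why the value 0 of an until-formula must come from a decision or from the advice.\<close>

lemma evaluates_finitary:
  assumes "evaluates \<alpha> (\<lambda>j q c. A (entry a j q c)) s i p b"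
  shows "\<exists>n. evaluates \<alpha> (\<lambda>j q c. entry a j q c < n \<and> A (entry a j q c)) s i p (b::'a)"
proof -
  consider q r where "p = impc q r" | q where "p = nextc q" | q r where "p = untilc q r"
    | "\<forall>q r. p \<noteq> impc q r" "\<forall>q. p \<noteq> nextc q" "\<forall>q r. p \<noteq> untilc q r"
    by blast
  then show ?thesis
  proof cases
    case 1
    let ?n = "entry a i q 1 + entry a i r 1 + 1"
    have "entry a i q c < ?n" "entry a i r c < ?n" if "c \<le> 1" for c
      using entry_mono[of i i c 1 a q] entry_mono[of i i c 1 a r] that
      by (simp_all add: add_increasing add_increasing2)
    from this[of 0] this[of 1] show ?thesis
      using assms unfolding 1 evaluates_simps by (intro exI[of _ ?n]) simp
  next
    case 2
    show ?thesis
      using assms unfolding 2 evaluates_simps by (intro exI[of _ "entry a (i + 1) q b + 1"]) simp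
  next
    case 3
    obtain n where n: "i \<le> n \<and> (\<forall>j. i \<le> j \<and> j < n \<longrightarrow> A (entry a j q 1) \<and> A (entry a j r 0))
      \<and> (A (entry a n r 1) \<and> b = 1 \<or> A (entry a n r 0) \<and> A (entry a n q 0) \<and> b = 0 \<or> s n \<and> b = 0)"
      using assms unfolding 3 evaluates_simps ..
    let ?n = "entry a n q 1 + entry a n r 1 + 1"
    have *: "entry a j q c < ?n" "entry a j r c < ?n" if "j \<le> n" "c \<le> 1" for j c
      using entry_mono[of j n c 1 a q] entry_mono[of j n c 1 a r] that
      by (simp_all add: add_increasing add_increasing2)
    show ?thesis
      unfolding 3 evaluates_simps
      by (rule exI[of _ ?n], rule exI[of _ n]) (use n *[of _ 0] *[of _ 1] in \<open>simp add: less_imp_le\<close>)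
  next
    case 4
    show ?thesis
      using assms unfolding evaluates_atom[OF 4] by simp
  qed
qed

end

section \<open>Evaluation relative to advice, and the existence of correct advice\<close>

locale ltl_model = aca0_model \<S> for \<S> :: "'a::discrete_semiring set set" +
  fixes \<alpha> :: "'a \<Rightarrow> 'a \<Rightarrow> bool"
  assumes \<alpha>: "bdef \<S> (\<lambda>e. \<alpha> (e 0) (e (Suc 0)))"
begin

lemma evaluation_exists:
  "\<exists>L\<in>\<S>. \<forall>a i p b. entry a i p b \<in> L \<longleftrightarrow> evaluates \<alpha> (\<lambda>j q c. entry a j q c \<in> L) (stop a p) i p b"
proof -
  define J where "J A x \<longleftrightarrow> (\<exists>a i p b. x = entry a i p b \<and> evaluates \<alpha> (\<lambda>j q c. A (entry a j q c)) (stop a p) i p b)" for A x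
  have "\<exists>L\<in>\<S>. \<forall>x. x \<in> L \<longleftrightarrow> J (\<lambda>y. y \<in> L) x"
  proof (rule finitary_fixpoint[of J])
    show "J B x" if "J A x" "\<And>y. A y \<Longrightarrow> B y" for A B x
    proof -
      obtain a i p b where *: "x = entry a i p b" "evaluates \<alpha> (\<lambda>j q c. A (entry a j q c)) (stop a p) i p b"
        using \<open>J A x\<close> unfolding J_def by (elim exE conjE)
      have "evaluates \<alpha> (\<lambda>j q c. B (entry a j q c)) (stop a p) i p b"
        by (rule evaluates_mono[OF *(2)]) (rule that(2))
      with *(1) show ?thesis unfolding J_def by (intro exI conjI)
    qed
    show "\<exists>n. J (\<lambda>y. y < n \<and> A y) x" if "J A x" for A x
    proof -
      obtain a i p b where *: "x = entry a i p b" "evaluates \<alpha> (\<lambda>j q c. A (entry a j q c)) (stop a p) i p b"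
        using \<open>J A x\<close> unfolding J_def by (elim exE conjE)
      obtain n where "evaluates \<alpha> (\<lambda>j q c. entry a j q c < n \<and> A (entry a j q c)) (stop a p) i p b"
        using evaluates_finitary[of \<alpha> A a, OF *(2)] ..
      with *(1) show ?thesis unfolding J_def by (intro exI conjI)
    qed
    show "bdef \<S> (\<lambda>e. J (Fin (e 0)) (e (Suc 0)))"
      unfolding J_def evaluates_def stop_def
      by (intro bdef_intros bdef_Fin tdef_entry tdef_codes bdef_rel2[OF \<alpha>])
  qed
  then obtain L where "L \<in> \<S>" and L: "\<And>x. x \<in> L \<longleftrightarrow> J (\<lambda>y. y \<in> L) x"
    by blast
  have "entry a i p b \<in> L \<longleftrightarrow> evaluates \<alpha> (\<lambda>j q c. entry a j q c \<in> L) (stop a p) i p b" for a i p b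
    unfolding L[of "entry a i p b"] by (simp add: J_def)
  with \<open>L \<in> \<S>\<close> show ?thesis by blast
qed

definition L :: "'a set" where
  "L = (SOME L. L \<in> \<S> \<and> (\<forall>a i p b. entry a i p b \<in> L \<longleftrightarrow> evaluates \<alpha> (\<lambda>j q c. entry a j q c \<in> L) (stop a p) i p b))"

definition T :: "'a \<Rightarrow> 'a \<Rightarrow> 'a \<Rightarrow> 'a \<Rightarrow> bool" where
  "T a i p b \<longleftrightarrow> entry a i p b \<in> L"

lemma L_mem: "L \<in> \<S>"
  and T_iff: "T a i p b \<longleftrightarrow> evaluates \<alpha> (T a) (stop a p) i p b"
proof -
  have "L \<in> \<S> \<and> (\<forall>a i p b. entry a i p b \<in> L \<longleftrightarrow> evaluates \<alpha> (\<lambda>j q c. entry a j q c \<in> L) (stop a p) i p b)"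
    unfolding L_def by (rule someI_ex) (use evaluation_exists in blast)
  then show "L \<in> \<S>" "T a i p b \<longleftrightarrow> evaluates \<alpha> (T a) (stop a p) i p b"
    unfolding T_def by blast+
qed

lemma bdef_T:
  "tdef f \<Longrightarrow> tdef g \<Longrightarrow> tdef h \<Longrightarrow> tdef k \<Longrightarrow> bdef \<S> (\<lambda>e. T (f e) (g e) (h e) (k e))"
  unfolding T_def by (intro bdef_mem tdef_entry L_mem)

text \<open>Correctness of the advice for codes below \<open>P\<close>. Besides bivalence only the
  until clause has to be demanded; the other clauses follow from bivalence and the evaluation
  rules.\<close>

definition good :: "'a \<Rightarrow> 'a \<Rightarrow> bool" where
  "good a P \<longleftrightarrow> (\<forall>p<P. \<forall>i. (T a i p 0 \<longleftrightarrow> \<not> T a i p 1)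
    \<and> (\<forall>q r. p = untilc q r \<longrightarrow> (T a i p 1 \<longleftrightarrow> until_holds (\<lambda>j q. T a j q 1) i q r)))"

lemma bdef_good: "tdef f \<Longrightarrow> tdef g \<Longrightarrow> bdef \<S> (\<lambda>e. good (f e) (g e))"
proof -
  assume fg: "tdef f" "tdef g"
  have "bdef \<S> (\<lambda>e. good (e 0) (e (Suc 0)))"
    unfolding good_def until_holds_def by (intro bdef_intros bdef_T tdef_codes)
  from bdef_rel2[OF this fg] show ?thesis .
qed

lemma stop_update: "\<exists>a'. \<forall>p n. stop a' p n \<longleftrightarrow> (if p = (P::'a) then c \<and> m \<le> n else stop a p n)"
proof -
  \<comment> \<open>All earlier advice about \<open>P\<close> is discarded, and the pair of
    \<open>P\<close> and \<open>m\<close> is put in exactly if \<open>c\<close> holds.\<close>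
  define X where "X = {z. Fin a z \<and> \<not> (\<exists>m\<le>z. z = cpair P m) \<or> c \<and> z = cpair P m}"
  have "X \<in> \<S>"
    unfolding X_def by (rule comprehension) (intro bdef_intros bdef_Fin)
  then obtain a' where "\<forall>z. Fin a' z \<longleftrightarrow> z < a + cpair P m + 1 \<and> z \<in> X"
    using Fin_code by blast
  moreover have "z < a + cpair P m + 1" if "z \<in> X" for z
    using that unfolding X_def by (auto simp: add_increasing add_increasing2 dest!: Fin_less)
  ultimately have *: "Fin a' z \<longleftrightarrow> z \<in> X" for z by blast
  have "stop a' p n \<longleftrightarrow> (if p = P then c \<and> m \<le> n else stop a p n)" for p n
    unfolding stop_def * X_def using le_cpair2[of _ P] by auto
  then show ?thesis by blast
qed

text \<open>Values are determined by the rules and the advice on smaller or equal codes, although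
  the fixed point was not chosen to be least. Hence changing the advice at \<open>P\<close> keeps
  what is known below \<open>P\<close>.\<close>

lemma T_agree:
  assumes "\<And>p n. p < P \<Longrightarrow> stop a' p n \<longleftrightarrow> stop a p n" "p < P"
  shows "T a' i p b \<longleftrightarrow> T a i p b"
proof -
  have "p < P \<longrightarrow> (\<forall>i b. T a' i p b \<longleftrightarrow> T a i p b)" for p
  proof (induction p rule: bdef_less_induct)
    case definable
    show ?case by (intro bdef_intros bdef_T)
  next
    case (less p)
    show ?case
    proof (intro impI allI)
      fix i b assume "p < P"
      then have "stop a' p = stop a p" using assms(1) by blast
      moreover have "T a' j q c \<longleftrightarrow> T a j q c" if "q < p" for j q c
        using less that \<open>p < P\<close> by (meson less_trans)
      ultimately show "T a' i p b \<longleftrightarrow> T a i p b"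
        unfolding T_iff[of _ _ p] using evaluates_cong[of p "T a'" "T a"] by simp
    qed
  qed
  with assms(2) show ?thesis by blast
qed

lemma good_step:
  assumes "good a P"
  shows "\<exists>a'. good a' (P + 1)"
proof -
  text \<open>
    If the until-formula \<open>P\<close> is undecided from some place \<open>m\<close> on, then it is false there, and \<open>m\<close>
    is added to the advice; otherwise every search for a decision succeeds.
  \<close>
  define decided where "decided n \<longleftrightarrow> (\<exists>q r. P = untilc q r \<and> (T a n r 1 \<or> T a n q 0))" for n
  \<comment> \<open>The non-effective step: whether decisions occur beyond every bound, and from
    where on they are absent, is settled by classical cases. The truth value \<open>c\<close>
    records which case holds.\<close>
  obtain c m where cm: "c \<Longrightarrow> \<forall>n\<ge>m. \<not> decided n" "\<not> c \<Longrightarrow> \<forall>m. \<exists>n\<ge>m. decided n"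
    by blast
  obtain a' where a': "\<And>p n. stop a' p n \<longleftrightarrow> (if p = P then c \<and> m \<le> n else stop a p n)"
    using stop_update by metis
  have agree: "T a' i p b \<longleftrightarrow> T a i p b" if "p < P" for i p b
    by (rule T_agree[of P]) (use a' that in auto)
  have biv: "T a i p 0 \<longleftrightarrow> \<not> T a i p 1" if "p < P" for i p
    using assms that unfolding good_def by blast
  have ev: "T a' i P b \<longleftrightarrow> evaluates \<alpha> (T a) (\<lambda>n. c \<and> m \<le> n) i P b" for i b
  proof -
    have stop: "stop a' P = (\<lambda>n. c \<and> m \<le> n)" using a' by auto
    have "T a' i P b \<longleftrightarrow> evaluates \<alpha> (T a') (stop a' P) i P b"
      by (rule T_iff)
    also have "\<dots> \<longleftrightarrow> evaluates \<alpha> (T a) (stop a' P) i P b"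
      by (rule evaluates_cong) (rule agree)
    finally show ?thesis
      unfolding stop .
  qed
  have "(T a' i P 0 \<longleftrightarrow> \<not> T a' i P 1)
    \<and> (\<forall>q r. P = untilc q r \<longrightarrow> (T a' i P 1 \<longleftrightarrow> until_holds (\<lambda>j q. T a' j q 1) i q r))" for i
  proof -
    consider q r where "P = impc q r" | q where "P = nextc q" | q r where "P = untilc q r"
      | "\<forall>q r. P \<noteq> impc q r" "\<forall>q. P \<noteq> nextc q" "\<forall>q r. P \<noteq> untilc q r"
      by blast
    then show ?thesis
    proof cases
      case 1
      then show ?thesis
        using biv[of q i] biv[of r i] less_impc(1)[of q r] less_impc(2)[of r q] unfolding ev by (auto simp: evaluates_simps)
    next
      case 2
      then show ?thesis
        using biv[of q "i + 1"] less_nextc[of q] unfolding ev by (simp add: evaluates_simps)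
    next
      case 4
      then show ?thesis unfolding ev evaluates_atom[OF 4] by simp
    next
      case 3
      have qr: "q < P" "r < P" using less_untilc 3 by blast+
      have dec: "decided n \<longleftrightarrow> T a n r 1 \<or> \<not> T a n q 1" for n
        using biv[OF qr(1)] unfolding decided_def 3 by auto
      \<comment> \<open>By bivalence of \<open>q\<close> and \<open>r\<close>, going on past a place
        (\<open>q\<close> true, \<open>r\<close> false) means that the place is undecided.\<close>
      have ev': "T a' i P b \<longleftrightarrow> (\<exists>n. i \<le> n \<and> (\<forall>j. i \<le> j \<and> j < n \<longrightarrow> \<not> decided j)
        \<and> (T a n r 1 \<and> b = 1 \<or> \<not> T a n r 1 \<and> \<not> T a n q 1 \<and> b = 0 \<or> c \<and> m \<le> n \<and> b = 0))" for b
        unfolding ev unfolding 3 evaluates_simps using biv[OF qr(1)] biv[OF qr(2)] dec by auto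
      have true: "until_holds (\<lambda>j q. T a j q 1) i q r" if "T a' i P 1"
        using that unfolding ev' until_holds_def dec by auto
      have false: "\<not> until_holds (\<lambda>j q. T a j q 1) i q r" if "T a' i P 0"
      proof
        assume "until_holds (\<lambda>j q. T a j q 1) i q r"
        then obtain k where k: "i \<le> k" "\<forall>j. i \<le> j \<and> j < k \<longrightarrow> T a j q 1" "T a k r 1"
          unfolding until_holds_def by blast
        obtain n where n: "i \<le> n" "\<forall>j. i \<le> j \<and> j < n \<longrightarrow> \<not> decided j"
          "\<not> T a n r 1 \<and> \<not> T a n q 1 \<or> c \<and> m \<le> n"
          using \<open>T a' i P 0\<close> unfolding ev' by auto
        \<comment> \<open>The place \<open>k\<close> is decided because \<open>r\<close> is true
          there, so the search cannot have passed it.\<close>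
        have "n \<le> k"
          using n(2) k(1,3) unfolding dec by (meson not_less)
        then consider "n = k" | "n < k" by (auto simp: le_less)
        then show False
        proof cases
          case 1
          then show False using n(3) k(3) cm(1) dec by auto
        next
          case 2
          then have "T a n q 1" using k(2) n(1) by blast
          with n(3) have "c" "m \<le> k" using \<open>n \<le> k\<close> by auto
          then show False using cm(1) k(3) dec by blast
        qed
      qed
      have some: "T a' i P 0 \<or> T a' i P 1"
      proof (cases "\<exists>n. i \<le> n \<and> decided n")
        case True
        then obtain n where "i \<le> n \<and> decided n" ..
        moreover have "bdef \<S> (\<lambda>e. i \<le> e 0 \<and> decided (e 0))"
          unfolding decided_def by (intro bdef_intros bdef_T tdef_codes)
        ultimately obtain n where n: "i \<le> n" "decided n" "\<forall>j<n. \<not> (i \<le> j \<and> decided j)"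
          using bdef_least[of "\<lambda>n. i \<le> n \<and> decided n" n] by blast
        then show ?thesis unfolding ev' dec by blast
      next
        case False
        then have "c" using cm(2) by blast
        \<comment> \<open>The search stops with the value 0 at the larger of \<open>i\<close> and
          \<open>m\<close>: no place from \<open>i\<close> on is decided, and from \<open>m\<close>
          on the advice permits stopping.\<close>
        with False show ?thesis
          unfolding ev' by (meson max.cobounded1 max.cobounded2)
      qed
      have "until_holds (\<lambda>j q. T a' j q 1) i q r \<longleftrightarrow> until_holds (\<lambda>j q. T a j q 1) i q r"
        unfolding until_holds_def agree[OF qr(1)] agree[OF qr(2)] ..
      with true false some show ?thesis unfolding 3 by auto
    qed
  qed
  moreover have "(T a' i p 0 \<longleftrightarrow> \<not> T a' i p 1)
    \<and> (\<forall>q r. p = untilc q r \<longrightarrow> (T a' i p 1 \<longleftrightarrow> until_holds (\<lambda>j q. T a' j q 1) i q r))" if "p < P" for i p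
  proof -
    have "until_holds (\<lambda>j q. T a' j q 1) i q r \<longleftrightarrow> until_holds (\<lambda>j q. T a j q 1) i q r" if "p = untilc q r" for q r
    proof -
      have "q < P" "r < P"
        using \<open>p < P\<close> less_trans less_untilc unfolding that by metis+
      then show ?thesis
        unfolding until_holds_def by (simp add: agree)
    qed
    moreover have "(T a i p 0 \<longleftrightarrow> \<not> T a i p 1)
      \<and> (\<forall>q r. p = untilc q r \<longrightarrow> (T a i p 1 \<longleftrightarrow> until_holds (\<lambda>j q. T a j q 1) i q r))"
      using assms \<open>p < P\<close> unfolding good_def by simp
    ultimately show ?thesis
      unfolding agree[OF \<open>p < P\<close>] by simp
  qed
  ultimately have "good a' (P + 1)"
    unfolding good_def by (auto simp: le_less)
  then show ?thesis ..
qed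

text \<open>The induction predicate quantifies over all places and over all searches, so induction
  for arithmetical predicates is what makes this possible.\<close>

lemma good_exists: "\<exists>a. good a P"
proof (induction P rule: bdef_induct)
  case definable
  show ?case by (intro bdef_intros bdef_good)
next
  case 0
  show ?case unfolding good_def by simp
qed (use good_step in blast)

lemma good_antimono: "good a P \<Longrightarrow> P' \<le> P \<Longrightarrow> good a P'"
proof -
  assume "good a P" "P' \<le> P"
  then have "p < P" if "p < P'" for p
    using that by simp
  with \<open>good a P\<close> show ?thesis
    unfolding good_def by blast
qed

lemma good_clauses:
  assumes "good a P" "p < P"
  shows "p = impc q r \<Longrightarrow> T a i p 1 \<longleftrightarrow> (T a i q 1 \<longrightarrow> T a i r 1)"
    and "p = nextc q \<Longrightarrow> T a i p 1 \<longleftrightarrow> T a (i + 1) q 1"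
    and "p = untilc q r \<Longrightarrow> T a i p 1 \<longleftrightarrow> until_holds (\<lambda>j q. T a j q 1) i q r"
    and "\<forall>q r. p \<noteq> impc q r \<Longrightarrow> \<forall>q. p \<noteq> nextc q \<Longrightarrow> \<forall>q r. p \<noteq> untilc q r \<Longrightarrow> T a i p 1 \<longleftrightarrow> \<alpha> i p"
proof -
  show "T a i p 1 \<longleftrightarrow> (T a i q 1 \<longrightarrow> T a i r 1)" if "p = impc q r"
  proof -
    have "q < P" using that less_impc(1)[of q r] assms(2) by (simp add: less_trans)
    then have "T a i q 0 \<longleftrightarrow> \<not> T a i q 1"
      using assms(1) unfolding good_def by blast
    then show ?thesis
      unfolding T_iff[of a i p] unfolding that evaluates_simps by auto
  qed
  show "T a i p 1 \<longleftrightarrow> T a (i + 1) q 1" if "p = nextc q"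
    unfolding T_iff[of a i p] unfolding that evaluates_simps ..
  show "T a i p 1 \<longleftrightarrow> until_holds (\<lambda>j q. T a j q 1) i q r" if "p = untilc q r"
    using assms that unfolding good_def by blast
  show "T a i p 1 \<longleftrightarrow> \<alpha> i p" if "\<forall>q r. p \<noteq> impc q r" "\<forall>q. p \<noteq> nextc q" "\<forall>q r. p \<noteq> untilc q r"
    unfolding T_iff[of a i p] evaluates_atom[OF that] by simp
qed

text \<open>Correct advices may differ, but correctness forces the semantic clauses, and these
  determine the truth values by induction on the code.\<close>

lemma good_unique:
  assumes "good a P" "good a' P'" "p < P" "p < P'"
  shows "T a i p 1 \<longleftrightarrow> T a' i p 1"
proof -
  have "p < P \<longrightarrow> p < P' \<longrightarrow> (\<forall>i. T a i p 1 \<longleftrightarrow> T a' i p 1)" for p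
  proof (induction p rule: bdef_less_induct)
    case definable
    show ?case by (intro bdef_intros bdef_T)
  next
    case (less p)
    show ?case
    proof (intro impI allI)
      fix i assume p: "p < P" "p < P'"
      have IH: "T a i q 1 \<longleftrightarrow> T a' i q 1" if "q < p" for q i
        using less that p by (meson less_trans)
      consider q r where "p = impc q r" | q where "p = nextc q" | q r where "p = untilc q r"
        | "\<forall>q r. p \<noteq> impc q r" "\<forall>q. p \<noteq> nextc q" "\<forall>q r. p \<noteq> untilc q r"
        by blast
      then show "T a i p 1 \<longleftrightarrow> T a' i p 1"
      proof cases
        case 1
        then have "q < p" "r < p" using less_impc by blast+
        then show ?thesis
          using good_clauses(1)[OF assms(1) p(1) 1] good_clauses(1)[OF assms(2) p(2) 1] IH by simp
      next
        case 2
        then have "q < p" using less_nextc by blast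
        then show ?thesis
          using good_clauses(2)[OF assms(1) p(1) 2] good_clauses(2)[OF assms(2) p(2) 2] IH by simp
      next
        case 3
        then have "q < p" "r < p" using less_untilc by blast+
        then show ?thesis
          using good_clauses(3)[OF assms(1) p(1) 3] good_clauses(3)[OF assms(2) p(2) 3] IH
          unfolding until_holds_def by simp
      next
        case 4
        then show ?thesis
          using good_clauses(4)[OF assms(1) p(1) 4] good_clauses(4)[OF assms(2) p(2) 4] by simp
      qed
    qed
  qed
  with assms(3,4) show ?thesis by blast
qed

text \<open>The bound is \<open>p + 1\<close> because \<open>good a P\<close> speaks only of codes
  below \<open>P\<close>.\<close>

definition holds :: "'a \<Rightarrow> 'a \<Rightarrow> bool" where
  "holds i p \<longleftrightarrow> (\<exists>a. good a (p + 1) \<and> T a i p 1)"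

lemma bdef_holds: "bdef \<S> (\<lambda>e. holds (e 0) (e (Suc 0)))"
  unfolding holds_def by (intro bdef_intros bdef_good bdef_T)

lemma holds_iff:
  assumes "good a P" "p < P"
  shows "holds i p \<longleftrightarrow> T a i p 1"
proof -
  have a: "good a (p + 1)" using good_antimono[OF assms(1)] assms(2) by simp
  have "T a' i p 1 \<longleftrightarrow> T a i p 1" if "good a' (p + 1)" for a'
    by (rule good_unique[OF that a]) simp_all
  with a show ?thesis
    unfolding holds_def by blast
qed

text \<open>One advice that is good for the compound code is good for its parts as well, and
  \<open>holds_iff\<close> lets it compute \<open>holds\<close> for all of them.\<close>

lemma holds_impc: "holds i (impc q r) \<longleftrightarrow> (holds i q \<longrightarrow> holds i r)"
  and holds_nextc: "holds i (nextc q) \<longleftrightarrow> holds (i + 1) q"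
  and holds_untilc: "holds i (untilc q r) \<longleftrightarrow> until_holds holds i q r"
  and holds_atom: "\<forall>q r. p \<noteq> impc q r \<Longrightarrow> \<forall>q. p \<noteq> nextc q \<Longrightarrow> \<forall>q r. p \<noteq> untilc q r \<Longrightarrow> holds i p \<longleftrightarrow> \<alpha> i p"
proof -
  have lt: "p < p + 1" for p :: 'a by simp
  show "holds i (impc q r) \<longleftrightarrow> (holds i q \<longrightarrow> holds i r)"
  proof -
    obtain a where a: "good a (impc q r + 1)" using good_exists by blast
    show ?thesis
      using good_clauses(1)[OF a lt refl] holds_iff[OF a] less_impc(1)[of q r] less_impc(2)[of r q] by (simp add: less_imp_le)
  qed
  show "holds i (nextc q) \<longleftrightarrow> holds (i + 1) q"
  proof -
    obtain a where a: "good a (nextc q + 1)" using good_exists by blast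
    show ?thesis
      using good_clauses(2)[OF a lt refl] holds_iff[OF a] less_nextc[of q] by (simp add: less_imp_le)
  qed
  show "holds i (untilc q r) \<longleftrightarrow> until_holds holds i q r"
  proof -
    obtain a where a: "good a (untilc q r + 1)" using good_exists by blast
    show ?thesis
      using good_clauses(3)[OF a lt refl] holds_iff[OF a] less_untilc(1)[of q r] less_untilc(2)[of r q]
      by (simp add: less_imp_le until_holds_def)
  qed
  show "holds i p \<longleftrightarrow> \<alpha> i p" if "\<forall>q r. p \<noteq> impc q r" "\<forall>q. p \<noteq> nextc q" "\<forall>q r. p \<noteq> untilc q r"
  proof -
    obtain a where a: "good a (p + 1)" using good_exists by blast
    show ?thesis
      using good_clauses(4)[OF a lt that] holds_iff[OF a] by simp
  qed
qed

end

section \<open>Valuations\<close>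

lemma ev_codes [simp]:
  "ev e bot_code = (0::'a::discrete_semiring)"
  "ev e (prop_code t) = (4 * ev e t + 1 :: 'a)"
  "ev e (imp_code t u) = (impc (ev e t) (ev e u) :: 'a)"
  "ev e (next_code t) = (nextc (ev e t) :: 'a)"
  "ev e (until_code t u) = (untilc (ev e t) (ev e u) :: 'a)"
  by (simp_all add: bot_code_def prop_code_def imp_code_def next_code_def until_code_def
      impc_def nextc_def untilc_def)

definition Val :: "'a::discrete_semiring set \<Rightarrow> 'a set \<Rightarrow> 'a \<Rightarrow> 'a \<Rightarrow> 'a \<Rightarrow> bool" where
  "Val V s i p b \<longleftrightarrow> (\<exists>w. cpair i w \<in> s \<and> cpair (cpair w p) b \<in> V)"

lemma sat_val [simp]:
  "sat \<S> e E (val V s i p b) \<longleftrightarrow> Val (E V) (E s) (ev e i) (ev e p) (ev e b :: 'a::discrete_semiring)"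
  by (simp add: val_def Val_def)

lemma sat_classes [simp]:
  "sat \<S> e E (Numbers t)" "sat \<S> e E (Fml t)"
  "sat \<S> e E (Bits t) \<longleftrightarrow> ev e t = 0 \<or> ev e t = 1"
  "sat \<S> e E (Elements X t) \<longleftrightarrow> ev e t \<in> E X"
  "sat \<S> e E (Prop t) \<longleftrightarrow> (\<exists>k. ev e t = 4 * k + (1 :: 'a::discrete_semiring))"
  by (auto simp: Numbers_def Fml_def Bits_def Elements_def Prop_def)

lemma sat_le [simp]: "sat \<S> e E (t \<^bold>\<le> u) \<longleftrightarrow> ev e t \<le> (ev e u :: 'a::discrete_semiring)"
  by (auto simp: le_def le_less)

lemma sat_is_function [simp]:
  "sat \<S> e E (is_function F A B) \<longleftrightarrow> sat \<S> e E (included F (product A B))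
    \<and> (\<forall>x y z :: 'a::discrete_semiring. cpair x y \<in> E F \<longrightarrow> cpair x z \<in> E F \<longrightarrow> y = z)
    \<and> (\<forall>x. sat \<S> (case_nat x e) E (A (Var 0)) \<longrightarrow> (\<exists>y. cpair x y \<in> E F))"
  by (simp add: is_function_def eval_nat_numeral)

lemma sat_is_frame:
  assumes "sat \<S> e E (is_frame S R s)"
  shows "\<exists>w. cpair i w \<in> E s"
    and "cpair i w \<in> E s \<Longrightarrow> w \<in> E S"
    and "cpair i w \<in> E s \<Longrightarrow> cpair i w' \<in> E s \<Longrightarrow> w = w'"
    and "w \<in> E S \<Longrightarrow> \<exists>i. cpair i w \<in> E s"
    and "cpair i w \<in> E s \<Longrightarrow> cpair j w \<in> E s \<Longrightarrow> i = (j::'a::discrete_semiring)"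
proof -
  have F: "\<forall>z. z \<in> E s \<longrightarrow> (\<exists>i w. z = cpair i w \<and> w \<in> E S)"
    "\<forall>x y z. cpair x y \<in> E s \<longrightarrow> cpair x z \<in> E s \<longrightarrow> y = z" "\<forall>x. \<exists>y. cpair x y \<in> E s"
    "\<forall>w. w \<in> E S \<longrightarrow> (\<exists>i. cpair i w \<in> E s)"
    "\<forall>x y. (\<forall>z. cpair x z \<in> E s \<longrightarrow> cpair y z \<notin> E s) \<or> x = y"
    using assms by (simp_all add: is_frame_def included_def product_def Let_def eval_nat_numeral)
  show "\<exists>w. cpair i w \<in> E s"
    using F(3) ..
  show "w \<in> E S" if "cpair i w \<in> E s"
    using F(1)[rule_format, OF that] by auto
  show "w = w'" if "cpair i w \<in> E s" "cpair i w' \<in> E s"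
    using F(2) that by blast
  show "\<exists>i. cpair i w \<in> E s" if "w \<in> E S"
    using F(4) that by blast
  show "i = j" if "cpair i w \<in> E s" "cpair j w \<in> E s"
    using F(5) that by blast
qed

lemma sat_is_valuation:
  "sat \<S> e E (is_valuation V S s) \<longleftrightarrow>
    sat \<S> e E (is_function V (product (Elements S) Fml) Bits)
    \<and> (\<forall>i. Val (E V) (E s) i 0 0)
    \<and> (\<forall>i p q a b c d. Val (E V) (E s) i p a \<longrightarrow> Val (E V) (E s) i q b \<longrightarrow> Val (E V) (E s) i (impc p q) c
        \<longrightarrow> d + b = 1 \<longrightarrow> c + a * d = 1)
    \<and> (\<forall>i p. Val (E V) (E s) i (nextc p) 1 \<longleftrightarrow> Val (E V) (E s) (i + 1) p 1)
    \<and> (\<forall>i p q. Val (E V) (E s) i (untilc p q) 1 \<longleftrightarrow> until_holds (\<lambda>j q. Val (E V) (E s) j q (1::'a::discrete_semiring)) i p q)"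
  unfolding is_valuation_def until_holds_def
  by (simp add: Let_def eval_nat_numeral del: sat_is_function) (intro conj_cong iff_allI refl; blast)

context aca0_model
begin

lemma valuation_extends:
  assumes sets: "s \<in> \<S>" "v \<in> \<S>"
    and frame: "\<And>i. \<exists>w. cpair i w \<in> s" "\<And>i w. cpair i w \<in> s \<Longrightarrow> w \<in> S"
      "\<And>i w w'. cpair i w \<in> s \<Longrightarrow> cpair i w' \<in> s \<Longrightarrow> w = w'"
      "\<And>w. w \<in> S \<Longrightarrow> \<exists>i. cpair i w \<in> s" "\<And>i j w. cpair i w \<in> s \<Longrightarrow> cpair j w \<in> s \<Longrightarrow> i = j"
    and v: "\<And>z. z \<in> v \<Longrightarrow> \<exists>w k b. z = cpair (cpair w (4 * k + 1)) b \<and> w \<in> S \<and> (b = 0 \<or> b = 1)"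
      "\<And>x b b'. cpair x b \<in> v \<Longrightarrow> cpair x b' \<in> v \<Longrightarrow> b = b'"
  obtains V where "V \<in> \<S>" "v \<subseteq> V"
    "\<And>z. z \<in> V \<Longrightarrow> \<exists>w p b. z = cpair (cpair w p) b \<and> w \<in> S \<and> (b = 0 \<or> b = 1)"
    "\<And>x b b'. cpair x b \<in> V \<Longrightarrow> cpair x b' \<in> V \<Longrightarrow> b = b'"
    "\<And>w p. w \<in> S \<Longrightarrow> \<exists>b. cpair (cpair w p) b \<in> V"
    "\<And>i. Val V s i 0 0"
    "\<And>i p q a b c d. Val V s i p a \<Longrightarrow> Val V s i q b \<Longrightarrow> Val V s i (impc p q) c \<Longrightarrow> d + b = 1 \<Longrightarrow> c + a * d = 1"
    "\<And>i p. Val V s i (nextc p) 1 \<longleftrightarrow> Val V s (i + 1) p 1"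
    "\<And>i p q. Val V s i (untilc p q) 1 \<longleftrightarrow> until_holds (\<lambda>j q. Val V s j q 1) i p q"
proof -
  \<comment> \<open>Carries \<open>v\<close> from worlds to indices. A code at which
    \<open>v\<close> is undefined becomes false.\<close>
  define \<alpha> where "\<alpha> i p \<longleftrightarrow> (\<exists>w. cpair i w \<in> s \<and> cpair (cpair w p) 1 \<in> v)" for i p
  interpret ltl_model \<S> \<alpha>
    by unfold_locales (unfold \<alpha>_def, intro bdef_intros sets)
  define V where "V = {z. \<exists>i w p. cpair i w \<in> s \<and> (z = cpair (cpair w p) 1 \<and> holds i p \<or> z = cpair (cpair w p) 0 \<and> \<not> holds i p)}"
  have V: "V \<in> \<S>"
    unfolding V_def by (rule comprehension) (intro bdef_intros sets bdef_rel2[OF bdef_holds])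
  \<comment> \<open>A world has only one index, so membership in \<open>V\<close> may be evaluated
    at any given \<open>i\<close> with \<open>cpair i w \<in> s\<close>.\<close>
  have mem_V: "cpair (cpair w p) b \<in> V \<longleftrightarrow> (b = 1 \<and> holds i p \<or> b = 0 \<and> \<not> holds i p)" if "cpair i w \<in> s" for i w p b
    unfolding V_def using that frame(5) by auto
  have Val: "Val V s i p b \<longleftrightarrow> (b = 1 \<and> holds i p \<or> b = 0 \<and> \<not> holds i p)" for i p b
    unfolding Val_def using mem_V frame(1)[of i] by blast
  have atom: "holds i (4 * k + 1) \<longleftrightarrow> \<alpha> i (4 * k + 1)" for i k
    by (rule holds_atom) simp_all
  have bot: "\<not> holds i 0" for i
  proof -
    have "holds i 0 \<longleftrightarrow> \<alpha> i 0"
      by (rule holds_atom) simp_all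
    \<comment> \<open>Falsum is evaluated as an atom; it comes out false because 0 is not of the
      form \<open>4 * k + 1\<close>.\<close>
    moreover have "cpair (cpair w 0) 1 \<notin> v" for w
    proof
      assume "cpair (cpair w 0) 1 \<in> v"
      from v(1)[OF this] show False by auto
    qed
    ultimately show ?thesis
      unfolding \<alpha>_def by blast
  qed
  show ?thesis
  proof (rule that[OF V])
    show "v \<subseteq> V"
    proof
      fix z assume z: "z \<in> v"
      then obtain w k b where w: "z = cpair (cpair w (4 * k + 1)) b" "w \<in> S" "b = 0 \<or> b = 1"
        using v(1) by blast
      obtain i where i: "cpair i w \<in> s" using frame(4)[OF w(2)] ..
      have "\<alpha> i (4 * k + 1) \<longleftrightarrow> b = 1"
      proof
        assume "\<alpha> i (4 * k + 1)"
        then obtain w' where "cpair i w' \<in> s" "cpair (cpair w' (4 * k + 1)) 1 \<in> v"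
          unfolding \<alpha>_def by blast
        then show "b = 1"
          using frame(3)[OF i, of w'] z w(1) v(2) by blast
      qed (use i z w(1) in \<open>auto simp: \<alpha>_def\<close>)
      then show "z \<in> V"
        using w(3) unfolding w(1) mem_V[OF i] atom by auto
    qed
    show "\<exists>w p b. z = cpair (cpair w p) b \<and> w \<in> S \<and> (b = 0 \<or> b = 1)" if "z \<in> V" for z
      using that frame(2) unfolding V_def by blast
    show "b = b'" if b: "cpair x b \<in> V" "cpair x b' \<in> V" for x b b'
    proof -
      obtain i w p where "cpair i w \<in> s" "x = cpair w p"
        using b(1) unfolding V_def by auto
      then show ?thesis using b mem_V[of i w] by auto
    qed
    show "\<exists>b. cpair (cpair w p) b \<in> V" if "w \<in> S" for w p
      using frame(4)[OF that] mem_V by blast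
    show "Val V s i 0 0" for i
      unfolding Val using bot by simp
    show "c + a * d = 1" if "Val V s i p a" "Val V s i q b" "Val V s i (impc p q) c" "d + b = 1" for i p q a b c d
      using that unfolding Val holds_impc by auto
    show "Val V s i (nextc p) 1 \<longleftrightarrow> Val V s (i + 1) p 1" for i p
      unfolding Val holds_nextc ..
    show "Val V s i (untilc p q) 1 \<longleftrightarrow> until_holds (\<lambda>j q. Val V s j q 1) i p q" for i p q
      unfolding Val holds_untilc by simp
  qed
qed

lemma valid_valuation_extension_lemma: "valid \<S> valuation_extension_lemma"
proof -
  have "\<exists>V\<in>\<S>. sat \<S> e (case_nat V (case_nat v (case_nat s (case_nat R (case_nat S E))))) (is_valuation 0 4 2 \<^bold>\<and> included 1 (Elements 0))"
    if sets: "s \<in> \<S>" "v \<in> \<S>"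
      and frame: "sat \<S> e (case_nat v (case_nat s (case_nat R (case_nat S E)))) (is_frame 3 2 1)"
      and v: "sat \<S> e (case_nat v (case_nat s (case_nat R (case_nat S E)))) (is_function 0 (product (Elements 3) Prop) Bits)"
    for e E S R s v
  proof -
    note frame' = sat_is_frame[OF frame, simplified, unfolded eval_nat_numeral, simplified]
    have v1: "\<exists>w k b. z = cpair (cpair w (4 * k + 1)) b \<and> w \<in> S \<and> (b = 0 \<or> b = 1)" if "z \<in> v" for z
      using v that by (simp add: included_def product_def eval_nat_numeral) blast
    have v2: "b = b'" if "cpair x b \<in> v" "cpair x b' \<in> v" for x b b'
      using v that by simp
    show ?thesis
    proof (rule valuation_extends[OF sets frame' v1 v2])
    fix V assume V: "V \<in> \<S>" "v \<subseteq> V"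
      "\<And>z. z \<in> V \<Longrightarrow> \<exists>w p b. z = cpair (cpair w p) b \<and> w \<in> S \<and> (b = 0 \<or> b = 1)"
      "\<And>x b b'. cpair x b \<in> V \<Longrightarrow> cpair x b' \<in> V \<Longrightarrow> b = b'"
      "\<And>w p. w \<in> S \<Longrightarrow> \<exists>b. cpair (cpair w p) b \<in> V"
      "\<And>i. Val V s i 0 0"
      "\<And>i p q a b c d. Val V s i p a \<Longrightarrow> Val V s i q b \<Longrightarrow> Val V s i (impc p q) c \<Longrightarrow> d + b = 1 \<Longrightarrow> c + a * d = 1"
      "\<And>i p. Val V s i (nextc p) 1 \<longleftrightarrow> Val V s (i + 1) p 1"
      "\<And>i p q. Val V s i (untilc p q) 1 \<longleftrightarrow> until_holds (\<lambda>j q. Val V s j q 1) i p q"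
    let ?E = "case_nat V (case_nat v (case_nat s (case_nat R (case_nat S E))))"
    have E: "?E 0 = V" "?E 1 = v" "?E 2 = s" "?E 4 = S"
      by (simp_all add: eval_nat_numeral)
    have "sat \<S> e ?E (is_function 0 (product (Elements 4) Fml) Bits)"
      unfolding sat_is_function E using V(3,4,5)
      by (simp add: included_def product_def eval_nat_numeral) blast
    moreover have "sat \<S> e ?E (included 1 (Elements 0))"
      using V(2) by (auto simp: included_def)
    moreover have "sat \<S> e ?E (is_valuation 0 4 2)"
      unfolding sat_is_valuation E using calculation(1) V(6,7,8,9) by blast
    ultimately show ?thesis
      using V(1) by (intro bexI[of _ V]) simp_all
    qed
  qed
  then show ?thesis
    unfolding valid_def valuation_extension_lemma_def by (auto simp del: sat_is_function)
qed

end

section \<open>The term model\<close>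

lemma Henkin_mono: "Henkin T H \<Longrightarrow> T' \<subseteq> T \<Longrightarrow> Henkin T' H"
  unfolding Henkin_def by (meson derives_mono)

lemma Henkin_separation:
  assumes "\<not> (T \<turnstile> \<phi>)"
  obtains H where "Henkin T H" "\<phi> \<notin> H"
proof -
  have "\<not> derives T [\<^bold>\<not> \<phi>] Bot"
    using assms derives.Classical unfolding provable_def by blast
  then obtain H where H: "Henkin T H" "set [\<^bold>\<not> \<phi>] \<subseteq> H"
    by (rule Henkin_extension)
  moreover have "\<phi> \<notin> H"
    using H Henkin_Imp[OF H(1)] Henkin_Bot[OF H(1)] by simp
  ultimately show ?thesis using that by blast
qed

text \<open>
  The consistency of \<open>RCA\<^sub>0\<close> makes the choice meaningful even if \<open>ACA\<^sub>0'\<close> proves the lemma, so that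
  the term model is in any case a model of \<open>RCA\<^sub>0\<close>.
\<close>

definition term_theory :: "fm set" where
  "term_theory = (SOME H. Henkin RCA0 H
    \<and> (\<not> (ACA0' \<turnstile> valuation_extension_lemma) \<longrightarrow> Henkin ACA0' H \<and> valuation_extension_lemma \<notin> H))"

lemma term_theory:
  shows Henkin_term_theory: "Henkin RCA0 term_theory"
    and term_theory_separates: "\<not> (ACA0' \<turnstile> valuation_extension_lemma) \<Longrightarrow>
      Henkin ACA0' term_theory \<and> valuation_extension_lemma \<notin> term_theory"
proof -
  have "\<exists>H. Henkin RCA0 H
    \<and> (\<not> (ACA0' \<turnstile> valuation_extension_lemma) \<longrightarrow> Henkin ACA0' H \<and> valuation_extension_lemma \<notin> H)"
  proof (cases "ACA0' \<turnstile> valuation_extension_lemma")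
    case True
    have "\<not> derives RCA0 [] Bot"
      using soundness[of RCA0 "[]" Bot "UNIV :: nat set set" "\<lambda>_. {}" "\<lambda>_. 0"] RCA0_standard by auto
    then obtain H where "Henkin RCA0 H" using Henkin_extension by blast
    with True show ?thesis by blast
  next
    case False
    then obtain H where "Henkin ACA0' H" "valuation_extension_lemma \<notin> H"
      by (rule Henkin_separation)
    moreover from this have "Henkin RCA0 H"
      using Henkin_mono unfolding ACA0'_def by blast
    ultimately show ?thesis by blast
  qed
  from someI_ex[OF this, folded term_theory_def]
  show "Henkin RCA0 term_theory" "\<not> (ACA0' \<turnstile> valuation_extension_lemma) \<Longrightarrow>
      Henkin ACA0' term_theory \<and> valuation_extension_lemma \<notin> term_theory"
    by blast+
qed

lemma inst_shift [simp]: "tsub (case_nat t Var) (shift (Suc 0) u) = u"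
  by (simp add: shift_def tsub_tsub)

definition term_eq :: "tm \<Rightarrow> tm \<Rightarrow> bool" where
  "term_eq t u \<longleftrightarrow> (t \<^bold>= u) \<in> term_theory"

lemma term_eq_refl: "term_eq t t"
  unfolding term_eq_def by (rule Henkin_refl[OF Henkin_term_theory])

lemma term_eq_subst: "term_eq t u \<Longrightarrow> inst t \<phi> \<in> term_theory \<Longrightarrow> inst u \<phi> \<in> term_theory"
  unfolding term_eq_def by (rule Henkin_subst[OF Henkin_term_theory])

lemma term_eq_sym: "term_eq t u \<Longrightarrow> term_eq u t"
  using term_eq_subst[of t u "Var 0 \<^bold>= shift 1 t"] term_eq_refl[of t] by (simp add: term_eq_def inst_def)

lemma term_eq_trans: "term_eq t u \<Longrightarrow> term_eq u w \<Longrightarrow> term_eq t w"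
  using term_eq_subst[of u w "shift 1 t \<^bold>= Var 0"] by (simp add: term_eq_def inst_def)

\<comment> \<open>A type cannot be introduced inside a proof by contradiction. Hence the model is
  built once and for all from \<open>term_theory\<close>, which was chosen to fit either
  case.\<close>
quotient_type term_number = tm / term_eq
  by (intro equivpI reflpI sympI transpI) (fact term_eq_refl term_eq_sym term_eq_trans | blast intro: term_eq_refl term_eq_sym term_eq_trans)+

text \<open>One argument is replaced at a time by the Leibniz rule, with \<open>Var 0\<close>
  marking the place of replacement.\<close>

lemma term_eq_cong:
  assumes "term_eq t t'" "term_eq u u'"
  shows "term_eq (t \<^bold>+ u) (t' \<^bold>+ u')" "term_eq (t \<^bold>* u) (t' \<^bold>* u')"
    "(t \<^bold>< u) \<in> term_theory \<longleftrightarrow> (t' \<^bold>< u') \<in> term_theory"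
proof -
  have "term_eq (t \<^bold>+ u) (t' \<^bold>+ u)"
    using term_eq_subst[OF assms(1), of "shift 1 (t \<^bold>+ u) \<^bold>= Var 0 \<^bold>+ shift 1 u"] term_eq_refl[of "t \<^bold>+ u"]
    by (simp add: term_eq_def inst_def)
  moreover have "term_eq (t' \<^bold>+ u) (t' \<^bold>+ u')"
    using term_eq_subst[OF assms(2), of "shift 1 (t' \<^bold>+ u) \<^bold>= shift 1 t' \<^bold>+ Var 0"] term_eq_refl[of "t' \<^bold>+ u"]
    by (simp add: term_eq_def inst_def)
  ultimately show "term_eq (t \<^bold>+ u) (t' \<^bold>+ u')" by (rule term_eq_trans)
  have "term_eq (t \<^bold>* u) (t' \<^bold>* u)"
    using term_eq_subst[OF assms(1), of "shift 1 (t \<^bold>* u) \<^bold>= Var 0 \<^bold>* shift 1 u"] term_eq_refl[of "t \<^bold>* u"]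
    by (simp add: term_eq_def inst_def)
  moreover have "term_eq (t' \<^bold>* u) (t' \<^bold>* u')"
    using term_eq_subst[OF assms(2), of "shift 1 (t' \<^bold>* u) \<^bold>= shift 1 t' \<^bold>* Var 0"] term_eq_refl[of "t' \<^bold>* u"]
    by (simp add: term_eq_def inst_def)
  ultimately show "term_eq (t \<^bold>* u) (t' \<^bold>* u')" by (rule term_eq_trans)
  have less: "(t' \<^bold>< u') \<in> term_theory"
    if "(t \<^bold>< u) \<in> term_theory" "term_eq t t'" "term_eq u u'" for t u t' u'
    using that term_eq_subst[of t t' "Var 0 \<^bold>< shift 1 u"] term_eq_subst[of u u' "shift 1 t' \<^bold>< Var 0"]
    by (simp add: inst_def)
  show "(t \<^bold>< u) \<in> term_theory \<longleftrightarrow> (t' \<^bold>< u') \<in> term_theory"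
    using less assms term_eq_sym by blast
qed

lemma term_eq_mem: "term_eq t u \<Longrightarrow> (t \<^bold>\<in> X) \<in> term_theory \<longleftrightarrow> (u \<^bold>\<in> X) \<in> term_theory"
  using term_eq_subst[of t u "Var 0 \<^bold>\<in> X"] term_eq_subst[of u t "Var 0 \<^bold>\<in> X"] term_eq_sym[of t u]
  by (auto simp: inst_def)

instantiation term_number :: "{zero, one, plus, times, ord, minus}"
begin

lift_definition zero_term_number :: term_number is Zero .
lift_definition one_term_number :: term_number is One .
lift_definition plus_term_number :: "term_number \<Rightarrow> term_number \<Rightarrow> term_number" is Add
  by (rule term_eq_cong(1))
lift_definition times_term_number :: "term_number \<Rightarrow> term_number \<Rightarrow> term_number" is Mul
  by (rule term_eq_cong(2))
lift_definition less_term_number :: "term_number \<Rightarrow> term_number \<Rightarrow> bool" is "\<lambda>t u. (t \<^bold>< u) \<in> term_theory"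
  by (rule term_eq_cong(3))
definition less_eq_term_number :: "term_number \<Rightarrow> term_number \<Rightarrow> bool" where
  "less_eq_term_number x y \<longleftrightarrow> x < y \<or> x = y"
definition minus_term_number :: "term_number \<Rightarrow> term_number \<Rightarrow> term_number" where
  "minus_term_number x y = (if y \<le> x then THE z. x = y + z else 0)"

instance ..

end

lift_definition term_mem :: "nat \<Rightarrow> term_number \<Rightarrow> bool" is "\<lambda>X t. (t \<^bold>\<in> X) \<in> term_theory"
  by (rule term_eq_mem)

definition term_sets :: "term_number set set" where
  "term_sets = range (\<lambda>X. Collect (term_mem X))"

lemma ev_term: "ev (\<lambda>n. abs_term_number (e n)) t = abs_term_number (tsub e t)"
  by (induction t) (simp_all add: zero_term_number.abs_eq one_term_number.abs_eq
      plus_term_number.abs_eq times_term_number.abs_eq)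

text \<open>The truth lemma. Elements are classes of terms and sets are named by set variables, so
  the Henkin witnesses of both sorts give the quantifier cases.\<close>

lemma sat_term:
  "sat term_sets (\<lambda>n. abs_term_number (e n)) (\<lambda>n. Collect (term_mem (E n))) \<phi> \<longleftrightarrow> nsub e (ssub E \<phi>) \<in> term_theory"
proof (induction \<phi> arbitrary: e E)
  case (Eq t u)
  show ?case by (simp add: ev_term term_number.abs_eq_iff term_eq_def)
next
  case (Less t u)
  show ?case by (simp add: ev_term less_term_number.abs_eq)
next
  case (Mem t X)
  show ?case by (simp add: ev_term term_mem.abs_eq)
next
  case Bot
  show ?case by (simp add: Henkin_Bot[OF Henkin_term_theory])
next
  case (Imp \<phi> \<psi>)
  then show ?case by (simp add: Henkin_Imp[OF Henkin_term_theory])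
next
  case (AllN \<phi>)
  have "case_nat (abs_term_number t) (\<lambda>n. abs_term_number (e n)) = (\<lambda>n. abs_term_number (case_nat t e n))" for t
    by (rule ext) (simp split: nat.split)
  moreover have "(\<forall>x. P x) \<longleftrightarrow> (\<forall>t. P (abs_term_number t))" for P
    by (metis term_number.abs_induct)
  ultimately show ?case
    by (simp add: AllN.IH Henkin_AllN[OF Henkin_term_theory] inst_nsub_under)
next
  case (AllS \<phi>)
  have "case_nat (Collect (term_mem X)) (\<lambda>n. Collect (term_mem (E n))) = (\<lambda>n. Collect (term_mem (case_nat X E n)))" for X
    by (rule ext) (simp split: nat.split)
  moreover have "instS X (nsub e (ssub (underS E) \<phi>)) = nsub e (ssub (case_nat X E) \<phi>)" for X
    by (simp add: instS_def ssub_nsub) (simp add: instS_def[symmetric] instS_ssub_underS)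
  moreover have "(\<forall>X\<in>term_sets. P X) \<longleftrightarrow> (\<forall>n. P (Collect (term_mem n)))" for P
    by (simp add: term_sets_def)
  ultimately show ?case
    by (simp add: AllS.IH Henkin_AllS[OF Henkin_term_theory])
qed

lemma valid_term:
  assumes "Henkin T term_theory" "\<phi> \<in> T"
  shows "valid term_sets \<phi>"
  unfolding valid_def
proof (intro allI impI)
  fix e :: "nat \<Rightarrow> term_number" and E :: "nat \<Rightarrow> term_number set"
  assume "range E \<subseteq> term_sets"
  then have "\<forall>n. \<exists>X. E n = Collect (term_mem X)"
    by (auto simp: term_sets_def)
  then obtain E' where "\<And>n. E n = Collect (term_mem (E' n))" by metis
  moreover have "\<exists>t. x = abs_term_number t" for x
    by (induction x rule: term_number.abs_induct) blast
  then have "\<forall>n. \<exists>t. e n = abs_term_number t" by blast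
  from choice[OF this] obtain e' where "\<forall>n. e n = abs_term_number (e' n)" ..
  ultimately have "E = (\<lambda>n. Collect (term_mem (E' n)))" "e = (\<lambda>n. abs_term_number (e' n))"
    by auto
  then show "sat term_sets e E \<phi>"
    using Henkin_axiom[OF assms] by (simp add: sat_term)
qed

interpretation term_model: rca0 term_sets
proof
  show "term_sets \<noteq> {}" by (simp add: term_sets_def)
  show "valid term_sets \<phi>" if "\<phi> \<in> RCA0" for \<phi>
    by (rule valid_term[OF Henkin_term_theory that])
qed

text \<open>This rests on \<open>RCA0\<close> alone and is therefore available whether or not
  \<open>ACA0'\<close> proves the lemma.\<close>

instance term_number :: discrete_semiring
  by (rule discrete_semiring.intro_of_class term_model.discrete_semiring less_eq_term_number_def minus_term_number_def)+

theorem theorem3p32: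
  shows "ACA0' \<turnstile> valuation_extension_lemma"
proof (rule ccontr)
  assume "\<not> (ACA0' \<turnstile> valuation_extension_lemma)"
  from term_theory_separates[OF this]
  have H: "Henkin ACA0' term_theory" and "valuation_extension_lemma \<notin> term_theory" by blast+
  interpret aca0_model term_sets
    by unfold_locales (rule valid_term[OF H], simp add: ACA0'_def jump_axiom_def)
  have "range (\<lambda>n. Collect (term_mem n)) \<subseteq> term_sets"
    by (simp add: term_sets_def)
  \<comment> \<open>Every variable denotes itself here, so the truth lemma turns truth into
    membership of the sentence itself.\<close>
  then have "sat term_sets (\<lambda>n. abs_term_number (Var n)) (\<lambda>n. Collect (term_mem n)) valuation_extension_lemma"
    using valid_valuation_extension_lemma unfolding valid_def by blast
  then have "nsub Var (ssub (\<lambda>n. n) valuation_extension_lemma) \<in> term_theory"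
    using sat_term[of Var "\<lambda>n. n"] by blast
  with \<open>_ \<notin> term_theory\<close> show False by simp
qed

end
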